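(* Let $G$ be a finite group such that $60 \leq Sub(G) \leq 75$. Then $G$ is solvable.
   Context: For a finite group $G$, $Sub(G)$ denotes the number of subgroups of $G$, including the trivial subgroup and $G$ itself (subgroups are counted as subsets, not up to conjugacy or isomorphism). *)

theory Defs
  imports "HOL-Algebra.Algebra"
begin

(* Subgroups are counted as subsets of the carrier. For an infinite family of
   subgroups, card yields 0; for finite G this case does not arise. *)
definition Sub :: "('a, 'b) monoid_scheme \<Rightarrow> nat"
  where "Sub G = card {H. subgroup H G}"

end

theory Submission
  imports Defs "HOL-Number_Theory.Cong"
begin

text \<open>
A finite nonsolvable group with at most 75 subgroups is simple of order 60, and such a group has
exactly 59 subgroups. So no nonsolvable group has between 60 and 75 subgroups.

The first claim goes by induction on the order of \<open>G\<close>. If \<open>N\<close> is a proper nontrivial normal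
subgroup, then \<open>N\<close> or the quotient by \<open>N\<close> is nonsolvable, has at most 75 subgroups, and is therefore
simple of order 60 with 59 subgroups. Both cases give at least 76 subgroups of \<open>G\<close>. If the quotient is
simple of order 60, its subgroups of two suitable prime orders lift to subgroups that do not contain
\<open>N\<close>; there are at least 17 of these, with the trivial subgroup, besides the 59 subgroups above \<open>N\<close>
(\<open>Sub_ge_76_of_quotient\<close>; the bound is attained by \<open>SL(2,5)\<close>). If \<open>N\<close> is simple of order 60, the
Frattini argument shows that the normalizers in \<open>G\<close> of the \<open>10 + 6\<close> Sylow subgroups of \<open>N\<close> for 3 and
5 do not lie in \<open>N\<close>, and neither does \<open>G\<close> (\<open>Sub_ge_76_of_normal\<close>).

There remains a nonabelian simple group \<open>G\<close> of order \<open>n\<close>. A proper subgroup of index \<open>m\<close> embeds \<open>G\<close>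
into the alternating group of degree \<open>m\<close>, so \<open>2 n\<close> divides \<open>m!\<close> (\<open>index_half_fact\<close>). Hence every
conjugacy class of nontrivial proper subgroups is large compared with \<open>n\<close>, while there is at least one
class for each prime power dividing \<open>n\<close> and one more for each Sylow normalizer that is not a Sylow
subgroup (\<open>subgroup_count\<close>). These constraints leave about 500 values of \<open>n\<close>. A verified sieve checks
the possible Sylow numbers of each (\<open>sieve_sound\<close>, \<open>sieve_result\<close>), and only thirteen orders remain.
Twelve of them are excluded by counting elements or by looking at Sylow normalizers
(\<open>order_60\<close>).

For order 60 the same methods determine the number of subgroups of each order (\<open>Sub_60\<close>).
\<close>

section \<open>Actions and fixed points modulo a prime\<close>

text \<open>The hidden constant is the notion of a prime element of an abstract monoid; here primes are numbers.\<close>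

hide_const (open) Divisibility.prime

locale finite_group = group +
  assumes fin [simp]: "finite (carrier G)"

context group
begin

text \<open>The acting set \<open>H\<close> is a parameter, so that one map can be used as an action of the whole group, of
a Sylow subgroup and of a normalizer.\<close>

definition acts_on :: "'a set \<Rightarrow> ('a \<Rightarrow> 'x \<Rightarrow> 'x) \<Rightarrow> 'x set \<Rightarrow> bool"
  where "acts_on H act A \<longleftrightarrow> (\<forall>x\<in>A. act \<one> x = x \<and> (\<forall>g\<in>H. act g x \<in> A) \<and>
     (\<forall>g\<in>H. \<forall>h\<in>H. act (g \<otimes> h) x = act g (act h x)))"

lemma acts_onD:
  assumes "acts_on H act A" "x \<in> A"
  shows "act \<one> x = x" "g \<in> H \<Longrightarrow> act g x \<in> A"
    "g \<in> H \<Longrightarrow> h \<in> H \<Longrightarrow> act (g \<otimes> h) x = act g (act h x)"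
  using assms unfolding acts_on_def by simp_all

lemma acts_on_subgroup: "acts_on H act A \<Longrightarrow> K \<subseteq> H \<Longrightarrow> acts_on K act A"
  unfolding acts_on_def by blast

lemma acts_on_inv_cancel:
  assumes "acts_on H act A" "subgroup H G" "x \<in> A" "g \<in> H"
  shows "act (inv g) (act g x) = x" "act g (act (inv g) x) = x"
proof -
  have g: "g \<in> carrier G" "inv g \<in> H"
    using assms subgroup.mem_carrier subgroup.m_inv_closed by fastforce+
  have "act (inv g) (act g x) = act (inv g \<otimes> g) x" "act g (act (inv g) x) = act (g \<otimes> inv g) x"
    using assms g unfolding acts_on_def by metis+
  with g assms show "act (inv g) (act g x) = x" "act g (act (inv g) x) = x"
    unfolding acts_on_def by simp_all
qed

lemma stabilizer_is_subgroup:
  assumes "acts_on H act A" "subgroup H G" "x \<in> A"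
  shows "subgroup {g \<in> H. act g x = x} G"
proof (rule subgroupI)
  show "{g \<in> H. act g x = x} \<subseteq> carrier G"
    using subgroup.subset[OF assms(2)] by blast
  show "{g \<in> H. act g x = x} \<noteq> {}"
    using assms subgroup.one_closed unfolding acts_on_def by fastforce
next
  fix a assume a: "a \<in> {g \<in> H. act g x = x}"
  then show "inv a \<in> {g \<in> H. act g x = x}"
    using acts_on_inv_cancel(1)[OF assms, of a] subgroup.m_inv_closed[OF assms(2)] by auto
next
  fix a b assume "a \<in> {g \<in> H. act g x = x}" "b \<in> {g \<in> H. act g x = x}"
  then show "a \<otimes> b \<in> {g \<in> H. act g x = x}"
    using assms subgroup.m_closed unfolding acts_on_def by fastforce
qed

lemma orbit_stabilizer:
  assumes act: "acts_on H act A" and H: "subgroup H G" and x: "x \<in> A" and finH: "finite H"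
  shows "card ((\<lambda>g. act g x) ` H) * card {g \<in> H. act g x = x} = card H"
proof -
  let ?S = "{g \<in> H. act g x = x}"
  have fibre: "card {g \<in> H. act g x = y} = card ?S" if y: "y \<in> (\<lambda>g. act g x) ` H" for y
  proof -
    obtain g0 where g0: "g0 \<in> H" "y = act g0 x" using y by blast
    have "bij_betw (\<lambda>s. g0 \<otimes> s) ?S {g \<in> H. act g x = y}"
    proof (rule bij_betw_byWitness[where f' = "\<lambda>g. inv g0 \<otimes> g"])
      show "\<forall>a\<in>?S. inv g0 \<otimes> (g0 \<otimes> a) = a" "\<forall>a'\<in>{g \<in> H. act g x = y}. g0 \<otimes> (inv g0 \<otimes> a') = a'"
        using g0 subgroup.mem_carrier[OF H] by (auto simp: m_assoc[symmetric])
      show "(\<otimes>) g0 ` ?S \<subseteq> {g \<in> H. act g x = y}"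
        using g0 act x subgroup.m_closed[OF H] unfolding acts_on_def by auto
      have "act (inv g0) y = x" using acts_on_inv_cancel(1)[OF act H x] g0 by simp
      then show "(\<otimes>) (inv g0) ` {g \<in> H. act g x = y} \<subseteq> ?S"
        using g0 act x subgroup.m_closed[OF H] subgroup.m_inv_closed[OF H]
        unfolding acts_on_def by auto
    qed
    then show ?thesis by (simp add: bij_betw_same_card)
  qed
  have "card H = (\<Sum>y\<in>(\<lambda>g. act g x) ` H. card {g \<in> H. act g x = y})"
    using sum.image_gen[OF finH, of "\<lambda>_. 1::nat" "\<lambda>g. act g x"] by simp
  also have "\<dots> = (\<Sum>y\<in>(\<lambda>g. act g x) ` H. card ?S)"
    using fibre by (intro sum.cong) auto
  finally show ?thesis by simp
qed

lemma acts_on_orbit: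
  assumes "acts_on H act A" "subgroup H G" "x \<in> A"
  shows "acts_on H act ((\<lambda>g. act g x) ` H)"
  unfolding acts_on_def
proof (intro ballI conjI)
  fix y assume "y \<in> (\<lambda>g. act g x) ` H"
  then obtain h where h: "h \<in> H" "y = act h x" by blast
  have yA: "y \<in> A" unfolding h(2) by (rule acts_onD(2)[OF assms(1,3) h(1)])
  show "act \<one> y = y" by (rule acts_onD(1)[OF assms(1) yA])
  fix g assume g: "g \<in> H"
  have "act g y = act (g \<otimes> h) x" unfolding h(2) by (rule acts_onD(3)[OF assms(1,3) g h(1), symmetric])
  then show "act g y \<in> (\<lambda>g. act g x) ` H" using subgroup.m_closed[OF assms(2) g h(1)] by blast
  fix g' assume g': "g' \<in> H"
  show "act (g \<otimes> g') y = act g (act g' y)" by (rule acts_onD(3)[OF assms(1) yA g g'])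
qed

lemma orbit_closed:
  assumes "acts_on H act A" "subgroup H G" "x \<in> A"
  shows "acts_on H act (A - (\<lambda>g. act g x) ` H)"
proof -
  have "act g y \<notin> (\<lambda>g. act g x) ` H" if "y \<in> A" "y \<notin> (\<lambda>g. act g x) ` H" "g \<in> H" for g y
  proof
    assume "act g y \<in> (\<lambda>g. act g x) ` H"
    then obtain h where h: "h \<in> H" "act g y = act h x" by blast
    have "y = act (inv g) (act h x)"
      using acts_on_inv_cancel(1)[OF assms(1,2) that(1,3)] h by simp
    also have "\<dots> = act (inv g \<otimes> h) x"
      using assms h that subgroup.m_inv_closed unfolding acts_on_def by metis
    finally show False
      using that h subgroup.m_closed[OF assms(2)] subgroup.m_inv_closed[OF assms(2)] by blast
  qed
  then show ?thesis using assms(1) unfolding acts_on_def by auto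
qed

text \<open>Remove the orbits of length greater than 1 one by one: their lengths divide a power of \<open>p\<close>.\<close>

lemma p_group_fixed_points:
  assumes p: "prime p" and H: "subgroup H G" "card H = p ^ k"
    and "finite A" "acts_on H act A"
  shows "[card A = card {x \<in> A. \<forall>g\<in>H. act g x = x}] (mod p)"
  using assms(4,5)
proof (induction "card A" arbitrary: A rule: less_induct)
  case less
  have finH: "finite H"
    using H p by (metis card.infinite power_eq_0_iff not_prime_0)
  show ?case
  proof (cases "\<forall>x\<in>A. \<forall>g\<in>H. act g x = x")
    case True
    then have "{x \<in> A. \<forall>g\<in>H. act g x = x} = A" by blast
    then show ?thesis by simp
  next
    case False
    then obtain x g where x: "x \<in> A" "g \<in> H" "act g x \<noteq> x" by blast
    let ?O = "(\<lambda>g. act g x) ` H"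
    have xO: "x \<in> ?O" "act g x \<in> ?O"
      using x less.prems subgroup.one_closed[OF H(1)] unfolding acts_on_def by (force, blast)
    have OA: "?O \<subseteq> A" using x less.prems unfolding acts_on_def by blast
    have finO: "finite ?O" using finH by blast
    have "card ?O dvd p ^ k"
      using orbit_stabilizer[OF less.prems(2) H(1) x(1) finH] H(2) by (metis dvd_triv_left)
    then obtain j where j: "card ?O = p ^ j" using divides_primepow_nat[OF p] by blast
    have "card ?O \<noteq> 1"
      using xO x(3) by (metis card_1_singletonE singletonD)
    with j have pO: "p dvd card ?O" by (cases j) auto
    let ?B = "A - ?O"
    have cB: "card A = card ?B + card ?O"
      using OA finO less.prems(1) by (simp add: card_Diff_subset card_mono)
    moreover have "card ?O > 0" using xO finO card_gt_0_iff by blast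
    ultimately have "[card ?B = card {x \<in> ?B. \<forall>g\<in>H. act g x = x}] (mod p)"
      using less.hyps[of ?B] less.prems orbit_closed[OF less.prems(2) H(1) x(1)] by simp
    moreover have "{x \<in> ?B. \<forall>g\<in>H. act g x = x} = {x \<in> A. \<forall>g\<in>H. act g x = x}"
    proof -
      have "\<not> (\<forall>g\<in>H. act g y = y)" if "y \<in> ?O" for y
      proof
        assume fy: "\<forall>g\<in>H. act g y = y"
        obtain h where h: "h \<in> H" "y = act h x" using \<open>y \<in> ?O\<close> by blast
        have "x = act (inv h) y"
          using acts_on_inv_cancel(1)[OF less.prems(2) H(1) x(1) h(1)] h by simp
        with fy h have "x = y" using subgroup.m_inv_closed[OF H(1)] by force
        with fy x show False by blast
      qed
      then show ?thesis by blast
    qed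
    ultimately have "[card ?B = card {x \<in> A. \<forall>g\<in>H. act g x = x}] (mod p)" by simp
    with cB pO show ?thesis
      by (auto simp: cong_def elim!: dvdE)
  qed
qed

section \<open>Conjugation and normalizers\<close>

definition conj_set :: "'a \<Rightarrow> 'a set \<Rightarrow> 'a set"
  where "conj_set g S = (\<lambda>x. g \<otimes> x \<otimes> inv g) ` S"

text \<open>The normalizer of \<open>S\<close> relative to \<open>H\<close>; all groups in this development are subgroups of one
ambient group, which avoids a change of the carrier.\<close>

definition normalizer_in :: "'a set \<Rightarrow> 'a set \<Rightarrow> 'a set"
  where "normalizer_in H S = {g \<in> H. conj_set g S = S}"

lemma conj_set_mult:
  assumes "g \<in> carrier G" "h \<in> carrier G" "S \<subseteq> carrier G"
  shows "conj_set (g \<otimes> h) S = conj_set g (conj_set h S)"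
proof -
  have "(g \<otimes> h) \<otimes> x \<otimes> inv (g \<otimes> h) = g \<otimes> (h \<otimes> x \<otimes> inv h) \<otimes> inv g" if "x \<in> S" for x
    using assms(1,2) subsetD[OF assms(3) that] by (simp add: m_assoc inv_mult_group)
  then show ?thesis unfolding conj_set_def image_image by (rule image_cong[OF refl])
qed

lemma conj_set_one:
  assumes "S \<subseteq> carrier G"
  shows "conj_set \<one> S = S"
proof -
  have "\<one> \<otimes> x \<otimes> inv \<one> = x" if "x \<in> S" for x
    using subsetD[OF assms that] by simp
  then show ?thesis unfolding conj_set_def by simp
qed

lemma conj_set_subgroup:
  assumes "g \<in> carrier G" "subgroup S G"
  shows "subgroup (conj_set g S) G"
proof (rule subgroupI)
  note sc = subgroup.mem_carrier[OF assms(2)]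
  show "conj_set g S \<subseteq> carrier G" using assms sc unfolding conj_set_def by auto
  show "conj_set g S \<noteq> {}" using subgroup.one_closed[OF assms(2)] unfolding conj_set_def by blast
next
  note sc = subgroup.mem_carrier[OF assms(2)]
  fix a assume "a \<in> conj_set g S"
  then obtain x where x: "x \<in> S" "a = g \<otimes> x \<otimes> inv g" unfolding conj_set_def by blast
  then have "inv a = g \<otimes> inv x \<otimes> inv g"
    using assms sc by (simp add: inv_mult_group m_assoc)
  then show "inv a \<in> conj_set g S"
    using x subgroup.m_inv_closed[OF assms(2)] unfolding conj_set_def by blast
next
  note sc = subgroup.mem_carrier[OF assms(2)]
  fix a b assume "a \<in> conj_set g S" "b \<in> conj_set g S"
  then obtain x y where x: "x \<in> S" "a = g \<otimes> x \<otimes> inv g" "y \<in> S" "b = g \<otimes> y \<otimes> inv g"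
    unfolding conj_set_def by blast
  have "a \<otimes> b = g \<otimes> x \<otimes> (inv g \<otimes> g) \<otimes> y \<otimes> inv g"
    using x assms(1) sc[of x] sc[of y] by (simp only: m_assoc inv_closed m_closed)
  also have "\<dots> = g \<otimes> (x \<otimes> y) \<otimes> inv g"
    using x assms(1) sc[of x] sc[of y] by (simp add: m_assoc)
  finally have "a \<otimes> b = g \<otimes> (x \<otimes> y) \<otimes> inv g" .
  then show "a \<otimes> b \<in> conj_set g S"
    using x subgroup.m_closed[OF assms(2)] unfolding conj_set_def by blast
qed

lemma card_conj_set:
  assumes "g \<in> carrier G" "S \<subseteq> carrier G"
  shows "card (conj_set g S) = card S"
  unfolding conj_set_def
proof (rule card_image, rule inj_onI)
  fix x y assume "x \<in> S" "y \<in> S" "g \<otimes> x \<otimes> inv g = g \<otimes> y \<otimes> inv g"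
  then show "x = y" using assms conjugation_is_inj by blast
qed

lemma conj_set_self:
  assumes "subgroup H G" "g \<in> H" "S \<subseteq> H"
  shows "conj_set g S \<subseteq> H"
proof
  fix y assume "y \<in> conj_set g S"
  then obtain x where "x \<in> H" "y = g \<otimes> x \<otimes> inv g" using assms(3) unfolding conj_set_def by blast
  then show "y \<in> H"
    using subgroup.m_closed[OF assms(1)] subgroup.m_inv_closed[OF assms(1)] assms(2) by simp
qed

lemma conj_set_mem: "x \<in> S \<Longrightarrow> g \<otimes> x \<otimes> inv g \<in> conj_set g S"
  unfolding conj_set_def by blast

lemma acts_on_conj_set:
  assumes "subgroup H G" "\<And>S. S \<in> A \<Longrightarrow> S \<subseteq> carrier G" "\<And>g S. g \<in> H \<Longrightarrow> S \<in> A \<Longrightarrow> conj_set g S \<in> A"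
  shows "acts_on H conj_set A"
  unfolding acts_on_def
proof (intro ballI conjI)
  fix S g h assume S: "S \<in> A"
  show "conj_set \<one> S = S" using conj_set_one assms(2) S by blast
  show "conj_set g S \<in> A" if "g \<in> H" using assms(3) S that by blast
  show "conj_set (g \<otimes> h) S = conj_set g (conj_set h S)" if "g \<in> H" "h \<in> H"
    using conj_set_mult assms(2) S that subgroup.mem_carrier[OF assms(1)] by blast
qed

lemma acts_on_conj_set_subsets:
  assumes "subgroup H G"
  shows "acts_on H conj_set {S. S \<subseteq> carrier G}"
proof (rule acts_on_conj_set[OF assms])
  show "conj_set g S \<in> {S. S \<subseteq> carrier G}" if "g \<in> H" "S \<in> {S. S \<subseteq> carrier G}" for g S
    using conj_set_self[OF subgroup_self] that subgroup.mem_carrier[OF assms] by simp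
qed simp

lemma normalizer_in_subgroup:
  assumes "subgroup H G" "S \<subseteq> carrier G"
  shows "subgroup (normalizer_in H S) G"
proof -
  from stabilizer_is_subgroup[OF acts_on_conj_set_subsets assms(1), of S] assms show ?thesis
    unfolding normalizer_in_def by simp
qed

lemma subset_normalizer_in:
  assumes "subgroup S G" "S \<subseteq> H"
  shows "S \<subseteq> normalizer_in H S"
proof -
  have "conj_set g S = S" if g: "g \<in> S" for g
  proof
    show "conj_set g S \<subseteq> S" using conj_set_self[OF assms(1) g] by blast
    show "S \<subseteq> conj_set g S"
    proof
      fix x assume x: "x \<in> S"
      have "x = g \<otimes> (inv g \<otimes> x \<otimes> g) \<otimes> inv g"
        using conjugation_is_surj subgroup.mem_carrier[OF assms(1)] g x by simp
      moreover have "inv g \<otimes> x \<otimes> g \<in> S"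
        using g x subgroup.m_closed[OF assms(1)] subgroup.m_inv_closed[OF assms(1)] by blast
      ultimately show "x \<in> conj_set g S" using conj_set_mem by metis
    qed
  qed
  then show ?thesis using assms unfolding normalizer_in_def by blast
qed

lemma normalizer_in_mem: "g \<in> normalizer_in H S \<Longrightarrow> x \<in> S \<Longrightarrow> g \<otimes> x \<otimes> inv g \<in> S"
  using conj_set_mem[of x S g] unfolding normalizer_in_def by simp

text \<open>By finiteness, one inclusion is enough for a conjugate to be equal to the subset.\<close>

lemma normalizer_inI:
  assumes "finite S" "S \<subseteq> carrier G" "g \<in> H" "g \<in> carrier G" "\<And>x. x \<in> S \<Longrightarrow> g \<otimes> x \<otimes> inv g \<in> S"
  shows "g \<in> normalizer_in H S"
proof -
  have "conj_set g S \<subseteq> S" using assms(5) unfolding conj_set_def by blast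
  then have "conj_set g S = S"
    using card_conj_set[OF assms(4,2)] assms(1) card_subset_eq by blast
  then show ?thesis using assms(3) unfolding normalizer_in_def by simp
qed

lemma normal_of_normalizer_in:
  assumes S: "subgroup S G" and eq: "normalizer_in (carrier G) S = carrier G"
  shows "S \<lhd> G"
proof -
  have "\<forall>x\<in>carrier G. \<forall>h\<in>S. x \<otimes> h \<otimes> inv x \<in> S"
    using normalizer_in_mem[of _ "carrier G" S] unfolding eq by simp
  then show ?thesis using S normal_inv_iff by blast
qed

lemma conjugates_count:
  assumes "subgroup H G" "finite H" "S \<subseteq> carrier G"
  shows "card ((\<lambda>g. conj_set g S) ` H) * card (normalizer_in H S) = card H"
proof -
  from orbit_stabilizer[OF acts_on_conj_set_subsets assms(1)] assms show ?thesis
    unfolding normalizer_in_def by simp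
qed

lemma card_subgroup_dvd:
  assumes "subgroup K G" "subgroup H G" "K \<subseteq> H"
  shows "card K dvd card H"
proof -
  interpret H: group "G\<lparr>carrier := H\<rparr>" using assms(2) subgroup_imp_group by blast
  have "subgroup K (G\<lparr>carrier := H\<rparr>)" using assms subgroup_incl by blast
  from H.lagrange[OF this] have "card (rcosets\<^bsub>G\<lparr>carrier := H\<rparr>\<^esub> K) * card K = card H"
    unfolding order_def by simp
  then show ?thesis using dvd_triv_right by metis
qed

end

section \<open>Sylow subgroups\<close>

context finite_group
begin

lemma finite_subgroup [simp]: "subgroup H G \<Longrightarrow> finite H"
  using subgroup.subset fin finite_subset by blast

lemma card_subgroup_pos [simp]: "subgroup H G \<Longrightarrow> 0 < card H"
  using subgroup.finite_imp_card_positive fin by blast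

lemma card_dvd_order: "subgroup H G \<Longrightarrow> card H dvd order G"
  using card_subgroup_dvd[OF _ subgroup_self] subgroup.subset unfolding order_def by blast

lemma finite_subgroups [simp]: "finite {H. subgroup H G \<and> P H}"
  by (rule finite_subset[of _ "Pow (carrier G)"]) (use subgroup.subset in auto)

lemma prime_power_subgroup:
  assumes "prime p" "subgroup H G" "p ^ k dvd card H"
  shows "\<exists>K. subgroup K G \<and> K \<subseteq> H \<and> card K = p ^ k"
proof -
  obtain m where "card H = p ^ k * m" using assms(3) by blast
  then have "order (G\<lparr>carrier := H\<rparr>) = p ^ k * m" by (simp add: order_def)
  then obtain K where "subgroup K (G\<lparr>carrier := H\<rparr>)" "card K = p ^ k"
    using sylow_thm[OF assms(1) subgroup_imp_group[OF assms(2)]] assms(2) by fastforce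
  then show ?thesis
    using incl_subgroup[OF assms(2)] subgroup.subset by fastforce
qed

text \<open>The Sylow \<open>p\<close>-subgroups of a subgroup \<open>H\<close> of the ambient group; only \<open>{\<one>}\<close> if \<open>p\<close> does not divide the
order of \<open>H\<close>.\<close>

definition sylows :: "'a set \<Rightarrow> nat \<Rightarrow> 'a set set"
  where "sylows H p = {P. subgroup P G \<and> P \<subseteq> H \<and> card P = p ^ multiplicity p (card H)}"

lemma sylD:
  assumes "P \<in> sylows H p"
  shows "subgroup P G" "P \<subseteq> H" "card P = p ^ multiplicity p (card H)"
  using assms unfolding sylows_def by blast+

lemma finite_syl [simp]: "finite (sylows H p)"
  unfolding sylows_def by simp

lemma syl_nonempty:
  assumes "prime p" "subgroup H G"
  shows "sylows H p \<noteq> {}"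
proof -
  have "p ^ multiplicity p (card H) dvd card H" by (rule multiplicity_dvd)
  from prime_power_subgroup[OF assms this] show ?thesis unfolding sylows_def by blast
qed

text \<open>The orbit of \<open>P\<close> under left translation is the set of left cosets; orbit counting with this stabilizer is
Lagrange's theorem for them.\<close>

lemma stabilizer_of_translation:
  assumes "subgroup P G" "subgroup H G" "P \<subseteq> H"
  shows "{g \<in> H. (\<lambda>x. g \<otimes> x) ` P = P} = P"
proof
  show "{g \<in> H. (\<lambda>x. g \<otimes> x) ` P = P} \<subseteq> P"
  proof
    fix g assume "g \<in> {g \<in> H. (\<lambda>x. g \<otimes> x) ` P = P}"
    moreover then have "g \<otimes> \<one> \<in> P"
      using subgroup.one_closed[OF assms(1)] by blast
    ultimately show "g \<in> P" using subgroup.mem_carrier[OF assms(2)] by simp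
  qed
  show "P \<subseteq> {g \<in> H. (\<lambda>x. g \<otimes> x) ` P = P}"
  proof
    fix g assume g: "g \<in> P"
    have "(\<lambda>x. g \<otimes> x) ` P \<subseteq> P" using g subgroup.m_closed[OF assms(1)] by blast
    moreover have "P \<subseteq> (\<lambda>x. g \<otimes> x) ` P"
    proof
      fix x assume x: "x \<in> P"
      then have "x = g \<otimes> (inv g \<otimes> x)"
        using g subgroup.mem_carrier[OF assms(1)] by (simp add: m_assoc[symmetric])
      then show "x \<in> (\<lambda>x. g \<otimes> x) ` P"
        using g x subgroup.m_closed[OF assms(1)] subgroup.m_inv_closed[OF assms(1)] by blast
    qed
    ultimately show "g \<in> {g \<in> H. (\<lambda>x. g \<otimes> x) ` P = P}" using g assms(3) by blast
  qed
qed

lemma acts_on_translation: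
  assumes H: "subgroup H G"
  shows "acts_on H (\<lambda>g C. (\<lambda>x. g \<otimes> x) ` C) {C. C \<subseteq> carrier G}"
  unfolding acts_on_def
proof (intro ballI conjI)
  fix C g h assume C: "C \<in> {C. C \<subseteq> carrier G}"
  then have C': "\<And>x. x \<in> C \<Longrightarrow> x \<in> carrier G" by blast
  show "(\<lambda>x. \<one> \<otimes> x) ` C = C" using C' by simp
  show "(\<lambda>x. g \<otimes> x) ` C \<in> {C. C \<subseteq> carrier G}" if "g \<in> H"
    using C' subgroup.mem_carrier[OF H that] by auto
  show "(\<lambda>x. g \<otimes> h \<otimes> x) ` C = (\<lambda>x. g \<otimes> x) ` (\<lambda>x. h \<otimes> x) ` C" if "g \<in> H" "h \<in> H"
    using C' that subgroup.mem_carrier[OF H] by (simp add: image_image m_assoc)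
qed

text \<open>A p-subgroup permutes the cosets of a Sylow subgroup; their number is coprime to \<open>p\<close>, so
  one of them stays fixed, and its stabilizer is a conjugate of the Sylow subgroup.\<close>

lemma p_subgroup_in_conjugate:
  assumes p: "prime p" and H: "subgroup H G" and P: "P \<in> sylows H p"
    and K: "subgroup K G" "K \<subseteq> H" "card K = p ^ k"
  shows "\<exists>h\<in>H. K \<subseteq> conj_set h P"
proof -
  note Ps = sylD[OF P]
  let ?act = "\<lambda>g C. (\<lambda>x. g \<otimes> x) ` C"
  let ?A = "(\<lambda>g. ?act g P) ` H"
  have PG: "P \<subseteq> carrier G" using Ps(1) subgroup.subset by blast
  note tr = acts_on_translation[OF H]
  have finA: "finite ?A" using H by simp
  have "card ?A * card {g \<in> H. ?act g P = P} = card H"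
    using orbit_stabilizer[OF tr H, of P] PG H by simp
  then have cA: "card ?A * card P = card H"
    using stabilizer_of_translation[OF Ps(1) H Ps(2)] by simp
  have npd: "\<not> p dvd card ?A"
  proof
    assume "p dvd card ?A"
    then have "p * card P dvd card H" using cA by (metis mult_dvd_mono dvd_refl)
    then have "p ^ Suc (multiplicity p (card H)) dvd card H" using Ps(3) by simp
    then show False
      using p card_subgroup_pos[OF H] by (metis multiplicity_geI not_less_eq_eq not_less_iff_gr_or_eq le_refl neq0_conv not_prime_unit)
  qed
  have "acts_on H ?act ?A" by (rule acts_on_orbit[OF tr H]) (use PG in simp)
  then have aK: "acts_on K ?act ?A" using acts_on_subgroup K by blast
  have "[card ?A = card {C \<in> ?A. \<forall>g\<in>K. ?act g C = C}] (mod p)"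
    by (rule p_group_fixed_points[OF p K(1,3) finA aK])
  with npd have "card {C \<in> ?A. \<forall>g\<in>K. ?act g C = C} \<noteq> 0"
    by (metis cong_0_iff)
  then have "{C \<in> ?A. \<forall>g\<in>K. ?act g C = C} \<noteq> {}" by (metis card.empty)
  then obtain C where C: "C \<in> ?A" "\<forall>g\<in>K. ?act g C = C" by blast
  then obtain h where h: "h \<in> H" "C = ?act h P" by blast
  then have h2: "\<forall>g\<in>K. ?act g (?act h P) = ?act h P" using C by simp
  have "K \<subseteq> conj_set h P"
  proof
    fix g assume g: "g \<in> K"
    have hG: "h \<in> carrier G" "g \<in> carrier G"
      using subgroup.mem_carrier[OF H h(1)] subgroup.mem_carrier[OF K(1) g] by auto
    have "h \<otimes> \<one> \<in> ?act h P" using subgroup.one_closed[OF Ps(1)] by blast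
    then have "g \<otimes> (h \<otimes> \<one>) \<in> ?act g (?act h P)" by blast
    then have "g \<otimes> (h \<otimes> \<one>) \<in> ?act h P" using h2 g by simp
    then obtain x where x: "x \<in> P" "g \<otimes> (h \<otimes> \<one>) = h \<otimes> x" by blast
    then have "g \<otimes> h = h \<otimes> x" using hG by simp
    then have "g = h \<otimes> x \<otimes> inv h"
      using hG x(1) PG by (metis inv_solve_right m_closed subsetD)
    then show "g \<in> conj_set h P" using conj_set_mem[OF x(1)] by simp
  qed
  with h show ?thesis by blast
qed

lemma conj_set_syl:
  assumes "P \<in> sylows H p" "h \<in> H" "subgroup H G"
  shows "conj_set h P \<in> sylows H p"
proof -
  note P = sylD[OF assms(1)]
  have h: "h \<in> carrier G" using subgroup.mem_carrier[OF assms(3,2)] .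
  show ?thesis
    using conj_set_subgroup[OF h P(1)] conj_set_self[OF assms(3,2) P(2)]
      card_conj_set[OF h subgroup.subset[OF P(1)]] P(3) unfolding sylows_def by simp
qed

lemma syl_conjugate:
  assumes p: "prime p" and H: "subgroup H G" and P: "P \<in> sylows H p" and Q: "Q \<in> sylows H p"
  shows "\<exists>h\<in>H. Q = conj_set h P"
proof -
  obtain h where h: "h \<in> H" "Q \<subseteq> conj_set h P"
    using p_subgroup_in_conjugate[OF p H P sylD(1,2,3)[OF Q]] by blast
  have "finite (conj_set h P)" "card Q = card (conj_set h P)"
    using sylD[OF conj_set_syl[OF P h(1) H]] sylD[OF Q] by simp_all
  then have "Q = conj_set h P" using card_subset_eq h(2) by blast
  with h show ?thesis by blast
qed

lemma syl_eq_conjugates: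
  assumes "prime p" "subgroup H G" "P \<in> sylows H p"
  shows "sylows H p = (\<lambda>h. conj_set h P) ` H"
  using syl_conjugate[OF assms] conj_set_syl[OF assms(3) _ assms(2)] by blast

lemma card_syl_normalizer_in:
  assumes "prime p" "subgroup H G" "P \<in> sylows H p"
  shows "card (sylows H p) * card (normalizer_in H P) = card H"
  unfolding syl_eq_conjugates[OF assms]
  by (rule conjugates_count) (use assms sylD[OF assms(3)] subgroup.subset in auto)

lemma card_syl_pos: "prime p \<Longrightarrow> subgroup H G \<Longrightarrow> 0 < card (sylows H p)"
  using syl_nonempty card_gt_0_iff finite_syl by blast

lemma syl_intermediate:
  assumes p: "prime p" and H: "subgroup H G" and K: "subgroup K G" "K \<subseteq> H"
    and P: "P \<in> sylows H p" "P \<subseteq> K"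
  shows "multiplicity p (card K) = multiplicity p (card H)"
    "sylows K p = {Q \<in> sylows H p. Q \<subseteq> K}"
proof -
  have d: "card P dvd card K" "card K dvd card H"
    using card_subgroup_dvd sylD[OF P(1)] P(2) H K by blast+
  have "multiplicity p (card K) \<le> multiplicity p (card H)"
    using dvd_imp_multiplicity_le[OF d(2)] card_subgroup_pos[OF H] by auto
  moreover have "multiplicity p (card H) \<le> multiplicity p (card K)"
    using d(1) sylD(3)[OF P(1)] card_subgroup_pos[OF K(1)] p
    by (metis multiplicity_geI neq0_conv not_prime_unit)
  ultimately show "multiplicity p (card K) = multiplicity p (card H)" by simp
  then show "sylows K p = {Q \<in> sylows H p. Q \<subseteq> K}"
    using K(2) unfolding sylows_def by auto
qed

text \<open>Both are Sylow subgroups of the normalizer of \<open>P\<close>, so they are conjugate there, and \<open>P\<close> has no other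
conjugate in its normalizer.\<close>

lemma syl_in_normalizer_in_eq:
  assumes p: "prime p" and H: "subgroup H G" and P: "P \<in> sylows H p" and Q: "Q \<in> sylows H p"
    and le: "Q \<subseteq> normalizer_in H P"
  shows "Q = P"
proof -
  note Ps = sylD[OF P]
  have N: "subgroup (normalizer_in H P) G" "normalizer_in H P \<subseteq> H"
    using normalizer_in_subgroup[OF H subgroup.subset[OF Ps(1)]] unfolding normalizer_in_def by auto
  have PN: "P \<subseteq> normalizer_in H P" using subset_normalizer_in Ps by blast
  have "P \<in> sylows (normalizer_in H P) p" "Q \<in> sylows (normalizer_in H P) p"
    using syl_intermediate(2)[OF p H N P PN] P Q PN le by auto
  then obtain h where "h \<in> normalizer_in H P" "Q = conj_set h P"
    using syl_conjugate[OF p N(1)] by blast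
  then show ?thesis unfolding normalizer_in_def by simp
qed

lemma acts_on_syl:
  assumes "subgroup H G"
  shows "acts_on H conj_set (sylows H p)"
  by (rule acts_on_conj_set[OF assms]) (use conj_set_syl assms sylD(1) subgroup.subset in blast)+

text \<open>A Sylow subgroup \<open>P\<close> acting by conjugation on all of them fixes only itself, because any fixed \<open>Q\<close>
is normalized by \<open>P\<close>.\<close>

lemma card_syl_cong_1:
  assumes p: "prime p" and H: "subgroup H G"
  shows "[card (sylows H p) = 1] (mod p)"
proof -
  obtain P where P: "P \<in> sylows H p" using syl_nonempty[OF p H] by blast
  note Ps = sylD[OF P]
  have "{Q \<in> sylows H p. \<forall>g\<in>P. conj_set g Q = Q} = {P}"
  proof (intro equalityI subsetI)
    fix Q assume "Q \<in> {Q \<in> sylows H p. \<forall>g\<in>P. conj_set g Q = Q}"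
    then have Q: "Q \<in> sylows H p" "P \<subseteq> normalizer_in H Q" using Ps(2) unfolding normalizer_in_def by auto
    then show "Q \<in> {P}" using syl_in_normalizer_in_eq[OF p H Q(1) P Q(2)] by simp
  next
    fix Q assume "Q \<in> {P}"
    moreover have "P \<subseteq> normalizer_in H P" using subset_normalizer_in Ps by blast
    ultimately show "Q \<in> {Q \<in> sylows H p. \<forall>g\<in>P. conj_set g Q = Q}"
      using P unfolding normalizer_in_def by auto
  qed
  then show ?thesis
    using p_group_fixed_points[OF p Ps(1,3) finite_syl acts_on_subgroup[OF acts_on_syl[OF H] Ps(2)], of p]
    by simp
qed

lemma normalizer_in_facts:
  assumes p: "prime p" and H: "subgroup H G" and P: "P \<in> sylows H p"
  shows "subgroup (normalizer_in H P) G" "P \<subseteq> normalizer_in H P" "normalizer_in H P \<subseteq> H"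
    "card (normalizer_in H P) = card H div card (sylows H p)"
    "p ^ multiplicity p (card H) dvd card H div card (sylows H p)"
proof -
  note Ps = sylD[OF P]
  show N: "subgroup (normalizer_in H P) G" "P \<subseteq> normalizer_in H P" "normalizer_in H P \<subseteq> H"
    using normalizer_in_subgroup[OF H subgroup.subset[OF Ps(1)]] subset_normalizer_in[OF Ps(1,2)]
    unfolding normalizer_in_def by auto
  show c: "card (normalizer_in H P) = card H div card (sylows H p)"
    using card_syl_normalizer_in[OF assms] card_syl_pos[OF p H] by (metis nonzero_mult_div_cancel_left neq0_conv)
  then show "p ^ multiplicity p (card H) dvd card H div card (sylows H p)"
    using card_subgroup_dvd[OF Ps(1) N(1,2)] Ps(3) by simp
qed

lemma card_syl_dvd:
  assumes p: "prime p" and H: "subgroup H G"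
  shows "card (sylows H p) * p ^ multiplicity p (card H) dvd card H"
proof -
  obtain P where P: "P \<in> sylows H p" using syl_nonempty[OF p H] by blast
  have "card P dvd card (normalizer_in H P)"
    using card_subgroup_dvd sylD(1)[OF P] normalizer_in_facts(1,2)[OF p H P] by blast
  then have "card (sylows H p) * card P dvd card (sylows H p) * card (normalizer_in H P)" by (rule mult_dvd_mono[OF dvd_refl])
  then show ?thesis using card_syl_normalizer_in[OF p H P] sylD(3)[OF P] by simp
qed

lemma normalizer_in_inj:
  assumes "prime p" "subgroup H G"
  shows "inj_on (normalizer_in H) (sylows H p)"
proof (rule inj_onI)
  fix P Q assume "P \<in> sylows H p" "Q \<in> sylows H p" "normalizer_in H P = normalizer_in H Q"
  then show "P = Q" using syl_in_normalizer_in_eq[OF assms] normalizer_in_facts(2)[OF assms] by metis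
qed

end

section \<open>Nonabelian simple groups\<close>

locale nonabelian_simple_group = finite_group + simple_group +
  assumes nonabelian: "\<not> comm_group G"

context group
begin

definition centralizer :: "'a \<Rightarrow> 'a set"
  where "centralizer z = {g \<in> carrier G. g \<otimes> z = z \<otimes> g}"

lemma centralizer_subgroup:
  assumes z: "z \<in> carrier G"
  shows "subgroup (centralizer z) G"
proof (rule subgroupI)
  show "centralizer z \<subseteq> carrier G" "centralizer z \<noteq> {}"
    using z unfolding centralizer_def by auto
next
  fix a assume "a \<in> centralizer z"
  then have a: "a \<in> carrier G" "a \<otimes> z = z \<otimes> a" unfolding centralizer_def by auto
  have "inv a \<otimes> z = inv a \<otimes> (z \<otimes> a) \<otimes> inv a" using a z by (simp add: m_assoc)
  also have "\<dots> = inv a \<otimes> (a \<otimes> z) \<otimes> inv a" using a by simp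
  also have "\<dots> = z \<otimes> inv a" using a(1) z by (simp add: m_assoc[symmetric])
  finally show "inv a \<in> centralizer z" using a unfolding centralizer_def by simp
next
  fix a b assume "a \<in> centralizer z" "b \<in> centralizer z"
  then have ab: "a \<in> carrier G" "a \<otimes> z = z \<otimes> a" "b \<in> carrier G" "b \<otimes> z = z \<otimes> b"
    unfolding centralizer_def by auto
  have "a \<otimes> b \<otimes> z = a \<otimes> (z \<otimes> b)" using ab z by (simp add: m_assoc)
  also have "\<dots> = z \<otimes> (a \<otimes> b)" using ab z by (metis m_assoc)
  finally show "a \<otimes> b \<in> centralizer z" using ab unfolding centralizer_def by simp
qed

end

context nonabelian_simple_group
begin

abbreviation n where "n \<equiv> order G"

lemma n_card: "n = card (carrier G)" by (simp add: order_def)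

lemma n_pos [simp]: "0 < n" using order_gt_one by simp

lemma normal_hom_kernel_cases:
  assumes "group_hom G K f"
  shows "kernel G K f = carrier G \<or> kernel G K f = {\<one>}"
  using group_hom.normal_kernel[OF assms] no_real_normal_subgroup by blast

text \<open>Otherwise the kernel is trivial and \<open>G\<close> embeds into a commutative structure.\<close>

lemma hom_to_comm_trivial:
  assumes f: "group_hom G K f" and K: "\<And>a b. a \<in> carrier K \<Longrightarrow> b \<in> carrier K \<Longrightarrow> a \<otimes>\<^bsub>K\<^esub> b = b \<otimes>\<^bsub>K\<^esub> a"
    and g: "g \<in> carrier G"
  shows "f g = \<one>\<^bsub>K\<^esub>"
proof -
  interpret f: group_hom G K f by fact
  have "kernel G K f \<noteq> {\<one>}"
  proof
    assume "kernel G K f = {\<one>}"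
    then have inj: "inj_on f (carrier G)" by (rule f.trivial_ker_imp_inj)
    have "a \<otimes> b = b \<otimes> a" if "a \<in> carrier G" "b \<in> carrier G" for a b
    proof (rule inj_onD[OF inj])
      show "f (a \<otimes> b) = f (b \<otimes> a)" using that K by simp
    qed (use that in auto)
    then have "comm_group G" by unfold_locales auto
    then show False using nonabelian by blast
  qed
  then have "kernel G K f = carrier G" using normal_hom_kernel_cases[OF assms(1)] by blast
  then show ?thesis using g unfolding kernel_def by blast
qed

text \<open>A nontrivial permutation representation on \<open>m\<close> points is faithful, and its composition with the
  sign is trivial, so the group embeds into the alternating group of degree \<open>m\<close>.\<close>

lemma order_dvd_half_fact:
  assumes act: "acts_on (carrier G) act A" and finA: "finite A"
    and g: "g \<in> carrier G" "x \<in> A" "act g x \<noteq> x"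
  shows "2 * n dvd fact (card A)"
proof -
  define m where "m = card A"
  obtain b where b: "bij_betw b {1..m} A"
    using ex_bij_betw_nat_finite_1[OF finA] unfolding m_def by blast
  define c where "c = the_inv_into {1..m} b"
  have bA: "b i \<in> A" if "i \<in> {1..m}" for i using b that bij_betwE by blast
  have cb: "c (b i) = i" if "i \<in> {1..m}" for i
    unfolding c_def using b that by (simp add: bij_betw_def the_inv_into_f_f)
  have bc: "b (c y) = y" "c y \<in> {1..m}" if "y \<in> A" for y
  proof -
    have "y \<in> b ` {1..m}" using b that by (simp add: bij_betw_def)
    then obtain i where "i \<in> {1..m}" "y = b i" by blast
    then show "b (c y) = y" "c y \<in> {1..m}" using cb by simp_all
  qed
  define \<psi> where "\<psi> h i = (if i \<in> {1..m} then c (act h (b i)) else i)" for h i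
  have actA: "act h y \<in> A" if "h \<in> carrier G" "y \<in> A" for h y
    using acts_onD(2)[OF act that(2,1)] .
  have \<psi>_mult: "\<psi> (h \<otimes> k) = \<psi> h \<circ> \<psi> k" if "h \<in> carrier G" "k \<in> carrier G" for h k
  proof
    fix i
    show "\<psi> (h \<otimes> k) i = (\<psi> h \<circ> \<psi> k) i"
    proof (cases "i \<in> {1..m}")
      case True
      note bi = bA[OF True]
      note ki = bc[OF actA[OF that(2) bi]]
      have "\<psi> h (\<psi> k i) = c (act h (b (c (act k (b i)))))"
        unfolding \<psi>_def if_P[OF True] if_P[OF ki(2)] ..
      also have "\<dots> = \<psi> (h \<otimes> k) i"
        unfolding ki(1) \<psi>_def if_P[OF True] acts_onD(3)[OF act bi that] ..
      finally show ?thesis by simp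
    next
      case False
      show ?thesis unfolding \<psi>_def comp_apply if_not_P[OF False] ..
    qed
  qed
  have \<psi>_one: "\<psi> \<one> = id"
    using acts_onD(1)[OF act bA] cb unfolding \<psi>_def by auto
  have \<psi>_in: "\<psi> h i \<in> {1..m}" if "h \<in> carrier G" "i \<in> {1..m}" for h i
    using bc(2)[OF actA[OF that(1) bA[OF that(2)]]] that(2) unfolding \<psi>_def by simp
  have \<psi>_perm: "\<psi> h permutes {1..m}" if h: "h \<in> carrier G" for h
  proof (rule bij_imp_permutes)
    show "bij_betw (\<psi> h) {1..m} {1..m}"
    proof (rule bij_betw_byWitness[where f' = "\<psi> (inv h)"])
      have "\<psi> (inv h) \<circ> \<psi> h = id" "\<psi> h \<circ> \<psi> (inv h) = id"
        using \<psi>_mult[of "inv h" h] \<psi>_mult[of h "inv h"] \<psi>_one h by simp_all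
      then show "\<forall>a\<in>{1..m}. \<psi> (inv h) (\<psi> h a) = a" "\<forall>a\<in>{1..m}. \<psi> h (\<psi> (inv h) a) = a"
        by (metis comp_apply id_apply)+
      show "\<psi> h ` {1..m} \<subseteq> {1..m}" "\<psi> (inv h) ` {1..m} \<subseteq> {1..m}"
        using \<psi>_in h by auto
    qed
    show "\<psi> h i = i" if "i \<notin> {1..m}" for i unfolding \<psi>_def if_not_P[OF that] ..
  qed
  have hom: "group_hom G (sym_group m) \<psi>"
  proof (rule group_hom.intro)
    show "group_hom_axioms G (sym_group m) \<psi>"
      unfolding group_hom_axioms_def hom_def
      using \<psi>_perm \<psi>_mult by (auto simp: sym_group_def)
  qed (auto simp: sym_group_is_group)
  then interpret \<psi>: group_hom G "sym_group m" \<psi> .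
  interpret sg: group_hom "sym_group m" sign_img sign by (rule sign_group_hom)
  have hom2: "group_hom G sign_img (sign \<circ> \<psi>)"
  proof (rule group_hom.intro)
    show "group_hom_axioms G sign_img (sign \<circ> \<psi>)"
      unfolding group_hom_axioms_def using Group.hom_compose[OF \<psi>.homh sg.homh] .
  qed (auto simp: sign_img_is_group)
  \<comment> \<open>The sign is a homomorphism to a commutative group.\<close>
  have even: "\<psi> h \<in> carrier (alt_group m)" if "h \<in> carrier G" for h
  proof -
    have "(sign \<circ> \<psi>) h = \<one>\<^bsub>sign_img\<^esub>"
      by (rule hom_to_comm_trivial[OF hom2 _ that]) (auto simp: sign_img_def)
    then show ?thesis
      using \<psi>_perm[OF that] unfolding alt_group_carrier sign_img_def
      by (auto simp: sign_def split: if_splits)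
  qed
  have moved: "\<psi> g (c x) \<noteq> c x"
  proof
    assume "\<psi> g (c x) = c x"
    then have "c (act g x) = c x" using bc[OF g(2)] unfolding \<psi>_def by simp
    then have "act g x = x" using bc(1)[OF g(2)] bc(1)[OF actA[OF g(1,2)]] by metis
    with g(3) show False by simp
  qed
  then have "\<psi> g \<noteq> \<one>\<^bsub>sym_group m\<^esub>" by (auto simp: sym_group_def)
  then have "kernel G (sym_group m) \<psi> \<noteq> carrier G" using g(1) unfolding kernel_def by blast
  then have "kernel G (sym_group m) \<psi> = {\<one>}" using normal_hom_kernel_cases[OF hom] by blast
  then have "inj_on \<psi> (carrier G)" by (rule \<psi>.trivial_ker_imp_inj)
  then have cn: "card (\<psi> ` carrier G) = n" unfolding n_card by (rule card_image)
  have "card (\<psi> ` carrier G) dvd card (carrier (alt_group m))"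
    by (rule group.card_subgroup_dvd[OF sym_group_is_group \<psi>.img_is_subgroup alt_group_is_subgroup])
      (use even in blast)
  then have nd: "n dvd card (carrier (alt_group m))" unfolding cn .
  have "m \<ge> 2"
  proof -
    have "card {x, act g x} \<le> card A" using finA g actA by (intro card_mono) auto
    then show ?thesis using g(3) unfolding m_def by simp
  qed
  have "2 * n dvd 2 * card (carrier (alt_group m))" by (rule mult_dvd_mono[OF dvd_refl nd])
  also have "2 * card (carrier (alt_group m)) = fact m" by (rule alt_group_card_carrier[OF \<open>m \<ge> 2\<close>])
  finally show ?thesis unfolding m_def .
qed

lemma index_half_fact:
  assumes K: "subgroup K G" "K \<noteq> carrier G"
  shows "2 * n dvd fact (n div card K)"
proof -
  let ?act = "\<lambda>g C. (\<lambda>x. g \<otimes> x) ` C"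
  let ?A = "(\<lambda>g. ?act g K) ` carrier G"
  have KG: "K \<subseteq> carrier G" using K(1) subgroup.subset by blast
  note tr = acts_on_translation[OF subgroup_self]
  have act: "acts_on (carrier G) ?act ?A"
    by (rule acts_on_orbit[OF tr subgroup_self]) (use KG in simp)
  have "card ?A * card {g \<in> carrier G. ?act g K = K} = card (carrier G)"
    by (rule orbit_stabilizer[OF tr subgroup_self]) (use KG in auto)
  then have "card ?A * card K = n"
    unfolding stabilizer_of_translation[OF K(1) subgroup_self KG] n_card .
  then have cA: "card ?A = n div card K"
    using card_subgroup_pos[OF K(1)] by (metis div_mult_self_is_m)
  obtain g where g: "g \<in> carrier G" "g \<notin> K" using K KG by blast
  then have ne: "?act g K \<noteq> K" using stabilizer_of_translation[OF K(1) subgroup_self KG] by blast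
  have KA: "K \<in> ?A"
  proof -
    have "?act \<one> K = K" by (rule acts_onD(1)[OF tr]) (use KG in simp)
    then show ?thesis by (metis (mono_tags, lifting) image_iff one_closed)
  qed
  have "2 * n dvd fact (card ?A)"
    by (rule order_dvd_half_fact[OF act _ g(1) KA ne]) simp
  then show ?thesis unfolding cA .
qed

lemma center_trivial:
  assumes z: "z \<in> carrier G" "centralizer z = carrier G"
  shows "z = \<one>"
proof -
  let ?Z = "{z \<in> carrier G. \<forall>g\<in>carrier G. g \<otimes> z = z \<otimes> g}"
  have c: "z \<in> ?Z \<longleftrightarrow> z \<in> carrier G \<and> z \<in> centralizer g" if "g \<in> carrier G" "\<forall>g\<in>carrier G. z \<in> centralizer g" for z g
    using that unfolding centralizer_def by auto
  have "subgroup ?Z G"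
  proof -
    have e: "?Z = \<Inter> (centralizer ` carrier G)" unfolding centralizer_def by auto
    show ?thesis unfolding e
      by (rule subgroups_Inter) (use centralizer_subgroup in auto)
  qed
  moreover have "\<forall>x\<in>carrier G. \<forall>h\<in>?Z. x \<otimes> h \<otimes> inv x \<in> ?Z"
  proof (intro ballI)
    fix x h assume "x \<in> carrier G" "h \<in> ?Z"
    then have "x \<otimes> h \<otimes> inv x = h" by (simp add: m_assoc)
    then show "x \<otimes> h \<otimes> inv x \<in> ?Z" using \<open>h \<in> ?Z\<close> by simp
  qed
  ultimately have "?Z \<lhd> G" using normal_inv_iff by blast
  then consider "?Z = carrier G" | "?Z = {\<one>}" using no_real_normal_subgroup by blast
  then show ?thesis
  proof cases
    case 1
    have "a \<otimes> b = b \<otimes> a" if "a \<in> carrier G" "b \<in> carrier G" for a b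
    proof -
      have "b \<in> ?Z" using that(2) unfolding 1 .
      then show ?thesis using that(1) by blast
    qed
    then have "comm_group G" by unfold_locales auto
    then show ?thesis using nonabelian by blast
  next
    case 2
    have "z \<in> ?Z" using z unfolding centralizer_def by auto
    then show ?thesis unfolding 2 by simp
  qed
qed

text \<open>Conjugation of a \<open>p\<close>-group on itself has a number of fixed points divisible by \<open>p\<close>, so the centre would
be nontrivial.\<close>

lemma order_not_prime_power:
  assumes p: "prime p"
  shows "n \<noteq> p ^ k"
proof
  assume nk: "n = p ^ k"
  then have k: "k > 0" using order_gt_one by (cases k) auto
  let ?act = "\<lambda>g x. g \<otimes> x \<otimes> inv g"
  have "acts_on (carrier G) ?act (carrier G)"
    unfolding acts_on_def by (auto simp: m_assoc inv_mult_group)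
  then have "[card (carrier G) = card {x \<in> carrier G. \<forall>g\<in>carrier G. ?act g x = x}] (mod p)"
    by (rule p_group_fixed_points[OF p subgroup_self nk[unfolded n_card] fin])
  moreover have "p dvd card (carrier G)" using nk k unfolding n_card by simp
  ultimately have d: "p dvd card {x \<in> carrier G. \<forall>g\<in>carrier G. ?act g x = x}" (is "p dvd card ?F")
    using cong_dvd_iff by blast
  have "?F \<subseteq> {\<one>}"
  proof
    fix x assume x: "x \<in> ?F"
    have "g \<otimes> x = x \<otimes> g" if "g \<in> carrier G" for g
    proof -
      have "g \<otimes> x \<otimes> inv g = x" "x \<in> carrier G" using x that by auto
      then show ?thesis using that by (metis inv_solve_right' m_closed)
    qed
    then show "x \<in> {\<one>}" using center_trivial[of x] x unfolding centralizer_def by auto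
  qed
  moreover have "\<one> \<in> ?F" by simp
  ultimately have "?F = {\<one>}" by blast
  then have "card ?F = 1" by simp
  then have "p dvd 1" using d by simp
  then show False using p by (metis not_prime_unit)
qed

end

section \<open>Counting subgroups and elements\<close>

context finite_group
begin

text \<open>Counting by order makes families of subgroups disjoint for free.\<close>

definition nsub :: "nat \<Rightarrow> nat"
  where "nsub m = card {H. subgroup H G \<and> card H = m}"

lemma sum_nsub_eq:
  assumes "finite M"
  shows "(\<Sum>m\<in>M. nsub m) = card {H. subgroup H G \<and> card H \<in> M}"
proof -
  have "card (\<Union>m\<in>M. {H. subgroup H G \<and> card H = m}) = (\<Sum>m\<in>M. nsub m)"
    unfolding nsub_def by (rule card_UN_disjoint) (use assms in auto)
  moreover have "(\<Union>m\<in>M. {H. subgroup H G \<and> card H = m}) = {H. subgroup H G \<and> card H \<in> M}" by blast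
  ultimately show ?thesis by simp
qed

lemma sum_nsub_le_Sub:
  assumes "finite M"
  shows "(\<Sum>m\<in>M. nsub m) \<le> Sub G"
  unfolding sum_nsub_eq[OF assms] Sub_def
  by (rule card_mono) (use finite_subgroups[of "\<lambda>_. True"] in auto)

lemma Sub_eq_sum_nsub:
  assumes "finite M" "\<And>m. m dvd order G \<Longrightarrow> m \<in> M"
  shows "Sub G = (\<Sum>m\<in>M. nsub m)"
proof -
  have "{H. subgroup H G \<and> card H \<in> M} = {H. subgroup H G}"
    using assms(2) card_dvd_order by blast
  then show ?thesis unfolding sum_nsub_eq[OF assms(1)] Sub_def by simp
qed

lemma nsub_1 [simp]: "nsub 1 = 1"
proof -
  have "{H. subgroup H G \<and> card H = 1} = {{\<one>}}"
  proof (intro equalityI subsetI)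
    fix H assume "H \<in> {H. subgroup H G \<and> card H = 1}"
    then obtain x where "H = {x}" "subgroup H G" using card_1_singletonE by blast
    then show "H \<in> {{\<one>}}" using subgroup.one_closed by fastforce
  qed (simp add: triv_subgroup)
  then show ?thesis unfolding nsub_def by simp
qed

lemma nsub_order [simp]: "nsub (order G) = 1"
proof -
  have "{H. subgroup H G \<and> card H = order G} = {carrier G}"
  proof (intro equalityI subsetI)
    fix H assume "H \<in> {H. subgroup H G \<and> card H = order G}"
    then have "H \<subseteq> carrier G" "card H = card (carrier G)"
      using subgroup.subset by (auto simp: order_def)
    then show "H \<in> {carrier G}" using card_subset_eq[OF fin] by blast
  qed (simp add: subgroup_self order_def)
  then show ?thesis unfolding nsub_def by simp
qed

lemma nsub_ge_of_inj:
  assumes "inj_on f A" "\<And>x. x \<in> A \<Longrightarrow> subgroup (f x) G \<and> card (f x) = m"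
  shows "card A \<le> nsub m"
  unfolding nsub_def by (rule card_inj_on_le[OF assms(1)]) (use assms(2) in auto)

lemma coprime_subgroups_Int:
  assumes "subgroup A G" "subgroup B G" "coprime (card A) (card B)"
  shows "A \<inter> B = {\<one>}"
proof -
  have AB: "subgroup (A \<inter> B) G" using subgroups_Inter_pair assms by blast
  have "card (A \<inter> B) dvd card A" "card (A \<inter> B) dvd card B"
    using card_subgroup_dvd[OF AB] assms by auto
  then have "card (A \<inter> B) = 1" using assms(3) by (metis coprime_common_divisor_nat)
  then obtain x where "A \<inter> B = {x}" using card_1_singletonE by blast
  then show ?thesis using subgroup.one_closed[OF AB] by auto
qed

definition sylow_disjoint :: "'a set \<Rightarrow> nat \<Rightarrow> bool"
  where "sylow_disjoint L p \<longleftrightarrow> (\<forall>P\<in>sylows L p. \<forall>Q\<in>sylows L p. P \<noteq> Q \<longrightarrow> P \<inter> Q = {\<one>})"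

lemma prime_subgroups_Int:
  assumes "prime p" "subgroup P G" "subgroup Q G" "card P = p" "card Q = p" "P \<noteq> Q"
  shows "P \<inter> Q = {\<one>}"
proof -
  have PQ: "subgroup (P \<inter> Q) G" using subgroups_Inter_pair assms by blast
  have "card (P \<inter> Q) dvd p" using card_subgroup_dvd[OF PQ assms(2)] assms by auto
  then consider "card (P \<inter> Q) = 1" | "card (P \<inter> Q) = p"
    using assms(1) by (metis prime_nat_iff)
  then show ?thesis
  proof cases
    case 1
    then obtain x where "P \<inter> Q = {x}" using card_1_singletonE by blast
    then show ?thesis using subgroup.one_closed[OF PQ] by auto
  next
    case 2
    have "P \<inter> Q = P" by (rule card_subset_eq) (use assms 2 in auto)
    moreover have "P \<inter> Q = Q" by (rule card_subset_eq) (use assms 2 in auto)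
    ultimately show ?thesis using assms(6) by simp
  qed
qed

lemma sylow_disjoint_prime:
  assumes "prime p" "multiplicity p (card L) = 1"
  shows "sylow_disjoint L p"
  unfolding sylow_disjoint_def
proof (intro ballI impI)
  fix P Q assume PQ: "P \<in> sylows L p" "Q \<in> sylows L p" "P \<noteq> Q"
  have "card P = p" "card Q = p" using sylD(3)[OF PQ(1)] sylD(3)[OF PQ(2)] assms(2) by simp_all
  then show "P \<inter> Q = {\<one>}"
    using prime_subgroups_Int[OF assms(1) sylD(1)[OF PQ(1)] sylD(1)[OF PQ(2)]] PQ(3) by blast
qed

definition syl_elts :: "'a set \<Rightarrow> nat \<Rightarrow> 'a set"
  where "syl_elts L p = (\<Union>P\<in>sylows L p. P - {\<one>})"

lemma card_syl_elts:
  assumes "sylow_disjoint L p"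
  shows "card (syl_elts L p) = card (sylows L p) * (p ^ multiplicity p (card L) - 1)"
proof -
  have "card (syl_elts L p) = (\<Sum>P\<in>sylows L p. card (P - {\<one>}))"
    unfolding syl_elts_def
    by (rule card_UN_disjoint) (use assms sylD(1) in \<open>auto simp: sylow_disjoint_def\<close>)
  also have "\<dots> = (\<Sum>P\<in>sylows L p. p ^ multiplicity p (card L) - 1)"
  proof (rule sum.cong[OF refl])
    fix P assume "P \<in> sylows L p"
    from sylD[OF this] show "card (P - {\<one>}) = p ^ multiplicity p (card L) - 1"
      by (simp add: subgroup.one_closed)
  qed
  finally show ?thesis by simp
qed

lemma syl_elts_subset: "syl_elts L p \<subseteq> L"
  unfolding syl_elts_def using sylD(2) by blast

lemma syl_elts_disjoint:
  assumes "prime p" "prime q" "p \<noteq> q"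
  shows "syl_elts L p \<inter> syl_elts L q = {}"
proof -
  have "P \<inter> Q = {\<one>}" if "P \<in> sylows L p" "Q \<in> sylows L q" for P Q
  proof (rule coprime_subgroups_Int)
    show "coprime (card P) (card Q)"
      using sylD(3)[OF that(1)] sylD(3)[OF that(2)] primes_coprime[OF assms]
      by (metis coprime_power_left_iff coprime_power_right_iff)
  qed (use sylD(1) that in auto)
  then show ?thesis unfolding syl_elts_def by blast
qed

lemma syl_elts_subgroup_disjoint:
  assumes "prime p" "subgroup H G" "\<not> p dvd card H"
  shows "syl_elts L p \<inter> H = {}"
proof -
  have "P \<inter> H = {\<one>}" if "P \<in> sylows L p" for P
  proof (rule coprime_subgroups_Int)
    show "coprime (card P) (card H)"
      using sylD(3)[OF that] prime_imp_coprime[OF assms(1,3)]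
      by (metis coprime_power_left_iff)
  qed (use sylD(1) that assms in auto)
  then show ?thesis unfolding syl_elts_def by blast
qed

lemma card_UN_syl_elts:
  assumes "finite S" "\<And>p. p \<in> S \<Longrightarrow> prime p" "\<And>p. p \<in> S \<Longrightarrow> sylow_disjoint L p" "subgroup L G"
  shows "card (\<Union>p\<in>S. syl_elts L p) = (\<Sum>p\<in>S. card (sylows L p) * (p ^ multiplicity p (card L) - 1))"
proof -
  have "card (\<Union>p\<in>S. syl_elts L p) = (\<Sum>p\<in>S. card (syl_elts L p))"
  proof (rule card_UN_disjoint[OF assms(1)])
    show "\<forall>p\<in>S. finite (syl_elts L p)"
      using finite_subset[OF syl_elts_subset finite_subgroup[OF assms(4)]] by blast
    show "\<forall>p\<in>S. \<forall>q\<in>S. p \<noteq> q \<longrightarrow> syl_elts L p \<inter> syl_elts L q = {}"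
      using syl_elts_disjoint assms(2) by blast
  qed
  also have "\<dots> = (\<Sum>p\<in>S. card (sylows L p) * (p ^ multiplicity p (card L) - 1))"
    by (rule sum.cong[OF refl]) (use card_syl_elts assms(3) in blast)
  finally show ?thesis .
qed

text \<open>The nontrivial elements of Sylow subgroups for different primes are different, and none of them lies in a
subgroup \<open>H\<close> whose order is prime to all these primes. Where the Sylow subgroups for \<open>p\<close> meet trivially,
their elements can be counted exactly.\<close>

lemma element_count:
  assumes "finite S" "\<And>p. p \<in> S \<Longrightarrow> prime p" "\<And>p. p \<in> S \<Longrightarrow> sylow_disjoint L p" "subgroup L G"
    and H: "subgroup H G" "H \<subseteq> L" "\<And>p. p \<in> S \<Longrightarrow> \<not> p dvd card H"
  shows "(\<Sum>p\<in>S. card (sylows L p) * (p ^ multiplicity p (card L) - 1)) + card H \<le> card L"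
proof -
  let ?U = "\<Union>p\<in>S. syl_elts L p"
  have UL: "?U \<union> H \<subseteq> L" using syl_elts_subset H(2) by blast
  have finL: "finite L" using assms(4) by simp
  have "?U \<inter> H = {}" using syl_elts_subgroup_disjoint[OF _ H(1)] assms(2) H(3) by blast
  moreover have "finite ?U" "finite H" using UL finL finite_subset by blast+
  ultimately have "card (?U \<union> H) = card ?U + card H" by (simp add: card_Un_disjoint)
  moreover have "card (?U \<union> H) \<le> card L" by (rule card_mono[OF finL UL])
  ultimately show ?thesis using card_UN_syl_elts[OF assms(1-4)] by simp
qed

text \<open>When the bound is attained, \<open>H\<close> is the complement of the counted elements, and so is every subgroup of
the same order.\<close>

lemma element_count_unique:
  assumes "finite S" "\<And>p. p \<in> S \<Longrightarrow> prime p" "\<And>p. p \<in> S \<Longrightarrow> sylow_disjoint L p" "subgroup L G"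
    and H: "subgroup H G" "H \<subseteq> L" "\<And>p. p \<in> S \<Longrightarrow> \<not> p dvd card H"
    and K: "subgroup K G" "K \<subseteq> L" "card K = card H"
    and eq: "card L \<le> (\<Sum>p\<in>S. card (sylows L p) * (p ^ multiplicity p (card L) - 1)) + card H"
  shows "K = H"
proof -
  let ?U = "\<Union>p\<in>S. syl_elts L p"
  have finL: "finite L" using assms(4) by simp
  have "J = L - ?U" if J: "subgroup J G" "J \<subseteq> L" "card J = card H" for J
  proof (rule card_subset_eq)
    have "?U \<inter> J = {}"
      using syl_elts_subgroup_disjoint[OF _ J(1)] assms(2) H(3) unfolding J(3) by blast
    then show JU: "J \<subseteq> L - ?U" using J(2) by blast
    have U: "?U \<subseteq> L" using syl_elts_subset by blast
    then have "card (L - ?U) = card L - card ?U"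
      using finL finite_subset by (intro card_Diff_subset) auto
    then have "card (L - ?U) \<le> card J"
      using eq J(3) card_UN_syl_elts[OF assms(1-4)] by simp
    then show "card J = card (L - ?U)" using card_mono[OF _ JU] finL by simp
  qed (use finL in simp)
  from this[OF H(1,2) refl] this[OF K] show ?thesis by simp
qed

lemma normalized_product:
  assumes P: "subgroup P G" and T: "subgroup T G" "T \<subseteq> normalizer_in (carrier G) P"
  defines "K \<equiv> (\<lambda>(x, y). x \<otimes> y) ` (P \<times> T)"
  shows "subgroup K G" "P \<subseteq> K" "T \<subseteq> K" "card K \<le> card P * card T" "K \<subseteq> normalizer_in (carrier G) P"
proof -
  have PG: "x \<in> carrier G" if "x \<in> P" for x using subgroup.mem_carrier[OF P that] .
  have TG: "x \<in> carrier G" if "x \<in> T" for x using subgroup.mem_carrier[OF T(1) that] .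
  have KI: "x \<otimes> y \<in> K" if "x \<in> P" "y \<in> T" for x y using that unfolding K_def by force
  have KE: "\<exists>x\<in>P. \<exists>y\<in>T. k = x \<otimes> y" if "k \<in> K" for k using that unfolding K_def by auto
  have sw: "t \<otimes> x \<otimes> inv t \<in> P" if "x \<in> P" "t \<in> T" for x t
    using normalizer_in_mem[of t "carrier G" P x] that T(2) by blast
  show "subgroup K G"
  proof (rule subgroupI)
    show "K \<subseteq> carrier G" using PG TG unfolding K_def by auto
    show "K \<noteq> {}" using KI[OF subgroup.one_closed[OF P] subgroup.one_closed[OF T(1)]] by blast
  next
    fix a assume "a \<in> K"
    then obtain x y where a: "x \<in> P" "y \<in> T" "a = x \<otimes> y" using KE by blast
    have "inv a = (inv y \<otimes> inv x \<otimes> inv (inv y)) \<otimes> inv y"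
      using a PG[OF a(1)] TG[OF a(2)] by (simp add: inv_mult_group m_assoc)
    moreover have "inv y \<otimes> inv x \<otimes> inv (inv y) \<in> P"
      by (rule sw) (use a subgroup.m_inv_closed[OF P] subgroup.m_inv_closed[OF T(1)] in auto)
    ultimately show "inv a \<in> K" using KI a subgroup.m_inv_closed[OF T(1)] by simp
  next
    fix a b assume "a \<in> K" "b \<in> K"
    then obtain x y u v where ab: "x \<in> P" "y \<in> T" "a = x \<otimes> y" "u \<in> P" "v \<in> T" "b = u \<otimes> v"
      using KE by blast
    note G = PG[OF ab(1)] TG[OF ab(2)] PG[OF ab(4)] TG[OF ab(5)]
    have "inv y \<otimes> (y \<otimes> v) = v" using G by (simp add: m_assoc[symmetric])
    then have "a \<otimes> b = (x \<otimes> (y \<otimes> u \<otimes> inv y)) \<otimes> (y \<otimes> v)"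
      unfolding ab(3,6) using G by (simp add: m_assoc)
    moreover have "x \<otimes> (y \<otimes> u \<otimes> inv y) \<in> P"
      using subgroup.m_closed[OF P] sw ab by blast
    ultimately show "a \<otimes> b \<in> K"
      using KI[of "x \<otimes> (y \<otimes> u \<otimes> inv y)" "y \<otimes> v"] subgroup.m_closed[OF T(1) ab(2,5)] by simp
  qed
  show "P \<subseteq> K"
  proof
    fix x assume "x \<in> P"
    then show "x \<in> K" using KI[OF _ subgroup.one_closed[OF T(1)], of x] PG by simp
  qed
  show "T \<subseteq> K"
  proof
    fix x assume "x \<in> T"
    then show "x \<in> K" using KI[OF subgroup.one_closed[OF P], of x] TG by simp
  qed
  have "card K \<le> card (P \<times> T)"
    unfolding K_def by (rule card_image_le) (use P T in simp)
  then show "card K \<le> card P * card T" by (simp add: card_cartesian_product)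
  have N: "subgroup (normalizer_in (carrier G) P) G"
    by (rule normalizer_in_subgroup[OF subgroup_self subgroup.subset[OF P]])
  have "P \<subseteq> normalizer_in (carrier G) P" by (rule subset_normalizer_in[OF P subgroup.subset[OF P]])
  then show "K \<subseteq> normalizer_in (carrier G) P"
    using KE subgroup.m_closed[OF N] T(2) by blast
qed

text \<open>Cauchy's theorem in the normalizer of a Sylow subgroup \<open>P\<close> gives a subgroup \<open>T\<close> of order \<open>q\<close>. The
product of \<open>P\<close> and \<open>T\<close> lies in this normalizer, so \<open>P\<close> is its only Sylow \<open>p\<close>-subgroup, and
different \<open>P\<close> give different products.\<close>

lemma nsub_sylow_extension:
  assumes p: "prime p" and q: "prime q" "q \<noteq> p"
    and d: "q dvd order G div card (sylows (carrier G) p)"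
  shows "card (sylows (carrier G) p) \<le> nsub (p ^ multiplicity p (order G) * q)"
proof -
  let ?S = "sylows (carrier G) p"
  have ex: "\<exists>K. subgroup K G \<and> card K = p ^ multiplicity p (order G) * q \<and> P \<subseteq> K \<and> K \<subseteq> normalizer_in (carrier G) P"
    if P: "P \<in> ?S" for P
  proof -
    note N = normalizer_in_facts[OF p subgroup_self P]
    have "q ^ 1 dvd card (normalizer_in (carrier G) P)" using d N(4) by (simp add: order_def)
    then obtain T where T: "subgroup T G" "T \<subseteq> normalizer_in (carrier G) P" "card T = q"
      using prime_power_subgroup[OF q(1) N(1), of 1] by auto
    have cP: "card P = p ^ multiplicity p (order G)" using sylD(3)[OF P] by (simp add: order_def)
    obtain K where K: "subgroup K G" "P \<subseteq> K" "T \<subseteq> K" "card K \<le> card P * card T" "K \<subseteq> normalizer_in (carrier G) P"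
      using normalized_product[OF sylD(1)[OF P] T(1,2)] by blast
    have "coprime (card P) (card T)"
      unfolding cP T(3) using primes_coprime[OF p q(1)] q(2) by simp
    moreover have "card P dvd card K" "card T dvd card K"
      using card_subgroup_dvd K sylD(1)[OF P] T(1) by blast+
    ultimately have "card P * card T dvd card K" by (simp add: divides_mult)
    then have "card K = card P * card T"
      using K(4) dvd_imp_le card_subgroup_pos[OF K(1)] le_antisym by blast
    then show ?thesis using K cP T(3) by metis
  qed
  then obtain f where f: "\<And>P. P \<in> ?S \<Longrightarrow> subgroup (f P) G \<and> card (f P) = p ^ multiplicity p (order G) * q
      \<and> P \<subseteq> f P \<and> f P \<subseteq> normalizer_in (carrier G) P" by metis
  have "inj_on f ?S"
  proof (rule inj_onI)
    fix P Q assume PQ: "P \<in> ?S" "Q \<in> ?S" "f P = f Q"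
    then have "Q \<subseteq> normalizer_in (carrier G) P" using f[OF PQ(1)] f[OF PQ(2)] by auto
    then show "P = Q" using syl_in_normalizer_in_eq[OF p subgroup_self PQ(1,2)] by simp
  qed
  then show ?thesis by (rule nsub_ge_of_inj) (use f in blast)
qed

text \<open>The centre is nontrivial, and the centralizer of a noncentral element would lie strictly between the
centre and the group.\<close>

lemma prime_square_commute:
  assumes p: "prime p" and P: "subgroup P G" "card P = p\<^sup>2" and x: "x \<in> P" and y: "y \<in> P"
  shows "x \<otimes> y = y \<otimes> x"
proof -
  let ?act = "\<lambda>g x. g \<otimes> x \<otimes> inv g"
  note PG = subgroup.mem_carrier[OF P(1)]
  have "acts_on P ?act P"
    unfolding acts_on_def
    using PG subgroup.m_closed[OF P(1)] subgroup.m_inv_closed[OF P(1)]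
    by (auto simp: m_assoc inv_mult_group)
  then have c: "[card P = card {x \<in> P. \<forall>g\<in>P. ?act g x = x}] (mod p)"
    by (rule p_group_fixed_points[OF p P(1,2) finite_subgroup[OF P(1)]])
  have comm_iff: "g \<otimes> z \<otimes> inv g = z \<longleftrightarrow> g \<otimes> z = z \<otimes> g" if "g \<in> P" "z \<in> P" for g z
    using PG[OF that(1)] PG[OF that(2)] by (metis inv_solve_right' m_closed)
  let ?Z = "P \<inter> (\<Inter>g\<in>P. centralizer g)"
  have Z: "{x \<in> P. \<forall>g\<in>P. ?act g x = x} = ?Z"
    using comm_iff PG unfolding centralizer_def by auto
  have subZ: "subgroup ?Z G"
  proof -
    have "subgroup (\<Inter>g\<in>P. centralizer g) G"
      by (rule subgroups_Inter) (use centralizer_subgroup PG x in auto)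
    then show ?thesis using subgroups_Inter_pair P(1) by blast
  qed
  have "p dvd card P" using P(2) by (simp add: power2_eq_square)
  then have "p dvd card ?Z" using c cong_dvd_iff unfolding Z by blast
  have "card ?Z dvd p\<^sup>2" using card_subgroup_dvd[OF subZ P(1)] P(2) by auto
  then obtain j where j: "j \<le> 2" "card ?Z = p ^ j" using divides_primepow_nat[OF p] by blast
  have "j \<noteq> 0" using \<open>p dvd card ?Z\<close> j(2) p by (metis not_prime_unit power_0)
  show ?thesis
  proof (cases "x \<in> ?Z")
    case True
    then show ?thesis using y unfolding centralizer_def by auto
  next
    case False
    have "subgroup (P \<inter> centralizer x) G" (is "subgroup ?C G")
      using subgroups_Inter_pair P(1) centralizer_subgroup PG[OF x] by blast
    moreover have ZC: "?Z \<subset> ?C"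
    proof -
      have "x \<in> ?C" using x PG[OF x] unfolding centralizer_def by simp
      then show ?thesis using False x by blast
    qed
    ultimately have C: "subgroup ?C G" "?Z \<subset> ?C" by blast+
    have "card ?Z < card ?C" by (rule psubset_card_mono[OF finite_subgroup[OF C(1)] C(2)])
    moreover have "card ?C dvd p\<^sup>2" using card_subgroup_dvd[OF C(1) P(1)] P(2) by auto
    then obtain i where i: "i \<le> 2" "card ?C = p ^ i" using divides_primepow_nat[OF p] by blast
    ultimately have "j < i" using j(2) p by (metis power_strict_increasing_iff prime_gt_1_nat)
    then have "i = 2" using i j \<open>j \<noteq> 0\<close> by simp
    then have "?C = P" by (intro card_subset_eq) (use i P in auto)
    then have "y \<in> centralizer x" using y by blast
    then show ?thesis unfolding centralizer_def by simp
  qed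
qed

end

section \<open>Constraints on the Sylow numbers of a simple group\<close>

context nonabelian_simple_group
begin

abbreviation n_syl :: "nat \<Rightarrow> nat" where "n_syl p \<equiv> card (sylows (carrier G) p)"

lemma card_conj_class:
  assumes S: "subgroup S G" "S \<noteq> carrier G" "S \<noteq> {\<one>}"
  shows "2 * n dvd fact (card ((\<lambda>g. conj_set g S) ` carrier G))"
proof -
  let ?N = "normalizer_in (carrier G) S"
  have SG: "S \<subseteq> carrier G" using S(1) subgroup.subset by blast
  have N: "subgroup ?N G" by (rule normalizer_in_subgroup[OF subgroup_self SG])
  have "?N \<noteq> carrier G" using normal_of_normalizer_in[OF S(1)] no_real_normal_subgroup S by blast
  then have d: "2 * n dvd fact (n div card ?N)" by (rule index_half_fact[OF N])
  have "card ((\<lambda>g. conj_set g S) ` carrier G) * card ?N = n"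
    unfolding n_card by (rule conjugates_count[OF subgroup_self fin SG])
  then have "card ((\<lambda>g. conj_set g S) ` carrier G) = n div card ?N"
    using card_subgroup_pos[OF N] by (metis div_mult_self_is_m)
  with d show ?thesis by simp
qed

text \<open>One conjugacy class is already that large, by the embedding into an alternating group.\<close>

lemma nsub_ge:
  assumes S: "subgroup S G" "card S = m" "1 < m" "m < n" and d: "\<And>k. 2 * n dvd fact k \<Longrightarrow> d \<le> k"
  shows "d \<le> nsub m"
proof -
  have "S \<noteq> carrier G" "S \<noteq> {\<one>}" using S by (auto simp: n_card)
  then have "d \<le> card ((\<lambda>g. conj_set g S) ` carrier G)" using card_conj_class[OF S(1)] d by blast
  also have "\<dots> \<le> nsub m"
    unfolding nsub_def
  proof (rule card_mono)
    show "(\<lambda>g. conj_set g S) ` carrier G \<subseteq> {H. subgroup H G \<and> card H = m}"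
      using conj_set_subgroup S card_conj_set subgroup.subset[OF S(1)] by auto
  qed simp
  finally show ?thesis .
qed

lemma sylow_order:
  assumes "prime p" "p dvd n"
  shows "0 < multiplicity p n" "1 < p ^ multiplicity p n" "p ^ multiplicity p n < n"
proof -
  show m: "0 < multiplicity p n"
    using assms by (simp add: prime_multiplicity_gt_zero_iff)
  then show "1 < p ^ multiplicity p n" using one_less_power[OF prime_gt_1_nat[OF assms(1)]] by blast
  have "p ^ multiplicity p n \<le> n" by (rule dvd_imp_le[OF multiplicity_dvd n_pos])
  then show "p ^ multiplicity p n < n"
    using order_not_prime_power[OF assms(1), of "multiplicity p n"] by simp
qed

lemma sylD_G:
  assumes "P \<in> sylows (carrier G) p"
  shows "subgroup P G" "card P = p ^ multiplicity p n"
  using sylD[OF assms] by (simp_all add: n_card)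

lemma n_syl_eq_nsub: "nsub (p ^ multiplicity p n) = n_syl p"
proof -
  have "sylows (carrier G) p = {P. subgroup P G \<and> card P = p ^ multiplicity p n}"
    unfolding sylows_def n_card using subgroup.subset by auto
  then show ?thesis unfolding nsub_def by simp
qed

lemma n_syl_half_fact:
  assumes p: "prime p" "p dvd n"
  shows "2 * n dvd fact (n_syl p)"
proof -
  obtain P where P: "P \<in> sylows (carrier G) p" using syl_nonempty[OF p(1) subgroup_self] by blast
  have "P \<noteq> carrier G" "P \<noteq> {\<one>}" using sylD_G[OF P] sylow_order[OF p] by (auto simp: n_card)
  then show ?thesis
    using card_conj_class[OF sylD_G(1)[OF P]] syl_eq_conjugates[OF p(1) subgroup_self P] by simp
qed

lemma half_fact_ge_2: "2 * n dvd fact k \<Longrightarrow> 2 \<le> k"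
proof (rule ccontr)
  assume d: "2 * n dvd fact k" and "\<not> 2 \<le> k"
  then have "k = 0 \<or> k = 1" by linarith
  then have "fact k = (1::nat)" by auto
  with d show False by simp
qed

lemma n_syl_gt_1: "prime p \<Longrightarrow> p dvd n \<Longrightarrow> 1 < n_syl p"
  using half_fact_ge_2[OF n_syl_half_fact, of p] by simp

lemma n_syl_cong: "prime p \<Longrightarrow> [n_syl p = 1] (mod p)"
  by (rule card_syl_cong_1[OF _ subgroup_self])

lemma n_syl_dvd: "prime p \<Longrightarrow> n_syl p * p ^ multiplicity p n dvd n"
  using card_syl_dvd[OF _ subgroup_self, of p] unfolding n_card .

lemma n_syl_normalizer_in:
  assumes "prime p" "P \<in> sylows (carrier G) p"
  shows "card (normalizer_in (carrier G) P) = n div n_syl p"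
  using normalizer_in_facts(4)[OF assms(1) subgroup_self assms(2)] unfolding n_card .

lemma n_syl_le_nsub_normalizer_in:
  assumes p: "prime p"
  shows "n_syl p \<le> nsub (n div n_syl p)"
  by (rule nsub_ge_of_inj[OF normalizer_in_inj[OF p subgroup_self]])
    (use n_syl_normalizer_in[OF p] normalizer_in_facts(1)[OF p subgroup_self] in auto)

lemma n_factor:
  assumes "prime p"
  shows "n_syl p * (n div n_syl p) = n"
  by (rule dvd_mult_div_cancel) (rule dvd_mult_left[OF n_syl_dvd[OF assms]])

lemma normalizer_in_order_less:
  assumes "prime p" "p dvd n"
  shows "n div n_syl p < n"
  by (rule div_less_dividend) (use n_syl_gt_1[OF assms] in auto)

lemma normalizer_in_order_pos: "prime p \<Longrightarrow> 0 < n div n_syl p"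
  using n_factor n_pos by (metis mult_0_right neq0_conv)

text \<open>A prime power divisible by the \<open>p\<close>-part of \<open>n\<close> is a power of \<open>p\<close>, and the \<open>p\<close>-part is the largest one
that divides \<open>n\<close>.\<close>

lemma normalizer_in_order_not_prime_power:
  assumes p: "prime p" "p dvd n" and ne: "n_syl p * p ^ multiplicity p n \<noteq> n" and q: "prime q"
  shows "n div n_syl p \<noteq> q ^ j"
proof
  assume eq: "n div n_syl p = q ^ j"
  have "p ^ multiplicity p n dvd q ^ j"
  proof -
    have "n_syl p * p ^ multiplicity p n dvd n_syl p * (n div n_syl p)"
      unfolding n_factor[OF p(1)] by (rule n_syl_dvd[OF p(1)])
    moreover have "n_syl p \<noteq> 0" using n_syl_gt_1[OF p] by linarith
    ultimately show ?thesis unfolding eq using dvd_times_left_cancel_iff by blast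
  qed
  moreover have "p dvd q ^ j"
    by (rule dvd_trans[OF dvd_power calculation]) (use sylow_order(1)[OF p] in simp)
  then have pq: "p = q" using p(1) q prime_dvd_power primes_dvd_imp_eq by blast
  ultimately have "multiplicity p n \<le> j"
    using prime_gt_1_nat[OF p(1)] power_dvd_imp_le by blast
  moreover have "j \<le> multiplicity p n"
  proof -
    have "n div n_syl p dvd n" using dvd_triv_right[of "n div n_syl p" "n_syl p"] unfolding n_factor[OF p(1)] .
    then have "q ^ j dvd n" using eq by simp
    then show ?thesis
      using pq n_pos p(1) by (metis multiplicity_geI neq0_conv not_prime_unit)
  qed
  ultimately have "n div n_syl p = p ^ multiplicity p n" using eq pq by simp
  then show False using n_factor[OF p(1)] ne by simp
qed

text \<open>Three kinds of orders cannot collide: \<open>1\<close> and \<open>n\<close>; the prime powers, each with a conjugacy class of at least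
\<open>d\<close> subgroups; and the orders of Sylow normalizers that are not Sylow subgroups. Primes with equal Sylow
numbers have normalizers of equal order, so the last sum runs over the set of values and counts each once.\<close>

lemma subgroup_count:
  assumes d: "\<And>k. 2 * n dvd fact k \<Longrightarrow> d \<le> k"
  shows "2 + (\<Sum>p\<in>prime_factors n. n_syl p + (multiplicity p n - 1) * d)
      + \<Sum> {n_syl p | p. p \<in> prime_factors n \<and> n_syl p * p ^ multiplicity p n \<noteq> n} \<le> Sub G"
proof -
  let ?P = "prime_factors n"
  define T where "T = {n_syl p | p. p \<in> ?P \<and> n_syl p * p ^ multiplicity p n \<noteq> n}"
  define M1 where "M1 p = (\<lambda>i. p ^ i) ` {1..multiplicity p n}" for p :: nat
  define M2 where "M2 = (\<lambda>t. n div t) ` T"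
  have TE: "\<exists>p. prime p \<and> p dvd n \<and> t = n_syl p \<and> n_syl p * p ^ multiplicity p n \<noteq> n" if "t \<in> T" for t
    using that unfolding T_def by (auto simp: prime_factors_dvd)
  have finT: "finite T" unfolding T_def by simp
  have PE: "prime p" "p dvd n" if "p \<in> ?P" for p using that by (auto simp: prime_factors_dvd)
  have powlt: "1 < p ^ i" "p ^ i < n" if "p \<in> ?P" "i \<in> {1..multiplicity p n}" for p i
  proof -
    show "1 < p ^ i" using one_less_power[OF prime_gt_1_nat[OF PE(1)[OF that(1)]], of i] that(2) by simp
    have "p ^ i \<le> p ^ multiplicity p n"
      using that prime_gt_0_nat[OF PE(1)[OF that(1)]] by (intro power_increasing) auto
    then show "p ^ i < n" using sylow_order(3)[OF PE[OF that(1)]] by simp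
  qed
  have injpow: "inj_on (\<lambda>i. p ^ i) {1..multiplicity p n}" if "p \<in> ?P" for p
    using prime_gt_1_nat[OF PE(1)[OF that]] by (auto simp: inj_on_def)
  have M1sum: "n_syl p + (multiplicity p n - 1) * d \<le> sum nsub (M1 p)" if p: "p \<in> ?P" for p
  proof -
    let ?a = "multiplicity p n"
    have a: "0 < ?a" by (rule sylow_order(1)[OF PE[OF p]])
    have each: "d \<le> nsub (p ^ i)" if i: "i \<in> {1..<?a}" for i
    proof -
      have "p ^ i dvd card (carrier G)"
        using i multiplicity_dvd'[of i p n] by (simp add: n_card)
      then obtain S where "subgroup S G" "card S = p ^ i"
        using prime_power_subgroup[OF PE(1)[OF p] subgroup_self] by blast
      then show ?thesis using nsub_ge[OF _ _ powlt[OF p] d] i by simp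
    qed
    have "sum nsub (M1 p) = (\<Sum>i\<in>{1..?a}. nsub (p ^ i))"
      unfolding M1_def sum.reindex[OF injpow[OF p]] comp_def ..
    also have "{1..?a} = insert ?a {1..<?a}" using a by auto
    also have "(\<Sum>i\<in>insert ?a {1..<?a}. nsub (p ^ i)) = n_syl p + (\<Sum>i\<in>{1..<?a}. nsub (p ^ i))"
      by (simp add: n_syl_eq_nsub)
    also have "\<dots> \<ge> n_syl p + (\<Sum>i\<in>{1..<?a}. d)"
      using each by (intro add_left_mono sum_mono) auto
    finally show ?thesis by simp
  qed
  have M1disj: "M1 p \<inter> M1 q = {}" if "p \<in> ?P" "q \<in> ?P" "p \<noteq> q" for p q
  proof -
    have "p ^ i \<noteq> q ^ j" if "i \<in> {1..multiplicity p n}" for i j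
    proof
      assume "p ^ i = q ^ j"
      then have "p dvd q ^ j" using that dvd_power[of i p] by simp
      then show False
        using PE \<open>p \<in> ?P\<close> \<open>q \<in> ?P\<close> \<open>p \<noteq> q\<close> prime_dvd_power primes_dvd_imp_eq by blast
    qed
    then show ?thesis unfolding M1_def by blast
  qed
  have inj2: "inj_on (\<lambda>t. n div t) T"
  proof (rule inj_onI)
    fix t u assume t: "t \<in> T" "u \<in> T" "n div t = n div u"
    have tn: "t * (n div t) = n" using TE[OF t(1)] n_factor by blast
    have un: "u * (n div t) = n" using TE[OF t(2)] n_factor unfolding t(3) by blast
    have "n div t \<noteq> 0" using tn n_pos by (cases "n div t = 0") auto
    moreover have "t * (n div t) = u * (n div t)" using tn un by simp
    ultimately show "t = u" by simp
  qed
  have M2sum: "\<Sum> T \<le> sum nsub M2"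
  proof -
    have "\<Sum> T \<le> (\<Sum>t\<in>T. nsub (n div t))"
      by (rule sum_mono) (use TE n_syl_le_nsub_normalizer_in in blast)
    then show ?thesis unfolding M2_def by (simp add: sum.reindex[OF inj2])
  qed
  have M2ne: "n div t \<noteq> 1" "n div t \<noteq> n" "n div t \<noteq> q ^ j" if "t \<in> T" "prime q" for t q j
  proof -
    note TE' = TE[OF that(1)]
    obtain p where p: "prime p" "p dvd n" "t = n_syl p" "n_syl p * p ^ multiplicity p n \<noteq> n"
      using TE' by blast
    note np = normalizer_in_order_not_prime_power[OF p(1,2,4)]
    show "n div t \<noteq> 1" using np[OF p(1), of 0] p(3) by simp
    show "n div t \<noteq> n" using normalizer_in_order_less[OF p(1,2)] p(3) by simp
    show "n div t \<noteq> q ^ j" using np[OF that(2)] p(3) by simp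
  qed
  have d1: "(\<Union>p\<in>?P. M1 p) \<inter> M2 = {}"
  proof -
    have False if p: "p \<in> ?P" and m: "m \<in> M1 p" "m \<in> M2" for m p
    proof -
      obtain i t where "m = p ^ i" "t \<in> T" "m = n div t" using m unfolding M1_def M2_def by blast
      then show False using M2ne(3)[OF _ PE(1)[OF p]] by metis
    qed
    then show ?thesis by blast
  qed
  have d2: "{1, n} \<inter> ((\<Union>p\<in>?P. M1 p) \<union> M2) = {}"
  proof -
    have "m \<noteq> 1 \<and> m \<noteq> n" if m: "m \<in> M1 p" "p \<in> ?P" for m p
    proof -
      obtain i where i: "i \<in> {1..multiplicity p n}" "m = p ^ i" using m(1) unfolding M1_def by blast
      show ?thesis unfolding i(2) using powlt[OF m(2) i(1)] by linarith
    qed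
    moreover have "m \<noteq> 1 \<and> m \<noteq> n" if m: "m \<in> M2" for m
    proof -
      obtain t where t: "t \<in> T" "m = n div t" using m unfolding M2_def by blast
      show ?thesis unfolding t(2) using M2ne(1,2)[OF t(1) two_is_prime_nat] by simp
    qed
    ultimately show ?thesis by blast
  qed
  have "2 + (\<Sum>p\<in>?P. n_syl p + (multiplicity p n - 1) * d) + \<Sum> T
      \<le> sum nsub {1, n} + ((\<Sum>p\<in>?P. sum nsub (M1 p)) + sum nsub M2)"
  proof -
    have "sum nsub {1, n} = 2" using order_gt_one nsub_1 nsub_order by simp
    moreover have "(\<Sum>p\<in>?P. n_syl p + (multiplicity p n - 1) * d) \<le> (\<Sum>p\<in>?P. sum nsub (M1 p))"
      by (rule sum_mono[OF M1sum])
    ultimately show ?thesis using M2sum by linarith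
  qed
  also have "(\<Sum>p\<in>?P. sum nsub (M1 p)) = sum nsub (\<Union>p\<in>?P. M1 p)"
    by (rule sum.UNION_disjoint[symmetric]) (use M1disj in \<open>auto simp: M1_def\<close>)
  also have "sum nsub (\<Union>p\<in>?P. M1 p) + sum nsub M2 = sum nsub ((\<Union>p\<in>?P. M1 p) \<union> M2)"
    by (rule sum.union_disjoint[symmetric]) (use d1 finT in \<open>auto simp: M1_def M2_def\<close>)
  also have "sum nsub {1, n} + \<dots> = sum nsub ({1, n} \<union> ((\<Union>p\<in>?P. M1 p) \<union> M2))"
    by (rule sum.union_disjoint[symmetric]) (use d2 finT in \<open>auto simp: M1_def M2_def\<close>)
  also have "\<dots> \<le> Sub G"
    by (rule sum_nsub_le_Sub) (use finT in \<open>auto simp: M1_def M2_def\<close>)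
  finally show ?thesis unfolding T_def .
qed

lemma conjugates_in_proper:
  assumes N: "subgroup N G" and x: "x \<in> carrier G" "x \<noteq> \<one>" "\<And>g. g \<in> carrier G \<Longrightarrow> g \<otimes> x \<otimes> inv g \<in> N"
  shows "N = carrier G"
proof -
  let ?S = "(\<lambda>g. g \<otimes> x \<otimes> inv g) ` carrier G"
  have S: "?S \<subseteq> carrier G" using x by auto
  have "generate G ?S \<lhd> G"
  proof (rule normal_generateI[OF S])
    fix h g assume "h \<in> ?S" "g \<in> carrier G"
    then obtain k where k: "k \<in> carrier G" "h = k \<otimes> x \<otimes> inv k" by blast
    have "g \<otimes> h \<otimes> inv g = (g \<otimes> k) \<otimes> x \<otimes> inv (g \<otimes> k)"
      using k x \<open>g \<in> carrier G\<close> by (simp add: m_assoc inv_mult_group)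
    then show "g \<otimes> h \<otimes> inv g \<in> ?S" using k \<open>g \<in> carrier G\<close> by blast
  qed
  moreover have "x \<in> generate G ?S"
  proof -
    have "x = \<one> \<otimes> x \<otimes> inv \<one>" using x by simp
    then have "x \<in> ?S" by blast
    then show ?thesis by (rule generate.incl)
  qed
  ultimately have "generate G ?S = carrier G" using no_real_normal_subgroup x(2) by blast
  moreover have "generate G ?S \<subseteq> N" by (rule generate_subgroup_incl[OF _ N]) (use x(3) in auto)
  ultimately show ?thesis using subgroup.subset[OF N] by blast
qed

text \<open>A proper subgroup cannot contain all Sylow subgroups for a prime: they generate a normal
  subgroup.\<close>

lemma sylow_in_subgroup:
  assumes q: "prime q" "q dvd n" and N: "subgroup N G" "N \<noteq> carrier G"
    and full: "q ^ multiplicity q n dvd card N"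
  shows "multiplicity q (card N) = multiplicity q n" "sylows N q \<subseteq> sylows (carrier G) q" "card (sylows N q) < n_syl q"
proof -
  have d: "card N dvd n" by (rule card_dvd_order[OF N(1)])
  have "multiplicity q (card N) \<le> multiplicity q n"
    using dvd_imp_multiplicity_le[OF d] n_pos by simp
  moreover have "multiplicity q n \<le> multiplicity q (card N)"
    using full card_subgroup_pos[OF N(1)] q(1) by (metis multiplicity_geI neq0_conv not_prime_unit)
  ultimately show m: "multiplicity q (card N) = multiplicity q n" by simp
  show sub: "sylows N q \<subseteq> sylows (carrier G) q"
    using subgroup.subset[OF N(1)] m unfolding sylows_def n_card by auto
  have "sylows N q \<noteq> sylows (carrier G) q"
  proof
    assume eq: "sylows N q = sylows (carrier G) q"
    obtain Q where Q: "Q \<in> sylows (carrier G) q" using syl_nonempty[OF q(1) subgroup_self] by blast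
    have "card Q \<noteq> 1" using sylD_G(2)[OF Q] sylow_order(2)[OF q] by linarith
    then have "Q \<noteq> {\<one>}" by auto
    then obtain x where x: "x \<in> Q" "x \<noteq> \<one>" using subgroup.one_closed[OF sylD_G(1)[OF Q]] by blast
    have "g \<otimes> x \<otimes> inv g \<in> N" if "g \<in> carrier G" for g
    proof -
      have "conj_set g Q \<in> sylows N q" using conj_set_syl[OF Q that subgroup_self] eq by simp
      then show ?thesis using sylD(2) conj_set_mem[OF x(1), of g] by blast
    qed
    then show False
      using conjugates_in_proper[OF N(1) _ x(2)] subgroup.mem_carrier[OF sylD_G(1)[OF Q] x(1)] N(2) by blast
  qed
  with sub show "card (sylows N q) < n_syl q" by (intro psubset_card_mono) auto
qed

text \<open>Compare the Sylow \<open>q\<close>-subgroups of a Sylow \<open>p\<close>-normalizer \<open>N\<close> with those of the group: \<open>N\<close> cannot contain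
all of them, and if it has only one, then \<open>N\<close> lies in the normalizer of that one.\<close>

lemma sylow_in_normalizer_in:
  assumes p: "prime p" "p dvd n" and q: "prime q" "q dvd n"
    and full: "q ^ multiplicity q n dvd n div n_syl p"
  obtains m where "m * q ^ multiplicity q n dvd n div n_syl p" "[m = 1] (mod q)" "m < n_syl q" "m = 1 \<Longrightarrow> n_syl q dvd n_syl p"
proof -
  obtain P where P: "P \<in> sylows (carrier G) p" using syl_nonempty[OF p(1) subgroup_self] by blast
  let ?N = "normalizer_in (carrier G) P"
  note N = normalizer_in_facts(1)[OF p(1) subgroup_self P]
  have cN: "card ?N = n div n_syl p" by (rule n_syl_normalizer_in[OF p(1) P])
  have Nne: "?N \<noteq> carrier G"
  proof
    assume "?N = carrier G"
    then have "n div n_syl p = n" using cN by (simp add: n_card)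
    then show False using normalizer_in_order_less[OF p] by simp
  qed
  note s = sylow_in_subgroup[OF q N Nne full[folded cN]]
  show ?thesis
  proof (rule that[of "card (sylows ?N q)"])
    show "card (sylows ?N q) * q ^ multiplicity q n dvd n div n_syl p"
      using card_syl_dvd[OF q(1) N] s(1) cN by simp
    show "[card (sylows ?N q) = 1] (mod q)" by (rule card_syl_cong_1[OF q(1) N])
    show "card (sylows ?N q) < n_syl q" by (rule s(3))
    assume one: "card (sylows ?N q) = 1"
    then obtain Q where Q: "sylows ?N q = {Q}" using card_1_singletonE by blast
    then have QG: "Q \<in> sylows (carrier G) q" using s(2) by blast
    have "?N \<subseteq> normalizer_in (carrier G) Q"
    proof
      fix g assume g: "g \<in> ?N"
      have "conj_set g Q \<in> sylows ?N q" using conj_set_syl[OF _ g N, of Q q] Q by simp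
      then show "g \<in> normalizer_in (carrier G) Q"
        using Q g subgroup.mem_carrier[OF N g] unfolding normalizer_in_def by simp
    qed
    then have "card ?N dvd card (normalizer_in (carrier G) Q)"
      using card_subgroup_dvd[OF N normalizer_in_facts(1)[OF q(1) subgroup_self QG]] by blast
    then have "n div n_syl p dvd n div n_syl q" unfolding cN n_syl_normalizer_in[OF q(1) QG] .
    then have "n_syl q * (n div n_syl p) dvd n_syl q * (n div n_syl q)" by simp
    then have "n_syl q * (n div n_syl p) dvd n_syl p * (n div n_syl p)"
      unfolding n_factor[OF p(1)] n_factor[OF q(1)] .
    moreover have "n div n_syl p \<noteq> 0" using normalizer_in_order_pos[OF p(1)] by simp
    ultimately show "n_syl q dvd n_syl p" by simp
  qed
qed

text \<open>Two Sylow subgroups of order \<open>p\<^sup>2\<close> with a common element \<open>z \<noteq> \<one>\<close> both lie in the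
  centralizer of \<open>z\<close>, since groups of order \<open>p\<^sup>2\<close> are abelian.\<close>

lemma sylow_square_centralizer:
  assumes p: "prime p" "multiplicity p n = 2" and nd: "\<not> sylow_disjoint (carrier G) p"
  obtains z where "z \<in> carrier G" "z \<noteq> \<one>" "subgroup (centralizer z) G" "centralizer z \<noteq> carrier G"
    "(p + 1) * p\<^sup>2 \<le> card (centralizer z)"
proof -
  obtain P Q where PQ: "P \<in> sylows (carrier G) p" "Q \<in> sylows (carrier G) p" "P \<noteq> Q" "P \<inter> Q \<noteq> {\<one>}"
    using nd unfolding sylow_disjoint_def by blast
  note Ps = sylD_G[OF PQ(1)] and Qs = sylD_G[OF PQ(2)]
  obtain z where z: "z \<in> P" "z \<in> Q" "z \<noteq> \<one>"
    using PQ(4) subgroup.one_closed[OF Ps(1)] subgroup.one_closed[OF Qs(1)] by blast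
  have zG: "z \<in> carrier G" using subgroup.mem_carrier[OF Ps(1) z(1)] .
  have sub: "R \<subseteq> centralizer z" if "subgroup R G" "card R = p ^ multiplicity p n" "z \<in> R" for R
    using prime_square_commute[OF p(1) that(1) that(2)[unfolded p(2)] _ that(3)] subgroup.mem_carrier[OF that(1)]
    unfolding centralizer_def by blast
  have C: "subgroup (centralizer z) G" by (rule centralizer_subgroup[OF zG])
  have CG: "centralizer z \<subseteq> carrier G" by (rule subgroup.subset[OF C])
  have PC: "P \<subseteq> centralizer z" "Q \<subseteq> centralizer z" using sub Ps Qs z by blast+
  note si = syl_intermediate[OF p(1) subgroup_self C CG PQ(1) PC(1)]
  have m: "multiplicity p (card (centralizer z)) = 2" using si(1) p(2) by (simp add: n_card)
  let ?m = "card (sylows (centralizer z) p)"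
  have "{P, Q} \<subseteq> sylows (centralizer z) p" using si(2) PQ PC by blast
  then have "card {P, Q} \<le> ?m" by (intro card_mono) auto
  then have m1: "1 < ?m" using PQ(3) by simp
  have "p dvd ?m - 1" by (rule cong_to_1_nat[OF card_syl_cong_1[OF p(1) C]])
  then have "p \<le> ?m - 1" by (rule dvd_imp_le) (use m1 in simp)
  then have "(p + 1) * p\<^sup>2 \<le> ?m * p\<^sup>2" using m1 by (intro mult_le_mono1) linarith
  also have "?m * p\<^sup>2 dvd card (centralizer z)" using card_syl_dvd[OF p(1) C] unfolding m .
  then have "?m * p\<^sup>2 \<le> card (centralizer z)" by (rule dvd_imp_le) (use C in simp)
  finally have "(p + 1) * p\<^sup>2 \<le> card (centralizer z)" .
  moreover have "centralizer z \<noteq> carrier G" using center_trivial[OF zG] z(3) by blast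
  ultimately show ?thesis using that[of z] zG z(3) C by blast
qed

end

section \<open>A sieve for the possible orders\<close>

text \<open>This is the multiplicity of \<open>p\<close> in \<open>n\<close>, in a recursive form that the simplifier can evaluate on
numerals.\<close>

fun expo :: "nat \<Rightarrow> nat \<Rightarrow> nat" where
  "expo p n = (if 1 < p \<and> 0 < n \<and> p dvd n then Suc (expo p (n div p)) else 0)"

declare expo.simps [simp del]

text \<open>Started with \<open>m = 0\<close>, this is the least multiple \<open>m\<close> of the prime \<open>p\<close> such that \<open>p ^ a\<close> divides \<open>m!\<close>: each
step passes to the next multiple of \<open>p\<close> and subtracts its contribution from \<open>a\<close>. The maximum with 1 makes
the recursion terminate for all arguments.\<close>

fun degree_from :: "nat \<Rightarrow> nat \<Rightarrow> nat \<Rightarrow> nat" where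
  "degree_from p a m = (if a = 0 then m else degree_from p (a - max 1 (expo p (m + p))) (m + p))"

declare degree_from.simps [simp del]

text \<open>The search for tuples of Sylow numbers of a group of order \<open>n\<close> whose conjugacy classes have at least \<open>d\<close>
members. The primes in the list are treated one after the other; \<open>b\<close> is the number of subgroups still
allowed, \<open>T\<close> holds the Sylow numbers whose normalizers are already counted, and \<open>acc\<close> the numbers chosen
so far. The auxiliary function tries the candidates \<open>m\<close>, \<open>m + p\<close>, \<open>m + 2 p\<close> and so on for the prime
\<open>p\<close>; \<open>r\<close> is the \<open>p\<close>-free part of \<open>n\<close>, and \<open>w\<close> the contribution of the smaller powers of \<open>p\<close>. There are no
abstractions in these equations, so that simplification evaluates only what the tests demand.\<close>

function (sequential) sylow_counts :: "nat \<Rightarrow> nat \<Rightarrow> nat list \<Rightarrow> nat \<Rightarrow> nat list \<Rightarrow> nat list \<Rightarrow> nat list list"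
  and counts_from :: "nat \<Rightarrow> nat \<Rightarrow> nat \<Rightarrow> nat \<Rightarrow> nat \<Rightarrow> nat \<Rightarrow> nat list \<Rightarrow> nat \<Rightarrow> nat list \<Rightarrow> nat list \<Rightarrow> nat list list" where
  "sylow_counts n d [] b T acc = [acc]"
| "sylow_counts n d (p # ps) b T acc =
    (if p dvd n then counts_from n d p (n div p ^ expo p n) ((expo p n - 1) * d) (p + 1) ps b T acc
     else sylow_counts n d ps b T acc)"
| "counts_from n d p r w m ps b T acc =
    (if b < m + w \<or> p = 0 then [] else
      (if d \<le> m \<and> m dvd r \<and> m + w + (if m = r \<or> m \<in> set T then 0 else m) \<le> b
       then sylow_counts n d ps (b - (m + w + (if m = r \<or> m \<in> set T then 0 else m)))
              (if m = r then T else m # T) (m # acc)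
       else []) @ counts_from n d p r w (m + p) ps b T acc)"
  by pat_completeness auto
termination
  by (relation "measures [\<lambda>x. case x of Inl (n, d, ps, _) \<Rightarrow> length ps | Inr (n, d, p, r, w, m, ps, _) \<Rightarrow> length ps,
        \<lambda>x. case x of Inl _ \<Rightarrow> 0 | Inr (n, d, p, r, w, m, ps, b, _) \<Rightarrow> Suc b - m]") auto

declare sylow_counts.simps [simp del] counts_from.simps [simp del]

text \<open>The primes up to 36. A larger one cannot occur: a prime factor of \<open>n\<close> is at most the least \<open>m\<close> with \<open>2 n\<close>
dividing \<open>m!\<close>, and at least two prime factors cost \<open>m\<close> subgroups each, with 73 to spend.\<close>

abbreviation sieve_primes :: "nat list"
  where "sieve_primes \<equiv> [31, 29, 23, 19, 17, 13, 11, 7, 5, 3, 2]"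

text \<open>The search for orders \<open>n\<close>, built up from the primes in the list; \<open>a\<close> is the exponent of the first of them so
far, \<open>k\<close> the number of prime factors with multiplicity, and \<open>d\<close> a lower bound for every \<open>m\<close> with \<open>2 n\<close>
dividing \<open>m!\<close>. For \<open>p = 2\<close> the exponent is raised by one because of the factor 2. An order is given up
as soon as \<open>d * k\<close> exceeds \<open>73 = 75 - 2\<close>, the allowance for nontrivial proper subgroups; this is
inherited by multiples. The test \<open>k \<le> 37\<close> keeps the recursion finite when \<open>d\<close> is 0 or 1.\<close>

function sieve :: "nat list \<Rightarrow> nat \<Rightarrow> nat \<Rightarrow> nat \<Rightarrow> nat \<Rightarrow> (nat \<times> nat list) list"
  and sieve_step :: "nat \<Rightarrow> nat list \<Rightarrow> nat \<Rightarrow> nat \<Rightarrow> nat \<Rightarrow> nat \<Rightarrow> (nat \<times> nat list) list" where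
  "sieve [] a n k d = map (Pair n) (sylow_counts n d sieve_primes 73 [] [])"
| "sieve (p # ps) a n k d = sieve ps 0 n k d @
    sieve_step p ps (a + 1) (p * n) (k + 1) (max d (degree_from p (if p = 2 then a + 2 else a + 1) 0))"
| "sieve_step p ps a n k d = (if k \<le> 37 \<and> d * k \<le> 73 then sieve (p # ps) a n k d else [])"
  by pat_completeness auto
termination
  by (relation "measures [\<lambda>x. case x of Inl (ps, a, n, k, d) \<Rightarrow> length ps + (39 - k)
      | Inr (p, ps, a, n, k, d) \<Rightarrow> length ps + (if k \<le> 37 then Suc (39 - k) else 0), \<lambda>x. case x of Inl _ \<Rightarrow> 0 | Inr _ \<Rightarrow> 1]") auto

declare sieve.simps [simp del] sieve_step.simps [simp del]

text \<open>Keeping the numeral \<open>1\<close> instead of \<open>Suc 0\<close> lets the arithmetic simplification procedures do all the work.\<close>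

lemma sieve_result:
  "sieve sieve_primes 0 1 0 1 =
    [(1, []), (144, [9, 16]), (30, [5, 10, 6]), (30, [15, 10, 6]),
     (60, [5, 10, 6]), (60, [15, 10, 6]), (120, [15, 10, 6]),
     (90, [9, 10, 6]), (90, [15, 10, 6]), (90, [45, 10, 6]),
     (180, [9, 10, 6]), (360, [9, 10, 6]), (56, [7, 8]), (168, [7, 7, 8]),
     (168, [21, 7, 8]), (252, [7, 7, 36]), (504, [7, 7, 8]),
     (504, [9, 7, 8]), (105, [7, 21, 15]), (351, [13, 27])]"
  by (simp add: sieve.simps sieve_step.simps sylow_counts.simps counts_from.simps
      degree_from.simps expo.simps del: One_nat_def)

lemma expo_eq_multiplicity:
  assumes "prime p" "0 < n"
  shows "expo p n = multiplicity p n"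
  using assms(2)
proof (induction n rule: less_induct)
  case (less n)
  have p1: "1 < p" using assms(1) prime_gt_1_nat by blast
  show ?case
  proof (cases "p dvd n")
    case True
    then obtain m where m: "n = p * m" by blast
    then have m0: "0 < m" "m < n" using less.prems p1 by auto
    have "multiplicity p (p * m) = Suc (multiplicity p m)"
      by (rule multiplicity_times_same) (use m0 p1 assms(1) in auto)
    moreover have "expo p n = Suc (expo p m)"
      using True less.prems p1 m by (subst expo.simps) simp
    ultimately show ?thesis using less.IH[OF m0(2,1)] m by simp
  next
    case False
    then show ?thesis by (subst expo.simps) (simp add: not_dvd_imp_multiplicity_0)
  qed
qed

lemma multiplicity_fact_step:
  assumes p: "prime p" and m: "p dvd m"
  shows "j < p \<Longrightarrow> multiplicity p (fact (m + j) :: nat) = multiplicity p (fact m :: nat)"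
proof (induction j)
  case (Suc j)
  have "\<not> p dvd Suc (m + j)"
  proof
    assume "p dvd Suc (m + j)"
    then have "p dvd Suc j" using m by (metis add_Suc_right dvd_add_right_iff)
    then show False using Suc.prems by (meson dvd_imp_le not_less zero_less_Suc)
  qed
  then have "multiplicity p (Suc (m + j)) = 0" by (rule not_dvd_imp_multiplicity_0)
  moreover have "multiplicity p (fact (m + Suc j) :: nat) = multiplicity p (Suc (m + j)) + multiplicity p (fact (m + j) :: nat)"
    using p by (simp only: add_Suc_right fact_Suc of_nat_id)
      (rule prime_elem_multiplicity_mult_distrib, auto)
  ultimately show ?case using Suc by simp
qed simp

text \<open>Between \<open>m\<close> and \<open>m + p\<close> the multiplicity of \<open>p\<close> in the factorial does not change, so \<open>K\<close> must reach the
next multiple of \<open>p\<close> as long as \<open>a\<close> is positive.\<close>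

lemma degree_from_le:
  shows "prime p \<Longrightarrow> p dvd m \<Longrightarrow> m \<le> K \<Longrightarrow> a + multiplicity p (fact m :: nat) \<le> multiplicity p (fact K :: nat)
    \<Longrightarrow> degree_from p a m \<le> K"
proof (induction p a m rule: degree_from.induct)
  case (1 p a m)
  note p = "1.prems"(1) and prem = "1.prems"(2-)
  show ?case
  proof (cases "a = 0")
    case True
    then show ?thesis using prem by (subst degree_from.simps) simp
  next
    case False
    have p1: "1 < p" using prime_gt_1_nat[OF p] .
    have le: "m + p \<le> K"
    proof (rule ccontr)
      assume "\<not> m + p \<le> K"
      then have "multiplicity p (fact (m + (K - m)) :: nat) = multiplicity p (fact m :: nat)"
        by (intro multiplicity_fact_step[OF p prem(1)]) (use prem(2) in linarith)
      then show False using prem False by simp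
    qed
    have "multiplicity p (fact (m + p) :: nat) = multiplicity p (m + p) + multiplicity p (fact (m + (p - 1)) :: nat)"
    proof -
      have "fact (m + p) = (m + p) * (fact (m + (p - 1)) :: nat)"
        using p1 by (subst fact_reduce) auto
      then show ?thesis using p p1 by (simp add: prime_elem_multiplicity_mult_distrib)
    qed
    also have "multiplicity p (fact (m + (p - 1)) :: nat) = multiplicity p (fact m :: nat)"
      by (rule multiplicity_fact_step[OF p prem(1)]) (use p1 in simp)
    finally have v: "multiplicity p (fact (m + p) :: nat) = multiplicity p (m + p) + multiplicity p (fact m :: nat)" .
    have mono: "multiplicity p (fact (m + p) :: nat) \<le> multiplicity p (fact K :: nat)"
      by (rule dvd_imp_multiplicity_le) (use fact_dvd[OF le] in auto)
    have pd: "p dvd m + p" using prem(1) by simp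
    have e: "expo p (m + p) = multiplicity p (m + p)" "0 < multiplicity p (m + p)"
      using expo_eq_multiplicity[OF p, of "m + p"] p1 pd p by (auto simp: prime_multiplicity_gt_zero_iff)
    have "degree_from p (a - max 1 (expo p (m + p))) (m + p) \<le> K"
      by (rule "1.IH"[OF False p pd le]) (use prem(3) v mono e in \<open>auto simp: max_def\<close>)
    then show ?thesis using False by (subst degree_from.simps) simp
  qed
qed

lemma degree_from_0_le:
  assumes "prime p" "p ^ a dvd (fact K :: nat)"
  shows "degree_from p a 0 \<le> K"
proof (rule degree_from_le[OF assms(1) dvd_0_right le0])
  show "a + multiplicity p (fact 0 :: nat) \<le> multiplicity p (fact K :: nat)"
    using multiplicity_geI[OF _ _ assms(2)] prime_gt_1_nat[OF assms(1)] by simp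
qed

text \<open>The numerical constraints on the order \<open>n\<close> and the Sylow numbers \<open>s\<close> of a nonabelian simple group with at most
75 subgroups. \<open>D\<close> is a lower bound for the size of every conjugacy class of nontrivial proper
subgroups, for which \<open>2 n\<close> divides \<open>D!\<close>; the total leaves out the trivial subgroup and the whole group.\<close>

locale sylow_data =
  fixes n :: nat and s :: "nat \<Rightarrow> nat" and D :: nat
  assumes n_gt_1: "1 < n"
    and half_fact: "2 * n dvd fact D"
    and s_ge: "p \<in> prime_factors n \<Longrightarrow> D \<le> s p"
    and s_cong: "p \<in> prime_factors n \<Longrightarrow> [s p = 1] (mod p)"
    and s_dvd: "p \<in> prime_factors n \<Longrightarrow> s p dvd n div p ^ multiplicity p n"
    and total: "(\<Sum>p\<in>prime_factors n. s p + (multiplicity p n - 1) * D)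
      + \<Sum> {s p | p. p \<in> prime_factors n \<and> s p \<noteq> n div p ^ multiplicity p n} \<le> 73"
begin

lemma D_ge_2: "2 \<le> D"
proof (rule ccontr)
  assume "\<not> 2 \<le> D"
  then have "D = 0 \<or> D = 1" by linarith
  then have "fact D = (1::nat)" by auto
  then show False using half_fact n_gt_1 by simp
qed

lemma counts_from_reaches:
  assumes "m = m0 + i * p" "0 < p"
    and "d \<le> m" "m dvd r" "m + w + (if m = r \<or> m \<in> set T then 0 else m) \<le> b"
    and x: "x \<in> set (sylow_counts n' d ps (b - (m + w + (if m = r \<or> m \<in> set T then 0 else m)))
              (if m = r then T else m # T) (m # acc))"
  shows "x \<in> set (counts_from n' d p r w m0 ps b T acc)"
  using assms(1)
proof (induction i arbitrary: m0)
  case 0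
  then show ?case using assms(2-) by (subst counts_from.simps) auto
next
  case (Suc i)
  have "x \<in> set (counts_from n' d p r w (m0 + p) ps b T acc)"
    by (rule Suc.IH) (use Suc.prems in simp)
  moreover have "\<not> b < m0 + w" using Suc.prems assms(5) by (auto split: if_splits)
  ultimately show ?case using assms(2) by (subst counts_from.simps) auto
qed

text \<open>Replacing \<open>D\<close> by the smaller \<open>d\<close> only lowers the cost, so the true Sylow numbers are found within the
budget. The set difference in the hypothesis accounts for the normalizers that are already paid for.\<close>

lemma sylow_counts_complete:
  assumes "d \<le> D" "distinct ps" "\<And>p. p \<in> set ps \<Longrightarrow> prime p"
    and "(\<Sum>p | p \<in> set ps \<and> p dvd n. s p + (multiplicity p n - 1) * D)
      + \<Sum> ({s p | p. p \<in> set ps \<and> p dvd n \<and> s p \<noteq> n div p ^ multiplicity p n} - set T) \<le> b"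
  shows "rev (map s (filter (\<lambda>p. p dvd n) ps)) @ acc \<in> set (sylow_counts n d ps b T acc)"
  using assms(2-)
proof (induction ps arbitrary: b T acc)
  case Nil
  then show ?case by (simp add: sylow_counts.simps)
next
  case (Cons p ps)
  let ?r = "\<lambda>p. n div p ^ multiplicity p n"
  let ?S = "\<lambda>ps. {s p | p. p \<in> set ps \<and> p dvd n \<and> s p \<noteq> ?r p}"
  let ?c = "\<lambda>ps. \<Sum>p | p \<in> set ps \<and> p dvd n. s p + (multiplicity p n - 1) * D"
  show ?case
  proof (cases "p dvd n")
    case False
    have "{q. q \<in> set (p # ps) \<and> q dvd n} = {q. q \<in> set ps \<and> q dvd n}" "?S (p # ps) = ?S ps"
      using False by auto
    then have "rev (map s (filter (\<lambda>p. p dvd n) ps)) @ acc \<in> set (sylow_counts n d ps b T acc)"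
      using Cons.prems by (intro Cons.IH) auto
    then show ?thesis using False by (simp add: sylow_counts.simps)
  next
    case True
    have p: "prime p" "p \<in> prime_factors n"
      using Cons.prems True n_gt_1 by (auto simp: prime_factors_dvd)
    let ?m = "s p" and ?nc = "if s p = ?r p \<or> s p \<in> set T then 0 else s p"
    let ?w = "(expo p n - 1) * d" and ?T = "if s p = ?r p then T else s p # T"
    have ex: "expo p n = multiplicity p n" using expo_eq_multiplicity[OF p(1)] n_gt_1 by simp
    have finS: "finite (?S qs)" for qs by simp
    have c: "?c (p # ps) = s p + (multiplicity p n - 1) * D + ?c ps"
    proof -
      have "{q. q \<in> set (p # ps) \<and> q dvd n} = insert p {q. q \<in> set ps \<and> q dvd n}" using True by auto
      then show ?thesis using Cons.prems(1) by simp
    qed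
    have w: "?w \<le> (multiplicity p n - 1) * D" using assms(1) ex by simp
    have S: "\<Sum> (?S ps - set ?T) + ?nc \<le> \<Sum> (?S (p # ps) - set T)"
    proof (cases "s p = ?r p \<or> s p \<in> set T")
      case True
      have "\<Sum> (?S ps - set ?T) \<le> \<Sum> (?S (p # ps) - set T)"
        by (rule sum_mono2) auto
      then show ?thesis using True by simp
    next
      case False
      have "?S (p # ps) - set T = insert (s p) (?S ps - set ?T)"
        using False True by auto
      moreover have "s p \<notin> ?S ps - set ?T" using False by auto
      ultimately have "\<Sum> (?S (p # ps) - set T) = s p + \<Sum> (?S ps - set ?T)"
        using sum.insert[of "?S ps - set ?T" "s p" "\<lambda>x. x"] by simp
      then show ?thesis using False by simp
    qed
    have tot: "?m + ?w + ?nc + (?c ps + \<Sum> (?S ps - set ?T)) \<le> b"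
      using Cons.prems(3) c w S by linarith
    have IH: "rev (map s (filter (\<lambda>p. p dvd n) ps)) @ (s p # acc)
        \<in> set (sylow_counts n d ps (b - (?m + ?w + ?nc)) ?T (s p # acc))"
      by (rule Cons.IH) (use Cons.prems tot in auto)
    have sp: "2 \<le> s p" using s_ge[OF p(2)] D_ge_2 by simp
    have "p dvd s p - 1" by (rule cong_to_1_nat[OF s_cong[OF p(2)]])
    then obtain j where j: "s p - 1 = p * j" by blast
    then have "j \<noteq> 0" using sp by (intro notI) simp
    then obtain i where i: "j = Suc i" by (cases j) auto
    have si: "s p = (p + 1) + i * p" using j i sp by (simp add: algebra_simps)
    have "rev (map s (filter (\<lambda>p. p dvd n) ps)) @ (s p # acc)
        \<in> set (counts_from n d p (n div p ^ expo p n) ?w (p + 1) ps b T acc)"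
      by (rule counts_from_reaches[OF si]) (use IH ex s_dvd[OF p(2)] s_ge[OF p(2)] assms(1) tot prime_gt_0_nat[OF p(1)] in auto)
    then show ?thesis using True by (simp add: sylow_counts.simps)
  qed
qed

lemma prime_factor_count:
  "size (prime_factorization n) = (\<Sum>p\<in>prime_factors n. multiplicity p n)"
proof -
  have "size (prime_factorization n) = (\<Sum>p\<in>prime_factors n. count (prime_factorization n) p)"
    by (simp add: size_multiset_overloaded_eq)
  also have "\<dots> = (\<Sum>p\<in>prime_factors n. multiplicity p n)"
    by (rule sum.cong) (auto simp: count_prime_factorization in_prime_factors_iff)
  finally show ?thesis .
qed

lemma D_times_count: "D * size (prime_factorization n) \<le> 73"
proof -
  have "D * multiplicity p n \<le> s p + (multiplicity p n - 1) * D" if p: "p \<in> prime_factors n" for p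
  proof -
    have "multiplicity p n > 0" using p by (auto simp: prime_factors_multiplicity)
    then obtain k where "multiplicity p n = Suc k" by (cases "multiplicity p n") auto
    then show ?thesis using s_ge[OF p] by (simp add: algebra_simps)
  qed
  then have "(\<Sum>p\<in>prime_factors n. D * multiplicity p n) \<le> (\<Sum>p\<in>prime_factors n. s p + (multiplicity p n - 1) * D)"
    by (rule sum_mono)
  then show ?thesis unfolding prime_factor_count using total by (simp add: sum_distrib_left)
qed

lemma count_ge_2: "2 \<le> size (prime_factorization n)"
proof -
  obtain p where p: "prime p" "p dvd n" using n_gt_1 prime_factor_nat[of n] by auto
  then have pf: "p \<in> prime_factors n" using n_gt_1 by (auto simp: prime_factors_dvd)
  have v: "0 < multiplicity p n" using pf by (auto simp: prime_factors_multiplicity)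
  let ?m = "n div p"
  have nm: "n = p * ?m" using p by simp
  have "n div p ^ multiplicity p n dvd ?m"
  proof -
    obtain e where e: "multiplicity p n = Suc e" using v by (cases "multiplicity p n") auto
    define q where "q = p ^ multiplicity p n"
    have q: "q = p * p ^ e" unfolding q_def e by simp
    obtain u where u: "n = q * u" using multiplicity_dvd[of p n] unfolding q_def by blast
    have "0 < p" "0 < q" using prime_gt_0_nat[OF p(1)] unfolding q by simp_all
    then have "n div q = u" "?m = p ^ e * u" using u q by simp_all
    then show ?thesis unfolding q_def[symmetric] by simp
  qed
  then have "s p dvd ?m" using s_dvd[OF pf] dvd_trans by blast
  then have m1: "?m \<noteq> 1" using s_ge[OF pf] D_ge_2 by auto
  have m0: "?m \<noteq> 0" using nm n_gt_1 by (intro notI) simp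
  have "prime_factorization ?m \<noteq> {#}" using m0 m1 by (simp add: prime_factorization_empty_iff)
  moreover have "prime_factorization n = prime_factorization p + prime_factorization ?m"
    by (subst nm, rule prime_factorization_mult) (use p m0 in auto)
  then have "size (prime_factorization n) = Suc (size (prime_factorization ?m))"
    using p by (simp add: prime_factorization_prime)
  ultimately show ?thesis by (metis One_nat_def Suc_1 Suc_leI Suc_le_mono nonempty_has_size)
qed

lemma D_le: "D \<le> 36"
proof -
  have "D * 2 \<le> D * size (prime_factorization n)" using count_ge_2 by simp
  then show ?thesis using D_times_count by linarith
qed

lemma prime_power_dvd_half_fact:
  assumes "prime p" "p ^ a dvd n"
  shows "p ^ (if p = 2 then a + 1 else a) dvd (fact D :: nat)"
proof (cases "p = 2")
  case True
  then have "2 ^ (a + 1) dvd 2 * n" using assms by simp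
  then show ?thesis using half_fact dvd_trans unfolding True if_P[OF refl] by blast
next
  case False
  then show ?thesis using dvd_trans[OF dvd_mult[OF assms(2)] half_fact] by simp
qed

text \<open>The pruning is sound because \<open>2 n\<close> divides \<open>D!\<close> and \<open>D\<close> times the number of prime factors is at most 73;
both properties pass to the divisors of \<open>n\<close> met on the way. The outer induction follows the list of primes,
the inner one the exponent of the current prime.\<close>

lemma sieve_complete:
  assumes leaf: "\<And>d. d \<le> D \<Longrightarrow> x \<in> set (sylow_counts n d sieve_primes 73 [] [])"
    and "distinct ps" "\<And>p. p \<in> set ps \<Longrightarrow> prime p"
    and "n = n0 * r" "\<And>p. p \<in> prime_factors r \<Longrightarrow> p \<in> set ps"
    and "\<And>p. p \<in> set ps \<Longrightarrow> multiplicity p n0 = (if p = hd ps then a else 0)"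
    and "d \<le> D" "k + size (prime_factorization r) = size (prime_factorization n)"
  shows "(n, x) \<in> set (sieve ps a n0 k d)"
  using assms(2-)
proof (induction ps arbitrary: n0 r a d k)
  case Nil
  have "prime_factorization r = {#}" using Nil.prems(4) set_mset_eq_empty_iff by fastforce
  moreover have "r \<noteq> 0" using Nil.prems(3) n_gt_1 by (intro notI) simp
  ultimately have "n = n0" using Nil.prems(3) by (simp add: prime_factorization_empty_iff)
  then show ?case using leaf Nil.prems by (auto simp: sieve.simps)
next
  case (Cons p ps)
  note outer = Cons.IH
  have p: "prime p" using Cons.prems by simp
  from Cons.prems show ?case
  proof (induction "multiplicity p r" arbitrary: n0 r a d k)
    case 0
    note prem = 0
    have r0: "r \<noteq> 0" using prem(4) n_gt_1 by (intro notI) simp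
    have "\<not> p dvd r" using prem(1) p r0 prime_multiplicity_gt_zero_iff[of p r] by simp
    have "(n, x) \<in> set (sieve ps 0 n0 k d)"
    proof (rule outer)
      show "q \<in> set ps" if "q \<in> prime_factors r" for q
        using prem(5)[OF that] that \<open>\<not> p dvd r\<close> by (auto simp: prime_factors_dvd)
      show "multiplicity q n0 = (if q = hd ps then 0 else 0)" if "q \<in> set ps" for q
        using prem(6)[of q] prem(2) that by auto
    qed (use prem in auto)
    then show ?case by (simp add: sieve.simps)
  next
    case (Suc e)
    note prem = Suc.prems
    have r0: "r \<noteq> 0" using prem(3) n_gt_1 by (intro notI) simp
    have n00: "n0 \<noteq> 0" using prem(3) n_gt_1 by (intro notI) simp
    have "p dvd r" using Suc.hyps(2) by (metis Zero_not_Suc not_dvd_imp_multiplicity_0)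
    then obtain r' where r': "r = p * r'" by blast
    then have r'0: "r' \<noteq> 0" using r0 by auto
    let ?d = "max d (degree_from p (if p = 2 then a + 2 else a + 1) 0)"
    have pn0: "multiplicity p n0 = a" using prem(5)[of p] by simp
    have "p ^ a dvd n0" using multiplicity_dvd[of p n0] pn0 by simp
    then have "p ^ (a + 1) dvd n" using prem(3) r' by (auto intro!: mult_dvd_mono simp: mult.left_commute)
    from prime_power_dvd_half_fact[OF p this]
    have "p ^ (if p = 2 then a + 2 else a + 1) dvd (fact D :: nat)" by (auto split: if_splits)
    then have dD: "?d \<le> D" using degree_from_0_le[OF p] prem(6) by simp
    have pr: "prime_factorization r = prime_factorization p + prime_factorization r'"
      unfolding r' by (rule prime_factorization_mult) (use p r'0 in auto)
    then have sz: "size (prime_factorization r) = Suc (size (prime_factorization r'))"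
      using p by (simp add: prime_factorization_prime)
    then have k1: "(k + 1) + size (prime_factorization r') = size (prime_factorization n)" using prem(7) by simp
    have dk: "?d * (k + 1) \<le> 73"
    proof -
      have "?d * (k + 1) \<le> D * size (prime_factorization n)" using dD k1 by (intro mult_le_mono) auto
      then show ?thesis using D_times_count by linarith
    qed
    have kk: "k + 1 \<le> 37"
    proof -
      have "2 * (k + 1) \<le> D * size (prime_factorization n)" using D_ge_2 k1 by (intro mult_le_mono) auto
      from le_trans[OF this D_times_count] show ?thesis by simp
    qed
    have "(n, x) \<in> set (sieve (p # ps) (a + 1) (p * n0) (k + 1) ?d)"
    proof (rule Suc.hyps(1))
      have "multiplicity p (p * r') = Suc (multiplicity p r')"
        by (rule multiplicity_times_same) (use r'0 p in auto)
      then show "e = multiplicity p r'" using Suc.hyps(2) r' by simp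
      show "n = p * n0 * r'" using prem(3) r' by simp
      show "q \<in> set (p # ps)" if "q \<in> prime_factors r'" for q
        by (rule prem(4)) (use that pr in simp)
      show "multiplicity q (p * n0) = (if q = hd (p # ps) then a + 1 else 0)" if "q \<in> set (p # ps)" for q
      proof (cases "q = p")
        case True
        have "multiplicity p (p * n0) = Suc (multiplicity p n0)"
          by (rule multiplicity_times_same) (use n00 p in auto)
        then show ?thesis using True pn0 by simp
      next
        case False
        have q: "prime q" using prem(2) that by simp
        have "multiplicity q (p * n0) = multiplicity q p + multiplicity q n0"
          using q p n00 by (intro prime_elem_multiplicity_mult_distrib) auto
        moreover have "multiplicity q p = 0"
          using False p q by (metis not_dvd_imp_multiplicity_0 primes_dvd_imp_eq)
        ultimately show ?thesis using prem(5)[OF that] False by simp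
      qed
    qed (use prem dD k1 in auto)
    then have "(n, x) \<in> set (sieve_step p ps (a + 1) (p * n0) (k + 1) ?d)"
      unfolding sieve_step.simps if_P[OF conjI[OF kk dk]] .
    then show ?case unfolding sieve.simps(2) by simp
  qed
qed

lemma prime_le_36: "prime (p::nat) \<Longrightarrow> p \<le> 36 \<Longrightarrow> p \<in> set sieve_primes"
proof -
  assume p: "prime p" "p \<le> 36"
  have "list_all (\<lambda>p::nat. prime p \<longrightarrow> p \<in> set sieve_primes) [2..<37]"
    by (simp add: upt_rec_numeral)
  moreover have "p \<in> {2..<37}" using p prime_ge_2_nat[OF p(1)] by simp
  ultimately show ?thesis using p(1) unfolding list_all_iff set_upt by blast
qed

theorem sieve_sound:
  "(n, rev (map s (filter (\<lambda>p. p dvd n) sieve_primes))) \<in> set (sieve sieve_primes 0 1 0 1)"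
proof (rule sieve_complete)
  have primes: "prime p" if "p \<in> set sieve_primes" for p using that by auto
  have pf: "p \<in> set sieve_primes" if "p \<in> prime_factors n" for p
  proof -
    have "prime p" "p dvd n" using that by (auto simp: prime_factors_dvd)
    then have "p dvd fact D" using half_fact dvd_trans[OF dvd_mult] by blast
    then have "p \<le> D" using \<open>prime p\<close> prime_dvd_fact_iff by blast
    then show ?thesis using prime_le_36[OF \<open>prime p\<close>] D_le by simp
  qed
  then show "p \<in> set sieve_primes" if "p \<in> prime_factors n" for p using that .
  have e: "{p. p \<in> set sieve_primes \<and> p dvd n} = prime_factors n"
    using pf primes n_gt_1 by (auto simp: prime_factors_dvd simp del: set_simps)
  have e2: "p \<in> set sieve_primes \<and> p dvd n \<longleftrightarrow> p \<in> prime_factors n" for p using e by blast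
  show "rev (map s (filter (\<lambda>p. p dvd n) sieve_primes)) \<in> set (sylow_counts n d sieve_primes 73 [] [])"
    if "d \<le> D" for d
  proof -
    have "rev (map s (filter (\<lambda>p. p dvd n) sieve_primes)) @ [] \<in> set (sylow_counts n d sieve_primes 73 [] [])"
    proof (rule sylow_counts_complete[OF that])
      show "distinct sieve_primes" by simp
      show "prime p" if "p \<in> set sieve_primes" for p by (rule primes[OF that])
      show "(\<Sum>p | p \<in> set sieve_primes \<and> p dvd n. s p + (multiplicity p n - 1) * D)
        + \<Sum> ({s p | p. p \<in> set sieve_primes \<and> p dvd n \<and> s p \<noteq> n div p ^ multiplicity p n} - set []) \<le> 73"
        using total unfolding e2 conj_assoc[symmetric] by simp
    qed
    then show ?thesis by simp
  qed
  show "distinct sieve_primes" by simp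
  show "prime p" if "p \<in> set sieve_primes" for p by (rule primes[OF that])
  show "1 \<le> D" using D_ge_2 by simp
qed auto

end

section \<open>Simple groups with at most 75 subgroups have order 60\<close>

context nonabelian_simple_group
begin

lemma sylow_disjoint_carrier_prime:
  "prime p \<Longrightarrow> multiplicity p n = 1 \<Longrightarrow> sylow_disjoint (carrier G) p"
  by (rule sylow_disjoint_prime) (simp_all add: n_card)

lemma element_count_G:
  assumes "finite S" "\<And>p. p \<in> S \<Longrightarrow> prime p" "\<And>p. p \<in> S \<Longrightarrow> sylow_disjoint (carrier G) p"
  shows "(\<Sum>p\<in>S. n_syl p * (p ^ multiplicity p n - 1)) + 1 \<le> n"
proof -
  have "(\<Sum>p\<in>S. n_syl p * (p ^ multiplicity p (card (carrier G)) - 1)) + card {\<one>} \<le> card (carrier G)"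
  proof (rule element_count[OF assms subgroup_self triv_subgroup])
    show "\<not> p dvd card {\<one>}" if "p \<in> S" for p using prime_gt_1_nat[OF assms(2)[OF that]] by simp
  qed simp_all
  then show ?thesis by (simp add: n_card)
qed

text \<open>A second subgroup of the order of \<open>H\<close> makes the element count strict.\<close>

lemma room_for_subgroup:
  assumes p: "prime p" "sylow_disjoint (carrier G) p"
    and H: "subgroup H G" "\<not> p dvd card H" and K: "subgroup K G" "card K = card H" "K \<noteq> H"
  shows "n_syl p * (p ^ multiplicity p n - 1) + card H < n"
proof (rule ccontr)
  assume "\<not> ?thesis"
  then have "card (carrier G) \<le> (\<Sum>p\<in>{p}. card (sylows (carrier G) p) * (p ^ multiplicity p (card (carrier G)) - 1)) + card H"
    by (simp add: n_card)
  then have "K = H"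
    by (intro element_count_unique[of "{p}" "carrier G" H K])
      (use p H K subgroup_self subgroup.subset in auto)
  with K(3) show False by simp
qed

lemma two_sylows:
  assumes "prime q" "q dvd n"
  obtains P Q where "P \<in> sylows (carrier G) q" "Q \<in> sylows (carrier G) q" "P \<noteq> Q"
proof -
  have "\<exists>P\<in>sylows (carrier G) q. \<exists>Q\<in>sylows (carrier G) q. P \<noteq> Q"
  proof (rule ccontr)
    assume a: "\<not> ?thesis"
    obtain P where P: "P \<in> sylows (carrier G) q" using syl_nonempty[OF assms(1) subgroup_self] by blast
    then have "sylows (carrier G) q = {P}" using a by blast
    then show False using n_syl_gt_1[OF assms] by simp
  qed
  then show ?thesis using that by blast
qed

lemma room_for_sylow:
  assumes p: "prime p" "sylow_disjoint (carrier G) p" and q: "prime q" "q dvd n" "q \<noteq> p"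
  shows "n_syl p * (p ^ multiplicity p n - 1) + q ^ multiplicity q n < n"
proof -
  obtain P Q where PQ: "P \<in> sylows (carrier G) q" "Q \<in> sylows (carrier G) q" "P \<noteq> Q"
    using two_sylows[OF q(1,2)] .
  have "\<not> p dvd card P"
    using sylD_G(2)[OF PQ(1)] p(1) q(1,3) by (metis prime_dvd_power primes_dvd_imp_eq)
  then show ?thesis
    using room_for_subgroup[OF p sylD_G(1)[OF PQ(1)] _ sylD_G(1)[OF PQ(2)]] sylD_G(2)[OF PQ(1)]
      sylD_G(2)[OF PQ(2)] PQ(3) by simp
qed

lemma room_for_normalizer_in:
  assumes p: "prime p" "sylow_disjoint (carrier G) p" and q: "prime q" "q dvd n"
    and nd: "\<not> p dvd n div n_syl q"
  shows "n_syl p * (p ^ multiplicity p n - 1) + n div n_syl q < n"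
proof -
  obtain P Q where PQ: "P \<in> sylows (carrier G) q" "Q \<in> sylows (carrier G) q" "P \<noteq> Q"
    using two_sylows[OF q] .
  let ?N = "normalizer_in (carrier G)"
  have "?N P \<noteq> ?N Q" using inj_onD[OF normalizer_in_inj[OF q(1) subgroup_self]] PQ by blast
  then show ?thesis
    using room_for_subgroup[OF p normalizer_in_facts(1)[OF q(1) subgroup_self PQ(1)] _ normalizer_in_facts(1)[OF q(1) subgroup_self PQ(2)]]
      n_syl_normalizer_in[OF q(1) PQ(1)] n_syl_normalizer_in[OF q(1) PQ(2)] nd by auto
qed

text \<open>The least \<open>k\<close> with \<open>2 n\<close> dividing \<open>k!\<close> bounds the sizes of all conjugacy classes from below.\<close>

lemma sylow_data_of_count:
  assumes "Sub G \<le> 75"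
  shows "sylow_data n n_syl (LEAST k. 2 * n dvd fact k)"
proof -
  define D where "D = (LEAST k. 2 * n dvd fact k)"
  have le: "D \<le> k" if "2 * n dvd fact k" for k unfolding D_def using that by (rule Least_le)
  have pf: "prime p" "p dvd n" if "p \<in> prime_factors n" for p using that by (auto simp: prime_factors_dvd)
  obtain p where p: "prime p" "p dvd n" using prime_factor_nat[of n] order_gt_one by auto
  have D: "2 * n dvd fact D" unfolding D_def by (rule LeastI[of _ "n_syl p"]) (rule n_syl_half_fact[OF p])
  have eq: "n_syl p * p ^ multiplicity p n \<noteq> n \<longleftrightarrow> n_syl p \<noteq> n div p ^ multiplicity p n" if "p \<in> prime_factors n" for p
  proof -
    have "0 < p ^ multiplicity p n" using sylow_order(2)[OF pf[OF that]] by linarith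
    then show ?thesis using multiplicity_dvd[of p n] by (metis dvd_mult_div_cancel mult.commute nonzero_mult_div_cancel_right less_irrefl)
  qed
  have T: "{n_syl p | p. p \<in> prime_factors n \<and> n_syl p * p ^ multiplicity p n \<noteq> n}
    = {n_syl p | p. p \<in> prime_factors n \<and> n_syl p \<noteq> n div p ^ multiplicity p n}"
    using eq by blast
  have tot: "(\<Sum>p\<in>prime_factors n. n_syl p + (multiplicity p n - 1) * D)
      + \<Sum> {n_syl p | p. p \<in> prime_factors n \<and> n_syl p \<noteq> n div p ^ multiplicity p n} \<le> 73"
    using le_trans[OF subgroup_count[OF le] assms] unfolding T by simp
  show ?thesis
    unfolding D_def[symmetric]
  proof
    show "1 < n" using order_gt_one .
    show "2 * n dvd fact D" by (rule D)
    show "D \<le> n_syl p" if "p \<in> prime_factors n" for p using le[OF n_syl_half_fact[OF pf[OF that]]] .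
    show "[n_syl p = 1] (mod p)" if "p \<in> prime_factors n" for p by (rule n_syl_cong[OF pf(1)[OF that]])
    show "n_syl p dvd n div p ^ multiplicity p n" if "p \<in> prime_factors n" for p
    proof -
      have "p ^ multiplicity p n \<noteq> 0" using sylow_order(2)[OF pf[OF that]] by linarith
      from dvd_div_iff_mult[OF this multiplicity_dvd] show ?thesis using n_syl_dvd[OF pf(1)[OF that]] by blast
    qed
  qed (rule tot)
qed

lemma order_cases:
  assumes "Sub G \<le> 75"
  shows "n = 144 \<and> n_syl 2 = 9 \<and> n_syl 3 = 16 \<or> n = 30 \<and> n_syl 3 = 10 \<and> n_syl 5 = 6 \<or>
    n = 60 \<and> n_syl 3 = 10 \<and> n_syl 5 = 6 \<and> (n_syl 2 = 5 \<or> n_syl 2 = 15) \<or> n = 120 \<and> n_syl 2 = 15 \<and> n_syl 3 = 10 \<and> n_syl 5 = 6 \<or>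
    n = 90 \<and> n_syl 3 = 10 \<and> n_syl 5 = 6 \<or> n = 180 \<and> n_syl 2 = 9 \<and> n_syl 5 = 6 \<or>
    n = 360 \<and> n_syl 2 = 9 \<and> n_syl 5 = 6 \<or> n = 56 \<and> n_syl 2 = 7 \<and> n_syl 7 = 8 \<or> n = 168 \<and> n_syl 3 = 7 \<and> n_syl 7 = 8 \<or>
    n = 252 \<and> n_syl 3 = 7 \<and> n_syl 7 = 36 \<or> n = 504 \<and> n_syl 3 = 7 \<and> n_syl 7 = 8 \<or>
    n = 105 \<and> n_syl 3 = 7 \<and> n_syl 5 = 21 \<and> n_syl 7 = 15 \<or> n = 351 \<and> n_syl 3 = 13 \<and> n_syl 13 = 27"
proof -
  define ss where "ss m = rev (map n_syl (filter (\<lambda>p. p dvd m) sieve_primes))" for m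
  have "(n, ss n) \<in> set (sieve sieve_primes 0 1 0 1)"
    unfolding ss_def by (rule sylow_data.sieve_sound[OF sylow_data_of_count[OF assms]])
  then have mem: "(n, ss n) \<in> {(1, []), (144, [9, 16]), (30, [5, 10, 6]), (30, [15, 10, 6]),
     (60, [5, 10, 6]), (60, [15, 10, 6]), (120, [15, 10, 6]),
     (90, [9, 10, 6]), (90, [15, 10, 6]), (90, [45, 10, 6]),
     (180, [9, 10, 6]), (360, [9, 10, 6]), (56, [7, 8]), (168, [7, 7, 8]),
     (168, [21, 7, 8]), (252, [7, 7, 36]), (504, [7, 7, 8]),
     (504, [9, 7, 8]), (105, [7, 21, 15]), (351, [13, 27])}"
    unfolding sieve_result by (simp only: list.set)
  have "ss 144 = [n_syl 2, n_syl 3]" "ss 30 = [n_syl 2, n_syl 3, n_syl 5]" "ss 60 = [n_syl 2, n_syl 3, n_syl 5]"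
    "ss 120 = [n_syl 2, n_syl 3, n_syl 5]" "ss 90 = [n_syl 2, n_syl 3, n_syl 5]" "ss 180 = [n_syl 2, n_syl 3, n_syl 5]"
    "ss 360 = [n_syl 2, n_syl 3, n_syl 5]" "ss 56 = [n_syl 2, n_syl 7]" "ss 168 = [n_syl 2, n_syl 3, n_syl 7]"
    "ss 252 = [n_syl 2, n_syl 3, n_syl 7]" "ss 504 = [n_syl 2, n_syl 3, n_syl 7]" "ss 105 = [n_syl 3, n_syl 5, n_syl 7]"
    "ss 351 = [n_syl 3, n_syl 13]"
    unfolding ss_def by simp_all
  note ssv = this
  have "n \<noteq> 1" using order_gt_one by simp
  from mem show ?thesis
    unfolding insert_iff prod.inject empty_iff
    using ssv \<open>n \<noteq> 1\<close> by (elim disjE conjE) (simp_all only: list.inject, simp_all)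
qed

lemmas multiplicity_simps = expo_eq_multiplicity[symmetric] expo.simps

text \<open>The factorial of 4 is 24, less than \<open>2 n\<close>.\<close>

lemma index_ge_5:
  assumes "2 * n dvd fact k" "12 < n"
  shows "5 \<le> k"
proof (rule ccontr)
  assume "\<not> 5 \<le> k"
  then have "fact k \<le> (fact 4 :: nat)" by (intro fact_mono) simp
  moreover have "2 * n \<le> fact k" by (rule dvd_imp_le[OF assms(1)]) simp
  moreover have "fact 4 = (24 :: nat)" by (simp add: fact_numeral)
  ultimately show False using assms(2) by linarith
qed

lemma proper_subgroup_index:
  assumes "subgroup K G" "K \<noteq> carrier G" "12 < n"
  shows "5 * card K \<le> n"
proof -
  have "5 \<le> n div card K" using index_ge_5[OF index_half_fact[OF assms(1,2)] assms(3)] .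
  then have "5 * card K \<le> n div card K * card K" by simp
  then show ?thesis using card_dvd_order[OF assms(1)] by simp
qed

text \<open>The remaining orders fall as follows. If the Sylow subgroups of order 9 meet trivially there
are too many elements, and otherwise a centralizer has index below 5 (144 and 90). There is not
enough room for the elements of prime order (30 and 105), or no room for two Sylow subgroups or two Sylow
normalizers besides them (56, 351 and 252). A Sylow normalizer contains Sylow subgroups for a second prime
in an impossible way (168, 504, 180 and 360). Finally, there are too many subgroups (120).\<close>

lemma order_ne_144:
  assumes "n = 144" "n_syl 2 = 9" "n_syl 3 = 16"
  shows False
proof (cases "sylow_disjoint (carrier G) 3")
  case True
  then show False
    using room_for_sylow[of 3 2] assms by (simp add: multiplicity_simps)
next
  case False
  have m: "multiplicity 3 n = 2" using assms(1) by (simp add: multiplicity_simps)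
  have "prime (3::nat)" by simp
  from sylow_square_centralizer[OF this m False]
  obtain z where z: "subgroup (centralizer z) G" "centralizer z \<noteq> carrier G"
    "(3 + 1) * 3\<^sup>2 \<le> card (centralizer z)" .
  then show False using proper_subgroup_index[OF z(1,2)] assms(1) by simp
qed

lemma order_ne_90:
  assumes "n = 90" "n_syl 3 = 10" "n_syl 5 = 6"
  shows False
proof (cases "sylow_disjoint (carrier G) 3")
  case True
  have "sylow_disjoint (carrier G) 5"
    by (rule sylow_disjoint_carrier_prime) (use assms in \<open>simp_all add: multiplicity_simps\<close>)
  then have "(\<Sum>p\<in>{3, 5}. n_syl p * (p ^ multiplicity p n - 1)) + 1 \<le> n"
    using True by (intro element_count_G) auto
  then show False using assms by (simp add: multiplicity_simps)
next
  case False
  have m: "multiplicity 3 n = 2" using assms(1) by (simp add: multiplicity_simps)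
  have "prime (3::nat)" by simp
  from sylow_square_centralizer[OF this m False]
  obtain z where z: "subgroup (centralizer z) G" "centralizer z \<noteq> carrier G"
    "(3 + 1) * 3\<^sup>2 \<le> card (centralizer z)" .
  then show False using proper_subgroup_index[OF z(1,2)] assms(1) by simp
qed

lemma order_ne_30:
  assumes "n = 30" "n_syl 3 = 10" "n_syl 5 = 6"
  shows False
proof -
  have "sylow_disjoint (carrier G) 3" "sylow_disjoint (carrier G) 5"
    by (rule sylow_disjoint_carrier_prime; use assms in \<open>simp add: multiplicity_simps\<close>)+
  then have "(\<Sum>p\<in>{3, 5}. n_syl p * (p ^ multiplicity p n - 1)) + 1 \<le> n"
    by (intro element_count_G) auto
  then show False using assms by (simp add: multiplicity_simps)
qed

lemma order_ne_105:
  assumes "n = 105" "n_syl 3 = 7" "n_syl 5 = 21" "n_syl 7 = 15"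
  shows False
proof -
  have "sylow_disjoint (carrier G) 3" "sylow_disjoint (carrier G) 5" "sylow_disjoint (carrier G) 7"
    by (rule sylow_disjoint_carrier_prime; use assms in \<open>simp add: multiplicity_simps\<close>)+
  then have "(\<Sum>p\<in>{3, 5, 7}. n_syl p * (p ^ multiplicity p n - 1)) + 1 \<le> n"
    by (intro element_count_G) auto
  then show False using assms by (simp add: multiplicity_simps)
qed

lemma order_ne_56:
  assumes "n = 56" "n_syl 7 = 8"
  shows False
proof -
  have "sylow_disjoint (carrier G) 7"
    by (rule sylow_disjoint_carrier_prime) (use assms in \<open>simp_all add: multiplicity_simps\<close>)
  then show False using room_for_sylow[of 7 2] assms by (simp add: multiplicity_simps)
qed

lemma order_ne_351:
  assumes "n = 351" "n_syl 13 = 27"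
  shows False
proof -
  have "sylow_disjoint (carrier G) 13"
    by (rule sylow_disjoint_carrier_prime) (use assms in \<open>simp_all add: multiplicity_simps\<close>)
  then show False using room_for_sylow[of 13 3] assms by (simp add: multiplicity_simps)
qed

lemma order_ne_252:
  assumes "n = 252" "n_syl 3 = 7" "n_syl 7 = 36"
  shows False
proof -
  have "sylow_disjoint (carrier G) 7"
    by (rule sylow_disjoint_carrier_prime) (use assms in \<open>simp_all add: multiplicity_simps\<close>)
  then show False using room_for_normalizer_in[of 7 3] assms by (simp add: multiplicity_simps)
qed

lemma normalizer_in_obstruction:
  assumes p: "prime p" "p dvd n" and q: "prime q" "q dvd n"
    and full: "q ^ multiplicity q n dvd n div n_syl p"
    and no: "\<And>m. m dvd (n div n_syl p) div q ^ multiplicity q n \<Longrightarrow> m mod q = 1 mod q \<Longrightarrow> m < n_syl q \<Longrightarrow> m = 1"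
    and nd: "\<not> n_syl q dvd n_syl p"
  shows False
proof -
  obtain m where m: "m * q ^ multiplicity q n dvd n div n_syl p" "[m = 1] (mod q)" "m < n_syl q" "m = 1 \<Longrightarrow> n_syl q dvd n_syl p"
    using sylow_in_normalizer_in[OF p q full] by blast
  have "q ^ multiplicity q n \<noteq> 0" using q(1) by auto
  then have "m dvd (n div n_syl p) div q ^ multiplicity q n"
    using m(1) full by (simp add: dvd_div_iff_mult)
  then have "m = 1" using no m(2,3) by (simp add: cong_def)
  then show False using m(4) nd by blast
qed

lemma dvd_7_cases: "m dvd 7 \<Longrightarrow> m = 1 \<or> m = 7" for m :: nat
  using prime_nat_iff[of 7] by auto

lemma order_ne_168:
  assumes "n = 168" "n_syl 3 = 7" "n_syl 7 = 8"
  shows False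
  by (rule normalizer_in_obstruction[of 7 3]) (use assms dvd_7_cases in \<open>auto simp: multiplicity_simps\<close>)

lemma order_ne_504:
  assumes "n = 504" "n_syl 3 = 7" "n_syl 7 = 8"
  shows False
  by (rule normalizer_in_obstruction[of 7 3]) (use assms dvd_7_cases in \<open>auto simp: multiplicity_simps\<close>)

lemma less_6_mod_5: "m mod 5 = Suc 0 \<Longrightarrow> m < 6 \<Longrightarrow> m = 1" for m :: nat
  by presburger

lemma order_ne_180:
  assumes "n = 180" "n_syl 2 = 9" "n_syl 5 = 6"
  shows False
  by (rule normalizer_in_obstruction[of 2 5]) (use assms less_6_mod_5 in \<open>auto simp: multiplicity_simps\<close>)

lemma order_ne_360:
  assumes "n = 360" "n_syl 2 = 9" "n_syl 5 = 6"
  shows False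
  by (rule normalizer_in_obstruction[of 2 5]) (use assms less_6_mod_5 in \<open>auto simp: multiplicity_simps\<close>)

text \<open>The orders 6 and 10 come from extending Sylow subgroups by an involution; together with the Sylow subgroups,
their normalizers and the 2-subgroups there are at least 77 subgroups.\<close>

lemma order_ne_120:
  assumes n: "n = 120" and s: "n_syl 2 = 15" "n_syl 3 = 10" "n_syl 5 = 6" and S: "Sub G \<le> 75"
  shows False
proof -
  have d: "6 \<le> k" if "2 * n dvd fact k" for k
  proof (rule ccontr)
    assume "\<not> 6 \<le> k"
    then have "fact k \<le> (fact 5 :: nat)" by (intro fact_mono) simp
    moreover have "2 * n \<le> fact k" by (rule dvd_imp_le[OF that]) simp
    ultimately show False using n by (simp add: fact_numeral)
  qed
  have ex: "\<exists>S. subgroup S G \<and> card S = 2 ^ i" if "i \<le> 3" for i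
  proof -
    have "(2::nat) ^ i dvd 2 ^ 3" using that by (rule le_imp_power_dvd)
    moreover have "2 ^ 3 dvd card (carrier G)" using n by (simp add: n_card)
    ultimately have "2 ^ i dvd card (carrier G)" by (rule dvd_trans)
    then show ?thesis using prime_power_subgroup[OF two_is_prime_nat subgroup_self] by blast
  qed
  have "6 \<le> nsub 2"
  proof -
    obtain S where "subgroup S G" "card S = 2 ^ 1" using ex[of 1] by auto
    then show ?thesis using nsub_ge[of S 2 6] d n by simp
  qed
  moreover have "6 \<le> nsub 4"
  proof -
    obtain S where "subgroup S G" "card S = 2 ^ 2" using ex[of 2] by auto
    then show ?thesis using nsub_ge[of S 4 6] d n by simp
  qed
  moreover have "nsub 8 = 15" "nsub 3 = 10" "nsub 5 = 6"
    using n_syl_eq_nsub[of 2] n_syl_eq_nsub[of 3] n_syl_eq_nsub[of 5] s n by (simp_all add: multiplicity_simps)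
  moreover have "10 \<le> nsub 12" "6 \<le> nsub 20"
    using n_syl_le_nsub_normalizer_in[of 3] n_syl_le_nsub_normalizer_in[of 5] s n by simp_all
  moreover have "10 \<le> nsub 6" "6 \<le> nsub 10"
    using nsub_sylow_extension[of 3 2] nsub_sylow_extension[of 5 2] s n by (simp_all add: multiplicity_simps)
  moreover have "(\<Sum>m\<in>{1, n, 2, 4, 8, 3, 5, 12, 20, 6, 10}. nsub m) \<le> Sub G" by (rule sum_nsub_le_Sub) simp
  moreover have "nsub n = 1" "nsub 1 = 1" by (rule nsub_order, rule nsub_1)
  ultimately show False using S n by simp
qed

theorem order_60:
  assumes "Sub G \<le> 75"
  shows "n = 60" "n_syl 3 = 10" "n_syl 5 = 6" "n_syl 2 = 5 \<or> n_syl 2 = 15"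
proof -
  have no_144: "(n = 144 \<and> n_syl 2 = 9 \<and> n_syl 3 = 16) = False" using order_ne_144 by blast
  have no_30: "(n = 30 \<and> n_syl 3 = 10 \<and> n_syl 5 = 6) = False" using order_ne_30 by blast
  have no_90: "(n = 90 \<and> n_syl 3 = 10 \<and> n_syl 5 = 6) = False" using order_ne_90 by blast
  have no_180: "(n = 180 \<and> n_syl 2 = 9 \<and> n_syl 5 = 6) = False" using order_ne_180 by blast
  have no_360: "(n = 360 \<and> n_syl 2 = 9 \<and> n_syl 5 = 6) = False" using order_ne_360 by blast
  have no_56: "(n = 56 \<and> n_syl 2 = 7 \<and> n_syl 7 = 8) = False" using order_ne_56 by blast
  have no_168: "(n = 168 \<and> n_syl 3 = 7 \<and> n_syl 7 = 8) = False" using order_ne_168 by blast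
  have no_252: "(n = 252 \<and> n_syl 3 = 7 \<and> n_syl 7 = 36) = False" using order_ne_252 by blast
  have no_504: "(n = 504 \<and> n_syl 3 = 7 \<and> n_syl 7 = 8) = False" using order_ne_504 by blast
  have no_105: "(n = 105 \<and> n_syl 3 = 7 \<and> n_syl 5 = 21 \<and> n_syl 7 = 15) = False" using order_ne_105 by blast
  have no_351: "(n = 351 \<and> n_syl 3 = 13 \<and> n_syl 13 = 27) = False" using order_ne_351 by blast
  have no_120: "(n = 120 \<and> n_syl 2 = 15 \<and> n_syl 3 = 10 \<and> n_syl 5 = 6) = False"
    using order_ne_120[OF _ _ _ _ assms] by blast
  have "n = 60 \<and> n_syl 3 = 10 \<and> n_syl 5 = 6 \<and> (n_syl 2 = 5 \<or> n_syl 2 = 15)"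
    using order_cases[OF assms] unfolding no_144 no_30 no_90 no_180 no_360 no_56 no_168 no_252 no_504 no_105 no_351 no_120 simp_thms .
  then show "n = 60" "n_syl 3 = 10" "n_syl 5 = 6" "n_syl 2 = 5 \<or> n_syl 2 = 15" by blast+
qed

end

section \<open>The subgroups of a simple group of order 60\<close>

text \<open>The Sylow numbers that the sieve leaves for order 60; the value 15 for the prime 2 is excluded below.\<close>

locale simple_group_60 = nonabelian_simple_group +
  assumes order60: "n = 60" and n_syl_3: "n_syl 3 = 10" and n_syl_5: "n_syl 5 = 6" and n_syl_2_cases: "n_syl 2 = 5 \<or> n_syl 2 = 15"
begin

lemma mult60: "multiplicity 2 n = 2" "multiplicity 3 n = 1" "multiplicity 5 n = 1"
  using order60 by (simp_all add: multiplicity_simps)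

lemma proper_le_12:
  assumes "subgroup K G" "K \<noteq> carrier G"
  shows "card K \<le> 12"
  using proper_subgroup_index[OF assms] order60 by simp

lemma card_ne_carrier: "card K \<noteq> 60 \<Longrightarrow> K \<noteq> carrier G"
  using order60 by (auto simp: n_card)

lemma normalizer_in_if_unique_sylow:
  assumes p: "prime p" and C: "subgroup C G" "card C = n div n_syl p" and one: "card (sylows C p) = 1"
    and m: "multiplicity p (card C) = multiplicity p n"
  shows "C \<in> normalizer_in (carrier G) ` sylows (carrier G) p"
proof -
  obtain P where P: "sylows C p = {P}" using one card_1_singletonE by blast
  have CG: "C \<subseteq> carrier G" by (rule subgroup.subset[OF C(1)])
  have PG: "P \<in> sylows (carrier G) p" using P m CG unfolding sylows_def n_card by auto
  have "C \<subseteq> normalizer_in (carrier G) P"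
  proof
    fix g assume g: "g \<in> C"
    have "conj_set g P \<in> sylows C p" using conj_set_syl[OF _ g C(1), of P p] P by simp
    then show "g \<in> normalizer_in (carrier G) P" using P g CG unfolding normalizer_in_def by auto
  qed
  moreover have "card C = card (normalizer_in (carrier G) P)" using n_syl_normalizer_in[OF p PG] C(2) by simp
  ultimately have "C = normalizer_in (carrier G) P"
    using card_subset_eq normalizer_in_facts(1)[OF p subgroup_self PG] finite_subgroup by blast
  then show ?thesis using PG by blast
qed

text \<open>A subgroup of the order of a Sylow normalizer that has only one Sylow \<open>p\<close>-subgroup is the normalizer of
it.\<close>

lemma nsub_normalizer_in:
  assumes p: "prime p" and m: "multiplicity p (n div n_syl p) = multiplicity p n"
    and one: "\<And>C. subgroup C G \<Longrightarrow> card C = n div n_syl p \<Longrightarrow> card (sylows C p) = 1"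
  shows "nsub (n div n_syl p) = n_syl p"
proof -
  have "{C. subgroup C G \<and> card C = n div n_syl p} = normalizer_in (carrier G) ` sylows (carrier G) p"
  proof (intro equalityI subsetI)
    fix C assume "C \<in> {C. subgroup C G \<and> card C = n div n_syl p}"
    then show "C \<in> normalizer_in (carrier G) ` sylows (carrier G) p"
      using normalizer_in_if_unique_sylow[OF p] one m by simp
  next
    fix C assume "C \<in> normalizer_in (carrier G) ` sylows (carrier G) p"
    then show "C \<in> {C. subgroup C G \<and> card C = n div n_syl p}"
      using normalizer_in_facts(1)[OF p subgroup_self] n_syl_normalizer_in[OF p] by auto
  qed
  then show ?thesis unfolding nsub_def using card_image[OF normalizer_in_inj[OF p subgroup_self]] by simp
qed

text \<open>The Sylow number is 1 or 4, and it is not 1 because the normalizer of a subgroup of order 3 has order 6.\<close>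

lemma card_syl_12:
  assumes C: "subgroup C G" "card C = 12"
  shows "card (sylows C 3) = 4"
proof -
  have m: "multiplicity 3 (card C) = 1" by (simp add: C multiplicity_simps)
  have p3: "prime (3::nat)" by simp
  let ?m = "card (sylows C 3)"
  have "?m * 3 dvd card C" using card_syl_dvd[OF p3 C(1)] unfolding m by simp
  then have d: "?m dvd 4" using dvd_times_right_cancel_iff[of "3::nat" ?m 4] C(2) by simp
  then have "?m \<le> 4" by (rule dvd_imp_le) simp
  moreover have c: "?m mod 3 = 1" using card_syl_cong_1[OF p3 C(1)] by (simp add: cong_def)
  ultimately consider "?m = 1" | "?m = 4" using d by (cases "?m \<in> {0, 1, 2, 3, 4}") auto
  then show ?thesis
  proof cases
    case 1
    then obtain T where T: "sylows C 3 = {T}" using card_1_singletonE by blast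
    have CG: "C \<subseteq> carrier G" by (rule subgroup.subset[OF C(1)])
    have TG: "T \<in> sylows (carrier G) 3" using T m CG mult60(2) unfolding sylows_def n_card by auto
    have "C \<subseteq> normalizer_in (carrier G) T"
    proof
      fix g assume g: "g \<in> C"
      have "conj_set g T \<in> sylows C 3" using conj_set_syl[OF _ g C(1), of T 3] T by simp
      then show "g \<in> normalizer_in (carrier G) T" using T g CG unfolding normalizer_in_def by auto
    qed
    then have "card C \<le> card (normalizer_in (carrier G) T)"
      using normalizer_in_facts(1)[OF p3 subgroup_self TG] by (intro card_mono) auto
    then show ?thesis using n_syl_normalizer_in[OF p3 TG] C(2) order60 n_syl_3 by simp
  qed
qed

text \<open>A central element of a subgroup of order 12 normalizes, hence belongs to, each of its four
  subgroups of order 3.\<close>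

lemma center_of_order_12:
  assumes C: "subgroup C G" "card C = 12" and x: "x \<in> C" "\<And>c. c \<in> C \<Longrightarrow> c \<otimes> x = x \<otimes> c"
  shows "x = \<one>"
proof -
  have m: "multiplicity 3 (card C) = 1" by (simp add: C multiplicity_simps)
  have p3: "prime (3::nat)" by simp
  have xG: "x \<in> carrier G" using subgroup.mem_carrier[OF C(1) x(1)] .
  have inT: "x \<in> T" if T: "T \<in> sylows C 3" for T
  proof -
    note N = normalizer_in_facts[OF p3 C(1) T]
    have "card T = 3" using sylD(3)[OF T] m by simp
    moreover have "card (normalizer_in C T) = 3" using N(4) card_syl_12[OF C] C(2) by simp
    ultimately have "normalizer_in C T = T"
      using N(2) card_subset_eq[OF finite_subgroup[OF N(1)]] by metis
    moreover have "x \<in> normalizer_in C T"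
    proof (rule normalizer_inI[OF _ _ x(1) xG])
      show "finite T" "T \<subseteq> carrier G" using sylD(1)[OF T] subgroup.subset by auto
      fix t assume t: "t \<in> T"
      then have "t \<in> C" "t \<in> carrier G" using sylD(2)[OF T] subgroup.mem_carrier[OF C(1)] by auto
      then have "x \<otimes> t \<otimes> inv x = t" using x(2)[of t] xG by (metis inv_solve_right' m_closed)
      then show "x \<otimes> t \<otimes> inv x \<in> T" using t by simp
    qed
    ultimately show ?thesis by simp
  qed
  obtain T where T: "T \<in> sylows C 3" using syl_nonempty[OF p3 C(1)] by blast
  have "sylows C 3 \<noteq> {T}"
  proof
    assume "sylows C 3 = {T}"
    then show False using card_syl_12[OF C] by simp
  qed
  then have "\<exists>U\<in>sylows C 3. T \<noteq> U" using T by auto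
  then obtain U where TU: "T \<in> sylows C 3" "U \<in> sylows C 3" "T \<noteq> U" using T by auto
  have "card T = 3" "card U = 3" using sylD(3)[OF TU(1)] sylD(3)[OF TU(2)] m by simp_all
  then have "T \<inter> U = {\<one>}"
    by (rule prime_subgroups_Int[OF p3 sylD(1)[OF TU(1)] sylD(1)[OF TU(2)] _ _ TU(3)])
  then show ?thesis using inT[OF TU(1)] inT[OF TU(2)] by blast
qed

lemma sylow_disjoint_60:
  "sylow_disjoint (carrier G) 2" "sylow_disjoint (carrier G) 3" "sylow_disjoint (carrier G) 5"
proof -
  show "sylow_disjoint (carrier G) 3" "sylow_disjoint (carrier G) 5"
    by (rule sylow_disjoint_carrier_prime; use mult60 in simp)+
  show "sylow_disjoint (carrier G) 2"
  proof (rule ccontr)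
    assume nd: "\<not> ?thesis"
    have "prime (2::nat)" by simp
    from sylow_square_centralizer[OF this mult60(1) nd]
    obtain z where z: "z \<in> carrier G" "z \<noteq> \<one>" "subgroup (centralizer z) G" "centralizer z \<noteq> carrier G"
      "(2 + 1) * 2\<^sup>2 \<le> card (centralizer z)" .
    have "card (centralizer z) = 12" using proper_le_12[OF z(3,4)] z(5) by simp
    then have "z = \<one>"
    proof (rule center_of_order_12[OF z(3)])
      show "z \<in> centralizer z" using z(1) unfolding centralizer_def by blast
      show "c \<otimes> z = z \<otimes> c" if "c \<in> centralizer z" for c using that unfolding centralizer_def by blast
    qed
    with z(2) show False by blast
  qed
qed

lemma n_syl_2: "n_syl 2 = 5"
proof (rule ccontr)
  assume "n_syl 2 \<noteq> 5"
  then have "n_syl 2 = 15" using n_syl_2_cases by blast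
  moreover have "(\<Sum>p\<in>{2, 3, 5}. n_syl p * (p ^ multiplicity p n - 1)) + 1 \<le> n"
    using sylow_disjoint_60 by (intro element_count_G) auto
  ultimately show False using n_syl_3 n_syl_5 mult60 order60 by simp
qed

lemma nsub_6: "nsub 6 = 10"
proof -
  have "nsub (n div n_syl 3) = n_syl 3"
  proof (rule nsub_normalizer_in)
    fix C assume C: "subgroup C G" "card C = n div n_syl 3"
    then have c: "card C = 6" using order60 n_syl_3 by simp
    have m: "multiplicity 3 (card C) = 1" by (simp add: c multiplicity_simps)
    have "card (sylows C 3) * 3 dvd card C" using card_syl_dvd[OF _ C(1), of 3] unfolding m by simp
    then have "card (sylows C 3) dvd 2"
      using dvd_times_right_cancel_iff[of "3::nat" "card (sylows C 3)" 2] c by simp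
    then have "card (sylows C 3) \<le> 2" by (rule dvd_imp_le) simp
    moreover have "card (sylows C 3) mod 3 = 1" using card_syl_cong_1[OF _ C(1), of 3] by (simp add: cong_def)
    ultimately show "card (sylows C 3) = 1" by (cases "card (sylows C 3) \<in> {0, 1, 2}") auto
  qed (use order60 n_syl_3 in \<open>simp_all add: multiplicity_simps\<close>)
  then show ?thesis using order60 n_syl_3 by simp
qed

lemma nsub_10: "nsub 10 = 6"
proof -
  have "nsub (n div n_syl 5) = n_syl 5"
  proof (rule nsub_normalizer_in)
    fix C assume C: "subgroup C G" "card C = n div n_syl 5"
    then have c: "card C = 10" using order60 n_syl_5 by simp
    have m: "multiplicity 5 (card C) = 1" by (simp add: c multiplicity_simps)
    have "card (sylows C 5) * 5 dvd card C" using card_syl_dvd[OF _ C(1), of 5] unfolding m by simp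
    then have "card (sylows C 5) dvd 2"
      using dvd_times_right_cancel_iff[of "5::nat" "card (sylows C 5)" 2] c by simp
    then have "card (sylows C 5) \<le> 2" by (rule dvd_imp_le) simp
    moreover have "card (sylows C 5) mod 5 = 1" using card_syl_cong_1[OF _ C(1), of 5] by (simp add: cong_def)
    ultimately show "card (sylows C 5) = 1" by (cases "card (sylows C 5) \<in> {0, 1, 2}") auto
  qed (use order60 n_syl_5 in \<open>simp_all add: multiplicity_simps\<close>)
  then show ?thesis using order60 n_syl_5 by simp
qed

text \<open>The four subgroups of order 3 leave room for only one Sylow 2-subgroup.\<close>

lemma nsub_12: "nsub 12 = 5"
proof -
  have "nsub (n div n_syl 2) = n_syl 2"
  proof (rule nsub_normalizer_in)
    fix C assume C: "subgroup C G" "card C = n div n_syl 2"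
    then have c: "card C = 12" using order60 n_syl_2 by simp
    have m: "multiplicity 3 (card C) = 1" "multiplicity 2 (card C) = 2" by (simp_all add: c multiplicity_simps)
    obtain H where H: "H \<in> sylows C 2" using syl_nonempty[OF two_is_prime_nat C(1)] by blast
    have cH: "card K = 4" if "K \<in> sylows C 2" for K using sylD(3)[OF that] m by simp
    have "K = H" if K: "K \<in> sylows C 2" for K
    proof (rule element_count_unique[of "{3}" C H K])
      show "card C \<le> (\<Sum>p\<in>{3}. card (sylows C p) * (p ^ multiplicity p (card C) - 1)) + card H"
        using card_syl_12[OF C(1) c] m cH[OF H] c by simp
      show "sylow_disjoint C p" if "p \<in> {3}" for p using sylow_disjoint_prime[of 3 C] m that by simp
      show "\<not> p dvd card H" if "p \<in> {3}" for p using that cH[OF H] by simp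
    qed (use C(1) sylD[OF H] sylD[OF K] in auto)
    then have "sylows C 2 = {H}" using H by blast
    then show "card (sylows C 2) = 1" by simp
  qed (use order60 n_syl_2 in \<open>simp_all add: multiplicity_simps\<close>)
  then show ?thesis using order60 n_syl_2 by simp
qed

lemma nsub_large: "m \<in> {15, 20, 30} \<Longrightarrow> nsub m = 0"
proof -
  assume m: "m \<in> {15, 20, 30}"
  have "\<not> (subgroup C G \<and> card C = m)" for C
    using proper_le_12[of C] card_ne_carrier[of C] m by auto
  then have "{C. subgroup C G \<and> card C = m} = {}" by blast
  then show ?thesis unfolding nsub_def by simp
qed

text \<open>At most 15 elements are left besides the identity and those of order 3 and 5.\<close>

lemma nsub_2_le: "nsub 2 \<le> 15"
proof -
  let ?S = "{H. subgroup H G \<and> card H = 2}"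
  let ?I = "\<Union>H\<in>?S. H - {\<one>}"
  let ?U = "\<Union>p\<in>{3, 5}. syl_elts (carrier G) p"
  have "card ?I = (\<Sum>H\<in>?S. card (H - {\<one>}))"
  proof (rule card_UN_disjoint)
    show "\<forall>H\<in>?S. \<forall>K\<in>?S. H \<noteq> K \<longrightarrow> (H - {\<one>}) \<inter> (K - {\<one>}) = {}"
      using prime_subgroups_Int[OF two_is_prime_nat] by blast
  qed auto
  also have "\<dots> = (\<Sum>H\<in>?S. 1)"
    by (rule sum.cong) (auto simp: subgroup.one_closed)
  finally have cI: "card ?I = nsub 2" unfolding nsub_def by simp
  have cU: "card ?U = 44"
  proof -
    have "card ?U = (\<Sum>p\<in>{3, 5}. n_syl p * (p ^ multiplicity p (card (carrier G)) - 1))"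
      by (rule card_UN_syl_elts) (use sylow_disjoint_60 subgroup_self in auto)
    then show ?thesis using n_syl_3 n_syl_5 mult60 by (simp add: n_card[symmetric])
  qed
  have "syl_elts (carrier G) p \<inter> H = {}" if "H \<in> ?S" "p \<in> {3, 5}" for p H
    by (rule syl_elts_subgroup_disjoint) (use that in auto)
  then have d: "?I \<inter> ?U = {}" by blast
  have one: "\<one> \<notin> ?I \<union> ?U" unfolding syl_elts_def by blast
  have sub: "insert \<one> (?I \<union> ?U) \<subseteq> carrier G"
    using subgroup.subset syl_elts_subset[of "carrier G"] by (intro insert_subsetI Un_least UN_least) auto
  then have IU: "?I \<subseteq> carrier G" "?U \<subseteq> carrier G" by simp_all
  have f: "finite ?I" "finite ?U" by (rule finite_subset[OF IU(1) fin], rule finite_subset[OF IU(2) fin])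
  have "card (insert \<one> (?I \<union> ?U)) = Suc (card ?I + card ?U)"
    using one f d by (simp add: card_Un_disjoint)
  moreover have "card (insert \<one> (?I \<union> ?U)) \<le> n" unfolding n_card by (rule card_mono[OF fin sub])
  ultimately show ?thesis using cI cU order60 by simp
qed

text \<open>The normalizer of a subgroup of order 2 centralizes it and contains a Sylow 2-subgroup. Its order is a
multiple of 4, at most 12, and not 12 because subgroups of order 12 have trivial centre; so it is 4 and the conjugacy class
has 15 members.\<close>

lemma nsub_2_ge: "15 \<le> nsub 2"
proof -
  obtain P where P: "P \<in> sylows (carrier G) 2" using syl_nonempty[OF two_is_prime_nat subgroup_self] by blast
  have Ps: "subgroup P G" "card P = 2\<^sup>2" using sylD_G[OF P] mult60 by simp_all
  obtain H where H: "subgroup H G" "H \<subseteq> P" "card H = 2"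
    using prime_power_subgroup[OF two_is_prime_nat Ps(1), of 1] Ps(2) by auto
  have HG: "H \<subseteq> carrier G" by (rule subgroup.subset[OF H(1)])
  have "card (H - {\<one>}) = 1" using H(3) subgroup.one_closed[OF H(1)] by simp
  then obtain t where t: "H - {\<one>} = {t}" using card_1_singletonE by blast
  then have Ht: "H = {\<one>, t}" "t \<noteq> \<one>" "t \<in> H" using subgroup.one_closed[OF H(1)] by blast+
  have tG: "t \<in> carrier G" using Ht HG by blast
  let ?N = "normalizer_in (carrier G) H"
  have N: "subgroup ?N G" by (rule normalizer_in_subgroup[OF subgroup_self HG])
  have "H \<noteq> carrier G" "H \<noteq> {\<one>}" using card_ne_carrier H(3) by auto
  then have "?N \<noteq> carrier G" using normal_of_normalizer_in[OF H(1)] no_real_normal_subgroup by blast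
  then have le: "card ?N \<le> 12" by (rule proper_le_12[OF N])
  have Nt: "g \<otimes> t = t \<otimes> g" if g: "g \<in> ?N" for g
  proof -
    have gG: "g \<in> carrier G" using subgroup.mem_carrier[OF N g] .
    have "g \<otimes> t \<otimes> inv g \<in> {\<one>, t}" using normalizer_in_mem[OF g Ht(3)] Ht(1) by simp
    moreover have "g \<otimes> t \<otimes> inv g \<noteq> \<one>"
    proof
      assume "g \<otimes> t \<otimes> inv g = \<one>"
      then have "g \<otimes> t = g" using gG tG by (metis inv_solve_right' l_one m_closed one_closed)
      then show False using gG tG Ht(2) by (metis l_cancel_one)
    qed
    ultimately have "g \<otimes> t \<otimes> inv g = t" by simp
    then show ?thesis using gG tG by (metis inv_solve_right' m_closed)
  qed
  have "P \<subseteq> ?N"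
  proof
    fix g assume g: "g \<in> P"
    have gG: "g \<in> carrier G" using subgroup.mem_carrier[OF Ps(1) g] .
    show "g \<in> ?N"
    proof (rule normalizer_inI[OF _ HG gG gG])
      fix x assume x: "x \<in> H"
      then have "g \<otimes> x = x \<otimes> g" "x \<in> carrier G"
        using prime_square_commute[OF two_is_prime_nat Ps g, of x] H(2) HG by auto
      then have "g \<otimes> x \<otimes> inv g = x" using gG by (metis inv_solve_right' m_closed)
      then show "g \<otimes> x \<otimes> inv g \<in> H" using x by simp
    qed (use H(1) in simp)
  qed
  then have "4 dvd card ?N" using card_subgroup_dvd[OF Ps(1) N] Ps(2) by simp
  moreover have "card ?N dvd 60" using card_dvd_order[OF N] order60 by simp
  moreover have "card ?N \<noteq> 12"
  proof
    assume c: "card ?N = 12"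
    have "t \<in> ?N" using subset_normalizer_in[OF H(1) HG] Ht(3) by blast
    then show False using center_of_order_12[OF N c _ Nt] Ht(2) by blast
  qed
  ultimately have cN: "card ?N = 4"
  proof -
    assume a: "4 dvd card ?N" "card ?N dvd 60" "card ?N \<noteq> 12"
    obtain k where k: "card ?N = 4 * k" using a(1) by blast
    have "k \<le> 3" using k le by simp
    moreover have "k \<noteq> 0" using k card_subgroup_pos[OF N] by (intro notI) simp
    moreover have "k \<noteq> 2" using k a(2) by (intro notI) simp
    moreover have "k \<noteq> 3" using k a(3) by simp
    ultimately show ?thesis using k by (cases "k \<in> {0, 1, 2, 3}") auto
  qed
  have "card ((\<lambda>g. conj_set g H) ` carrier G) * card ?N = card (carrier G)"
    by (rule conjugates_count[OF subgroup_self fin HG])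
  then have "card ((\<lambda>g. conj_set g H) ` carrier G) = 15" using cN order60 by (simp add: n_card)
  moreover have "card ((\<lambda>g. conj_set g H) ` carrier G) \<le> nsub 2"
    unfolding nsub_def
  proof (rule card_mono)
    show "(\<lambda>g. conj_set g H) ` carrier G \<subseteq> {H. subgroup H G \<and> card H = 2}"
      using conj_set_subgroup H card_conj_set HG by auto
  qed simp
  ultimately show ?thesis by simp
qed

lemma nsub_prime: "nsub 2 = 15" "nsub 3 = 10" "nsub 5 = 6"
  using nsub_2_le nsub_2_ge n_syl_eq_nsub[of 3] n_syl_eq_nsub[of 5] n_syl_3 n_syl_5 mult60 by simp_all

lemma nsub_4: "nsub 4 = 5"
  using n_syl_eq_nsub[of 2] n_syl_2 mult60 by simp

theorem Sub_60: "Sub G = 59"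
proof -
  have "Sub G = (\<Sum>m\<in>{1, 2, 3, 4, 5, 6, 10, 12, 15, 20, 30, n}. nsub m)"
  proof (rule Sub_eq_sum_nsub)
    fix m assume "m dvd order G"
    then have "m dvd 60" unfolding order60 .
    have "m = 1 \<or> m \<in> {2..<61}"
      using dvd_imp_le[OF \<open>m dvd 60\<close>] \<open>m dvd 60\<close> by (cases "m = 0") auto
    moreover have "list_all (\<lambda>d::nat. d dvd 60 \<longrightarrow> d \<in> {2, 3, 4, 5, 6, 10, 12, 15, 20, 30, 60}) [2..<61]"
      by (simp add: upt_rec_numeral)
    then have "m \<in> {2..<61} \<Longrightarrow> m \<in> {2, 3, 4, 5, 6, 10, 12, 15, 20, 30, 60}"
      using \<open>m dvd 60\<close> unfolding list_all_iff set_upt by blast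
    ultimately show "m \<in> {1, 2, 3, 4, 5, 6, 10, 12, 15, 20, 30, n}" unfolding order60 by blast
  qed simp
  moreover have "nsub n = 1" "nsub 1 = 1" by (rule nsub_order, rule nsub_1)
  ultimately show ?thesis
    using nsub_prime nsub_4 nsub_6 nsub_10 nsub_12 nsub_large order60 by simp
qed

end

section \<open>Extensions of a simple group of order 60\<close>

lemma Sub_le_of_inj_hom:
  assumes h: "group_hom G H h" and inj: "inj_on h (carrier G)" and fin: "finite (carrier H)"
  shows "Sub G \<le> Sub H"
proof -
  interpret h: group_hom G H h by fact
  show ?thesis
    unfolding Sub_def
  proof (rule card_inj_on_le)
    show "inj_on ((`) h) {K. subgroup K G}"
    proof (rule inj_onI)
      fix K L assume "K \<in> {K. subgroup K G}" "L \<in> {K. subgroup K G}" "h ` K = h ` L"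
      then show "K = L" using inj_on_image_eq_iff[OF inj] subgroup.subset by (metis mem_Collect_eq)
    qed
    show "(`) h ` {K. subgroup K G} \<subseteq> {K. subgroup K H}"
      using h.subgroup_img_is_subgroup by auto
    show "finite {K. subgroup K H}"
      by (rule finite_subset[of _ "Pow (carrier H)"]) (use subgroup.subset fin in auto)
  qed
qed

context group_hom
begin

definition preim :: "'c set \<Rightarrow> 'a set"
  where "preim K = {x \<in> carrier G. h x \<in> K}"

lemma preim_subgroup:
  assumes "subgroup K H"
  shows "subgroup (preim K) G"
proof (rule G.subgroupI)
  show "preim K \<subseteq> carrier G" unfolding preim_def by blast
  show "preim K \<noteq> {}" using subgroup.one_closed[OF assms] hom_one unfolding preim_def by force
  show "inv a \<in> preim K" if "a \<in> preim K" for a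
    using that subgroup.m_inv_closed[OF assms] unfolding preim_def by auto
  show "a \<otimes> b \<in> preim K" if "a \<in> preim K" "b \<in> preim K" for a b
    using that subgroup.m_closed[OF assms] unfolding preim_def by auto
qed

lemma image_preim:
  assumes "h ` carrier G = carrier H" "K \<subseteq> carrier H"
  shows "h ` preim K = K"
proof
  show "K \<subseteq> h ` preim K"
  proof
    fix y assume y: "y \<in> K"
    then obtain x where "x \<in> carrier G" "y = h x" using assms by blast
    then show "y \<in> h ` preim K" using y unfolding preim_def by blast
  qed
qed (auto simp: preim_def)

lemma card_preim:
  assumes surj: "h ` carrier G = carrier H" and fin: "finite (carrier G)" and K: "K \<subseteq> carrier H"
  shows "card (preim K) = card K * card (kernel G H h)"
proof -
  have fibre: "card {x \<in> preim K. h x = y} = card (kernel G H h)" if y: "y \<in> K" for y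
  proof -
    obtain x0 where x0: "x0 \<in> carrier G" "y = h x0" using y K surj by blast
    have "bij_betw (\<lambda>r. x0 \<otimes> r) (kernel G H h) {x \<in> preim K. h x = y}"
    proof (rule bij_betw_byWitness[where f' = "\<lambda>x. inv x0 \<otimes> x"])
      show "\<forall>a\<in>kernel G H h. inv x0 \<otimes> (x0 \<otimes> a) = a"
        using x0 by (auto simp: kernel_def G.m_assoc[symmetric])
      show "\<forall>a\<in>{x \<in> preim K. h x = y}. x0 \<otimes> (inv x0 \<otimes> a) = a"
        using x0 by (auto simp: preim_def G.m_assoc[symmetric])
      show "(\<otimes>) x0 ` kernel G H h \<subseteq> {x \<in> preim K. h x = y}"
        using x0 y by (auto simp: kernel_def preim_def)
      show "(\<otimes>) (inv x0) ` {x \<in> preim K. h x = y} \<subseteq> kernel G H h"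
        using x0 by (auto simp: kernel_def preim_def)
    qed
    then show ?thesis by (simp add: bij_betw_same_card)
  qed
  have finP: "finite (preim K)" using fin unfolding preim_def by simp
  have "card (preim K) = (\<Sum>y\<in>h ` preim K. card {x \<in> preim K. h x = y})"
    using sum.image_gen[OF finP, of "\<lambda>_. 1::nat" h] by simp
  also have "\<dots> = (\<Sum>y\<in>K. card (kernel G H h))"
    unfolding image_preim[OF surj K] using fibre by (intro sum.cong) auto
  finally show ?thesis by simp
qed

lemma Sub_le_of_surj_hom:
  assumes surj: "h ` carrier G = carrier H" and fin: "finite (carrier G)"
  shows "Sub H \<le> card {K. subgroup K G \<and> kernel G H h \<subseteq> K}"
  unfolding Sub_def
proof (rule card_inj_on_le)
  show "inj_on preim {K. subgroup K H}"
  proof (rule inj_onI)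
    fix K L assume "K \<in> {K. subgroup K H}" "L \<in> {K. subgroup K H}" "preim K = preim L"
    then show "K = L" using image_preim[OF surj] subgroup.subset by (metis mem_Collect_eq)
  qed
  show "preim ` {K. subgroup K H} \<subseteq> {K. subgroup K G \<and> kernel G H h \<subseteq> K}"
    using preim_subgroup subgroup.one_closed by (auto simp: preim_def kernel_def)
  show "finite {K. subgroup K G \<and> kernel G H h \<subseteq> K}"
    by (rule finite_subset[of _ "Pow (carrier G)"]) (use subgroup.subset fin in auto)
qed

end

text \<open>A Sylow \<open>r\<close>-subgroup of the preimage of \<open>K\<close> is larger than the \<open>r\<close>-part of the kernel, so it maps onto \<open>K\<close>.
It is an \<open>r\<close>-group, and so cannot contain the kernel unless that is an \<open>r\<close>-group as well.\<close>

lemma (in group_hom) lift_prime_order: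
  assumes surj: "h ` carrier G = carrier H" and fin: "finite (carrier G)"
    and K: "subgroup K H" "card K = r" and r: "prime r" and nr: "\<And>j. card (kernel G H h) \<noteq> r ^ j"
  shows "\<exists>Y. subgroup Y G \<and> h ` Y = K \<and> \<not> kernel G H h \<subseteq> Y"
proof -
  interpret G: finite_group G by unfold_locales (rule fin)
  let ?R = "kernel G H h" and ?L = "preim K"
  have R: "subgroup ?R G" by (rule subgroup_kernel)
  have L: "subgroup ?L G" by (rule preim_subgroup[OF K(1)])
  have KH: "K \<subseteq> carrier H" by (rule subgroup.subset[OF K(1)])
  have cL: "card ?L = r * card ?R" using card_preim[OF surj fin KH] K(2) by simp
  obtain Y where Y: "Y \<in> G.sylows ?L r" using G.syl_nonempty[OF r L] by blast
  note Ys = G.sylD[OF Y]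
  have "\<not> ?R \<subseteq> Y"
  proof
    assume "?R \<subseteq> Y"
    then have "card ?R dvd r ^ multiplicity r (card ?L)"
      using G.card_subgroup_dvd[OF R Ys(1)] Ys(3) by simp
    then show False using nr divides_primepow_nat[OF r] by blast
  qed
  moreover have "h ` Y = K"
  proof -
    have hX: "subgroup (h ` Y) H" by (rule subgroup_img_is_subgroup[OF Ys(1)])
    have sub: "h ` Y \<subseteq> K" using Ys(2) unfolding preim_def by blast
    have finK: "finite K" using K(2) r by (metis card.infinite not_prime_0)
    have "card (h ` Y) dvd r" using H.card_subgroup_dvd[OF hX K(1) sub] K(2) by simp
    then consider "card (h ` Y) = 1" | "card (h ` Y) = r" using r by (metis prime_nat_iff)
    then show ?thesis
    proof cases
      case 1
      then obtain y where "h ` Y = {y}" using card_1_singletonE by blast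
      then have "h ` Y = {\<one>\<^bsub>H\<^esub>}" using subgroup.one_closed[OF hX] by auto
      then have "Y \<subseteq> ?R" using subgroup.subset[OF Ys(1)] unfolding kernel_def by blast
      then have "r ^ multiplicity r (card ?L) dvd card ?R"
        using G.card_subgroup_dvd[OF Ys(1) R] Ys(3) by simp
      moreover have "multiplicity r (card ?L) = Suc (multiplicity r (card ?R))"
        unfolding cL by (rule multiplicity_times_same) (use G.card_subgroup_pos[OF R] r in auto)
      ultimately have "Suc (multiplicity r (card ?R)) \<le> multiplicity r (card ?R)"
        using G.card_subgroup_pos[OF R] r multiplicity_geI[of "card ?R" r] prime_gt_1_nat[OF r] by simp
      then show ?thesis by simp
    next
      case 2
      show ?thesis by (rule card_subset_eq[OF finK sub]) (use 2 K in simp)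
    qed
  qed
  ultimately show ?thesis using Ys(1) by blast
qed

text \<open>The kernel is an \<open>r\<close>-group for at most one of the primes 2, 3 and 5, which have 15, 10 and 6 subgroups of that
order in the quotient. The two other primes supply at least 16 lifts.\<close>

lemma (in group_hom) Sub_ge_76_of_quotient:
  assumes surj: "h ` carrier G = carrier H" and fin: "finite (carrier G)"
    and H60: "simple_group_60 H" and R1: "kernel G H h \<noteq> {\<one>}"
  shows "76 \<le> Sub G"
proof -
  interpret G: finite_group G by unfold_locales (rule fin)
  interpret Q: simple_group_60 H by fact
  let ?R = "kernel G H h"
  have R: "subgroup ?R G" by (rule subgroup_kernel)
  have cR: "card ?R \<noteq> 1" using R1 subgroup.one_closed[OF R] by (metis card_1_singletonE singletonD)
  have pw: "r = s" if "card ?R = r ^ i" "card ?R = s ^ j" "prime r" "prime s" for r s i j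
  proof -
    have "i \<noteq> 0" using that(1) cR by (intro notI) simp
    then have "r dvd s ^ j" using that(1,2) by (metis dvd_power neq0_conv)
    then show ?thesis using that(3,4) prime_dvd_power primes_dvd_imp_eq by blast
  qed
  have p: "prime (2::nat)" "prime (3::nat)" "prime (5::nat)" by simp_all
  have excl: "card ?R \<noteq> s ^ i" if "card ?R = r ^ j" "r \<noteq> s" "prime r" "prime s" for r s i j
    using pw[OF that(1) _ that(3,4)] that(2) by blast
  obtain r s where rs: "r \<noteq> s" "prime r" "prime s" "16 \<le> Q.nsub r + Q.nsub s"
    "\<And>j. card ?R \<noteq> r ^ j" "\<And>j. card ?R \<noteq> s ^ j"
  proof (cases "\<exists>j. card ?R = 3 ^ j")
    case True
    then obtain j where j: "card ?R = 3 ^ j" by blast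
    show ?thesis
    proof (rule that[of 2 5])
      show "card ?R \<noteq> 2 ^ i" "card ?R \<noteq> 5 ^ i" for i by (rule excl[OF j]; simp)+
    qed (use Q.nsub_prime in simp_all)
  next
    case n3: False
    show ?thesis
    proof (cases "\<exists>j. card ?R = 5 ^ j")
      case True
      then obtain j where j: "card ?R = 5 ^ j" by blast
      show ?thesis
      proof (rule that[of 2 3])
        show "card ?R \<noteq> 2 ^ i" for i by (rule excl[OF j]; simp)
        show "card ?R \<noteq> 3 ^ i" for i using n3 by blast
      qed (use Q.nsub_prime in simp_all)
    next
      case False
      show ?thesis
      proof (rule that[of 3 5])
        show "card ?R \<noteq> 3 ^ i" "card ?R \<noteq> 5 ^ i" for i using n3 False by blast+
      qed (use Q.nsub_prime in simp_all)
    qed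
  qed
  \<comment> \<open>The order 1 stands for the trivial subgroup, which does not contain the kernel either.\<close>
  define \<K> where "\<K> = {K. subgroup K H \<and> card K \<in> {1, r, s}}"
  have "\<exists>Y. subgroup Y G \<and> h ` Y = K \<and> \<not> ?R \<subseteq> Y" if "K \<in> \<K>" for K
  proof -
    have K: "subgroup K H" "card K = 1 \<or> card K = r \<or> card K = s" using that unfolding \<K>_def by auto
    show ?thesis
    proof (cases "card K = 1")
      case True
      then obtain y where "K = {y}" using card_1_singletonE by blast
      then have "K = {\<one>\<^bsub>H\<^esub>}" using subgroup.one_closed[OF K(1)] by auto
      moreover have "\<not> ?R \<subseteq> {\<one>}" using R1 subgroup.one_closed[OF R] by blast
      ultimately show ?thesis using G.triv_subgroup by (intro exI[of _ "{\<one>}"]) auto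
    next
      case False
      then show ?thesis
        using K(2) lift_prime_order[OF surj fin K(1) _ rs(2,5)] lift_prime_order[OF surj fin K(1) _ rs(3,6)] by blast
    qed
  qed
  then obtain f where f: "\<And>K. K \<in> \<K> \<Longrightarrow> subgroup (f K) G \<and> h ` f K = K \<and> \<not> ?R \<subseteq> f K" by metis
  have fin1: "finite {K. subgroup K G \<and> P K}" for P by simp
  have "card \<K> = (\<Sum>m\<in>{1, r, s}. Q.nsub m)"
    unfolding \<K>_def by (rule Q.sum_nsub_eq[symmetric]) simp
  also have "\<dots> = 1 + Q.nsub r + Q.nsub s"
    using rs(1) prime_gt_1_nat[OF rs(2)] prime_gt_1_nat[OF rs(3)] Q.nsub_1 by simp
  finally have "17 \<le> card \<K>" using rs(4) by simp
  also have "card \<K> \<le> card {K. subgroup K G \<and> \<not> ?R \<subseteq> K}"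
  proof (rule card_inj_on_le[of f])
    show "inj_on f \<K>" using f by (metis inj_onI)
    show "f ` \<K> \<subseteq> {K. subgroup K G \<and> \<not> ?R \<subseteq> K}" using f by blast
    show "finite {K. subgroup K G \<and> \<not> ?R \<subseteq> K}" by simp
  qed
  finally have "17 \<le> card {K. subgroup K G \<and> \<not> ?R \<subseteq> K}" .
  moreover have "59 \<le> card {K. subgroup K G \<and> ?R \<subseteq> K}"
    using Sub_le_of_surj_hom[OF surj fin] Q.Sub_60 by simp
  moreover have "Sub G = card {K. subgroup K G \<and> ?R \<subseteq> K} + card {K. subgroup K G \<and> \<not> ?R \<subseteq> K}"
  proof -
    have "{K. subgroup K G} = {K. subgroup K G \<and> ?R \<subseteq> K} \<union> {K. subgroup K G \<and> \<not> ?R \<subseteq> K}" by blast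
    moreover have "card ({K. subgroup K G \<and> ?R \<subseteq> K} \<union> {K. subgroup K G \<and> \<not> ?R \<subseteq> K})
      = card {K. subgroup K G \<and> ?R \<subseteq> K} + card {K. subgroup K G \<and> \<not> ?R \<subseteq> K}"
      by (rule card_Un_disjoint) auto
    ultimately show ?thesis unfolding Sub_def by simp
  qed
  ultimately show ?thesis by simp
qed

lemma (in group) subgroup_of_subgroup_iff:
  assumes "subgroup N G"
  shows "subgroup K (G\<lparr>carrier := N\<rparr>) \<longleftrightarrow> subgroup K G \<and> K \<subseteq> N"
  using incl_subgroup[OF assms] subgroup_incl[OF _ assms] subgroup.subset[of K "G\<lparr>carrier := N\<rparr>"] by auto

text \<open>Frattini argument: the conjugates in \<open>G\<close> of a Sylow subgroup \<open>P\<close> of \<open>N\<close> are conjugate already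
  in \<open>N\<close>, so the normalizer of \<open>P\<close> in \<open>G\<close> is not contained in \<open>N\<close>.\<close>

lemma (in finite_group) normalizer_in_of_normal_sylow:
  assumes N: "N \<lhd> G" "N \<noteq> carrier G" and p: "prime p" and P: "P \<in> sylows N p"
  shows "card (sylows N p) * card (normalizer_in (carrier G) P) = order G"
    "normalizer_in (carrier G) P \<inter> N = normalizer_in N P" "\<not> normalizer_in (carrier G) P \<subseteq> N"
proof -
  have NG: "subgroup N G" by (rule normal_imp_subgroup[OF N(1)])
  note Ps = sylD[OF P]
  have PG: "P \<subseteq> carrier G" by (rule subgroup.subset[OF Ps(1)])
  have NsubG: "N \<subseteq> carrier G" by (rule subgroup.subset[OF NG])
  have "(\<lambda>g. conj_set g P) ` carrier G = sylows N p"
  proof (intro equalityI subsetI)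
    fix Q assume "Q \<in> (\<lambda>g. conj_set g P) ` carrier G"
    then obtain g where g: "g \<in> carrier G" "Q = conj_set g P" by blast
    have "conj_set g P \<subseteq> N"
      using normal_invE(2)[OF N(1) g(1)] Ps(2) unfolding conj_set_def by blast
    then show "Q \<in> sylows N p"
      using g conj_set_subgroup[OF g(1) Ps(1)] card_conj_set[OF g(1) PG] Ps(3) unfolding sylows_def by simp
  next
    fix Q assume "Q \<in> sylows N p"
    then show "Q \<in> (\<lambda>g. conj_set g P) ` carrier G"
      using syl_conjugate[OF p NG P] NsubG by blast
  qed
  then show c: "card (sylows N p) * card (normalizer_in (carrier G) P) = order G"
    using conjugates_count[OF subgroup_self fin PG] by (simp add: order_def)
  show i: "normalizer_in (carrier G) P \<inter> N = normalizer_in N P"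
    using NsubG unfolding normalizer_in_def by blast
  show "\<not> normalizer_in (carrier G) P \<subseteq> N"
  proof
    assume "normalizer_in (carrier G) P \<subseteq> N"
    then have "normalizer_in (carrier G) P = normalizer_in N P" using i by blast
    then have "card N = card (carrier G)"
      using c card_syl_normalizer_in[OF p NG P] by (simp add: order_def)
    then show False using card_subset_eq[OF fin NsubG] N(2) by blast
  qed
qed

lemma (in finite_group) Sub_ge_76_of_normal:
  assumes N: "N \<lhd> G" "N \<noteq> carrier G" and N60: "simple_group_60 (G\<lparr>carrier := N\<rparr>)"
  shows "76 \<le> Sub G"
proof -
  have NG: "subgroup N G" by (rule normal_imp_subgroup[OF N(1)])
  interpret S: simple_group_60 "G\<lparr>carrier := N\<rparr>" by fact
  note iff = subgroup_of_subgroup_iff[OF NG]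
  have syl_eq: "S.sylows N p = sylows N p" for p
    unfolding S.sylows_def sylows_def iff by auto
  have c3: "card (sylows N 3) = 10" and c5: "card (sylows N 5) = 6"
    using S.n_syl_3 S.n_syl_5 unfolding syl_eq[symmetric] by simp_all
  have p: "prime (3::nat)" "prime (5::nat)" by simp_all
  let ?n = "normalizer_in (carrier G)"
  let ?A = "{K. subgroup K G \<and> K \<subseteq> N}" and ?B3 = "?n ` sylows N 3" and ?B5 = "?n ` sylows N 5"
  have cA: "card ?A = 59" using S.Sub_60 unfolding Sub_def iff by simp
  have inj: "inj_on ?n (sylows N q)" if q: "prime q" for q
  proof (rule inj_onI)
    fix P Q assume PQ: "P \<in> sylows N q" "Q \<in> sylows N q" "?n P = ?n Q"
    then have "normalizer_in N P = normalizer_in N Q"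
      using normalizer_in_of_normal_sylow(2)[OF N q PQ(1)] normalizer_in_of_normal_sylow(2)[OF N q PQ(2)] by simp
    then show "P = Q" using inj_onD[OF normalizer_in_inj[OF q NG]] PQ by blast
  qed
  have cB: "card ?B3 = 10" "card ?B5 = 6"
    using card_image[OF inj[OF p(1)]] card_image[OF inj[OF p(2)]] c3 c5 by simp_all
  have k3: "10 * card K = order G" if K: "K \<in> ?B3" for K
  proof -
    obtain P where "P \<in> sylows N 3" "K = ?n P" using K by blast
    then show ?thesis using normalizer_in_of_normal_sylow(1)[OF N p(1)] c3 by simp
  qed
  have k5: "6 * card K = order G" if K: "K \<in> ?B5" for K
  proof -
    obtain P where "P \<in> sylows N 5" "K = ?n P" using K by blast
    then show ?thesis using normalizer_in_of_normal_sylow(1)[OF N p(2)] c5 by simp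
  qed
  have pos: "0 < order G" by (simp add: order_gt_0_iff_finite)
  have d1: "?B3 \<inter> ?B5 = {}"
  proof -
    have False if "K \<in> ?B3" "K \<in> ?B5" for K using k3[OF that(1)] k5[OF that(2)] pos by simp
    then show ?thesis by blast
  qed
  have d2: "carrier G \<notin> ?B3 \<union> ?B5"
    using k3[of "carrier G"] k5[of "carrier G"] pos by (auto simp: order_def)
  have sub: "subgroup K G \<and> \<not> K \<subseteq> N" if K: "K \<in> ?B3 \<union> ?B5 \<union> {carrier G}" for K
  proof (cases "K = carrier G")
    case True
    then show ?thesis using subgroup_self N(2) subgroup.subset[OF NG] by blast
  next
    case False
    then obtain P q where P: "prime q" "P \<in> sylows N q" "K = ?n P" using K p by blast
    then show ?thesis
      using normalizer_in_subgroup[OF subgroup_self subgroup.subset[OF sylD(1)[OF P(2)]]]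
        normalizer_in_of_normal_sylow(3)[OF N P(1,2)] by simp
  qed
  have "card (?B3 \<union> ?B5 \<union> {carrier G}) = 17"
    using cB d1 d2 by (simp add: card_Un_disjoint)
  moreover have "card (?A \<union> (?B3 \<union> ?B5 \<union> {carrier G})) = card ?A + card (?B3 \<union> ?B5 \<union> {carrier G})"
  proof (rule card_Un_disjoint)
    show "?A \<inter> (?B3 \<union> ?B5 \<union> {carrier G}) = {}" using sub by blast
  qed auto
  moreover have "card (?A \<union> (?B3 \<union> ?B5 \<union> {carrier G})) \<le> Sub G"
    unfolding Sub_def
  proof (rule card_mono)
    show "finite {H. subgroup H G}" using finite_subgroups[of "\<lambda>_. True"] by simp
    show "?A \<union> (?B3 \<union> ?B5 \<union> {carrier G}) \<subseteq> {H. subgroup H G}" using sub by blast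
  qed
  ultimately show ?thesis using cA by simp
qed

section \<open>Nonsolvable groups with at most 75 subgroups\<close>

lemma comm_group_solvable:
  assumes "comm_group G"
  shows "solvable G"
proof -
  interpret comm_group G by fact
  have "(derived G ^^ 1) (carrier G) = {\<one>\<^bsub>G\<^esub>}"
    using derived_eq_singleton by simp
  then show ?thesis using solvable_iff_trivial_derived_seq by blast
qed

lemma (in group) solvable_of_normal:
  assumes N: "N \<lhd> G" and sN: "solvable (G\<lparr>carrier := N\<rparr>)" and sQ: "solvable (G Mod N)"
  shows "solvable G"
proof (rule solvable_condition[of "G\<lparr>carrier := N\<rparr>" G id "G Mod N" "\<lambda>x. N #> x"])
  interpret N: normal N G by fact
  have NG: "subgroup N G" by (rule normal_imp_subgroup[OF N])
  interpret GN: group "G\<lparr>carrier := N\<rparr>" by (rule subgroup_imp_group[OF NG])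
  interpret Q: group "G Mod N" by (rule N.factorgroup_is_group)
  show "group_hom (G\<lparr>carrier := N\<rparr>) G id"
    by unfold_locales (use subgroup.subset[OF NG] in \<open>auto simp: hom_def\<close>)
  show "group_hom G (G Mod N) (\<lambda>x. N #> x)"
    by unfold_locales (rule N.r_coset_hom_Mod)
  show "(\<lambda>x. N #> x) ` carrier G = carrier (G Mod N)" by (simp add: carrier_FactGroup)
  show "kernel G (G Mod N) (\<lambda>x. N #> x) \<subseteq> id ` carrier (G\<lparr>carrier := N\<rparr>)"
  proof
    fix x assume "x \<in> kernel G (G Mod N) (\<lambda>x. N #> x)"
    then have "x \<in> carrier G" "N #> x = N" unfolding kernel_def by auto
    then have "x \<in> N" using rcos_self[OF _ NG, of x] by simp
    then show "x \<in> id ` carrier (G\<lparr>carrier := N\<rparr>)" by simp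
  qed
qed (rule sN, rule sQ)

text \<open>The induction needs the quotient as a group on the same type; choosing representatives of cosets provides
one.\<close>

theorem nonsolvable_imp_simple_60:
  fixes G :: "'a monoid"
  assumes "group G" "finite (carrier G)" "\<not> solvable G" "Sub G \<le> 75"
  shows "simple_group_60 G"
  using assms
proof (induction "order G" arbitrary: G rule: less_induct)
  case less
  interpret group G by fact
  interpret finite_group G by unfold_locales fact
  have gt1: "1 < order G"
  proof (rule ccontr)
    assume "\<not> 1 < order G"
    moreover have "0 < order G" using less.prems(2) by (simp add: order_gt_0_iff_finite)
    ultimately have "carrier G = {\<one>\<^bsub>G\<^esub>}" using order_one_triv_iff by simp
    then show False using less.prems(3) solvable_seq.unity[of G] unfolding solvable_def by simp
  qed
  have simple: "N = carrier G \<or> N = {\<one>\<^bsub>G\<^esub>}" if N: "N \<lhd> G" for N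
  proof (rule ccontr)
    assume nt: "\<not> ?thesis"
    interpret N: normal N G by fact
    have NG: "subgroup N G" by (rule normal_imp_subgroup[OF N])
    have NsubG: "N \<subseteq> carrier G" by (rule subgroup.subset[OF NG])
    have finN: "finite N" using finite_subset[OF NsubG fin] .
    consider (sub) "\<not> solvable (G\<lparr>carrier := N\<rparr>)" | (quot) "\<not> solvable (G Mod N)"
      using solvable_of_normal[OF N] less.prems(3) by blast
    then show False
    proof cases
      case sub
      interpret GN: group "G\<lparr>carrier := N\<rparr>" by (rule subgroup_imp_group[OF NG])
      have "group_hom (G\<lparr>carrier := N\<rparr>) G id"
        by unfold_locales (use NsubG in \<open>auto simp: hom_def\<close>)
      then have "Sub (G\<lparr>carrier := N\<rparr>) \<le> Sub G" by (rule Sub_le_of_inj_hom) simp_all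
      moreover have "order (G\<lparr>carrier := N\<rparr>) < order G"
        using psubset_card_mono[OF fin] NsubG nt unfolding order_def by auto
      ultimately have "simple_group_60 (G\<lparr>carrier := N\<rparr>)"
        using less.hyps[of "G\<lparr>carrier := N\<rparr>"] GN.is_group finN sub less.prems(4) by simp
      then have "76 \<le> Sub G" using Sub_ge_76_of_normal[OF N] nt by blast
      then show False using less.prems(4) by simp
    next
      case quot
      let ?rep = "\<lambda>U. SOME g. g \<in> U"
      let ?Q = "flatten (G Mod N) ?rep"
      interpret M: group "G Mod N" by (rule N.factorgroup_is_group)
      interpret Q: group ?Q by (rule N.flatten_set_group_mod)
      have iso: "?rep \<in> iso (G Mod N) ?Q" by (rule N.flatten_set_group_mod_iso)
      have rep: "group_hom (G Mod N) ?Q ?rep"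
        by unfold_locales (use iso in \<open>simp add: iso_def\<close>)
      have rinj: "inj_on ?rep (carrier (G Mod N))" by (rule N.flatten_set_group_mod_inj)
      have rsurj: "?rep ` carrier (G Mod N) = carrier ?Q" using iso by (simp add: iso_def bij_betw_def)
      define h where "h = (\<lambda>x. ?rep (N #>\<^bsub>G\<^esub> x))"
      have "h \<in> hom G ?Q"
        using Group.hom_compose[OF N.r_coset_hom_Mod group_hom.homh[OF rep]] by (simp add: h_def comp_def)
      then interpret h: group_hom G ?Q h by unfold_locales
      have surj: "h ` carrier G = carrier ?Q"
        unfolding h_def rsurj[symmetric] carrier_FactGroup image_image ..
      have finQ: "finite (carrier ?Q)" unfolding surj[symmetric] using fin by simp
      have ker: "kernel G ?Q h = N"
      proof (intro equalityI subsetI)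
        fix x assume "x \<in> kernel G ?Q h"
        then have x: "x \<in> carrier G" "?rep (N #>\<^bsub>G\<^esub> x) = \<one>\<^bsub>?Q\<^esub>" unfolding kernel_def h_def by auto
        have "?rep (N #>\<^bsub>G\<^esub> x) = ?rep (\<one>\<^bsub>G Mod N\<^esub>)" using x(2) group_hom.hom_one[OF rep] by simp
        then have "N #>\<^bsub>G\<^esub> x = \<one>\<^bsub>G Mod N\<^esub>"
        proof (rule inj_onD[OF rinj])
          show "N #>\<^bsub>G\<^esub> x \<in> carrier (G Mod N)" using x(1) by (simp add: carrier_FactGroup)
          show "\<one>\<^bsub>G Mod N\<^esub> \<in> carrier (G Mod N)" by (rule M.one_closed)
        qed
        then have "N #>\<^bsub>G\<^esub> x = N" by simp
        then show "x \<in> N" using rcos_self[OF x(1) NG] by simp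
      next
        fix x assume x: "x \<in> N"
        then have "N #>\<^bsub>G\<^esub> x = \<one>\<^bsub>G Mod N\<^esub>" using N.rcos_const[OF _ x] by simp
        then have "h x = \<one>\<^bsub>?Q\<^esub>" unfolding h_def using group_hom.hom_one[OF rep] by simp
        then show "x \<in> kernel G ?Q h" using x NsubG unfolding kernel_def by auto
      qed
      have "\<not> solvable ?Q" using group_hom.inj_hom_imp_solvable[OF rep rinj] quot by blast
      moreover have "Sub ?Q \<le> Sub G"
      proof -
        have "card {K. subgroup K G \<and> kernel G ?Q h \<subseteq> K} \<le> Sub G"
          unfolding Sub_def by (rule card_mono) (use finite_subgroups[of "\<lambda>_. True"] in auto)
        then show ?thesis using h.Sub_le_of_surj_hom[OF surj fin] by simp
      qed
      moreover have "order ?Q < order G"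
      proof -
        have oG: "order G = order ?Q * card N"
        proof -
          have "h.preim (carrier ?Q) = carrier G" unfolding h.preim_def surj[symmetric] by blast
          then show ?thesis using h.card_preim[OF surj fin subset_refl] unfolding ker order_def by simp
        qed
        have "card N \<noteq> 1"
          using nt subgroup.one_closed[OF NG] by (metis card_1_singletonE singletonD)
        moreover have "card N \<noteq> 0" using oG gt1 by (intro notI) simp
        ultimately have "2 \<le> card N" by linarith
        then have "order ?Q * 2 \<le> order G" unfolding oG by (rule mult_le_mono2)
        moreover have "order ?Q \<noteq> 0" using oG gt1 by (intro notI) simp
        ultimately show ?thesis by linarith
      qed
      ultimately have "simple_group_60 ?Q"
        using less.hyps[of ?Q] Q.is_group finQ less.prems(4) by simp
      then have "76 \<le> Sub G" using h.Sub_ge_76_of_quotient[OF surj fin] nt unfolding ker by blast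
      then show False using less.prems(4) by simp
    qed
  qed
  interpret nonabelian_simple_group G
    by unfold_locales (use gt1 simple comm_group_solvable less.prems(3) in auto)
  show ?case
    by unfold_locales (use order_60[OF less.prems(4)] in auto)
qed

theorem theorem2p3:
  fixes G :: "('a, 'b) monoid_scheme"
  assumes "group G"
    and "finite (carrier G)"
    and "60 \<le> Sub G"
    and "Sub G \<le> 75"
  shows "solvable G"
proof (rule ccontr)
  assume ns: "\<not> solvable G"
  interpret group G by fact
  \<comment> \<open>The induction is stated for the plain record type, so additional fields are dropped first.\<close>
  let ?T = "\<lparr>carrier = carrier G, monoid.mult = (\<otimes>\<^bsub>G\<^esub>), one = \<one>\<^bsub>G\<^esub>\<rparr>"
  interpret T: group ?T
    by (rule groupI) (auto simp: m_assoc intro: l_inv_ex)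
  have GT: "group_hom G ?T id" and TG: "group_hom ?T G id"
    by unfold_locales (auto simp: hom_def)
  have "Sub ?T \<le> Sub G" "Sub G \<le> Sub ?T"
    by (rule Sub_le_of_inj_hom[OF TG], use assms(2) in auto) (rule Sub_le_of_inj_hom[OF GT], use assms(2) in auto)
  moreover have "\<not> solvable ?T"
    using group_hom.inj_hom_imp_solvable[OF GT] ns by auto
  ultimately have "simple_group_60 ?T"
    using nonsolvable_imp_simple_60[of ?T] T.is_group assms by simp
  then have "Sub ?T = 59" by (rule simple_group_60.Sub_60)
  then show False using \<open>Sub G \<le> Sub ?T\<close> assms(3) by simp
qed

end
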